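(* For a prime $p$, let $l_p$ denote the smallest positive integer $n$ (with $p\nmid n$) such that $q(n) \not\equiv 0 \pmod p$. Then $$l_p \le (\log p)^{\frac{131}{72} + o(1)} \quad \text{as } p \to \infty.$$
   Context: For a prime $p$ and an integer $n$ not divisible by $p$, the Fermat quotient is $q(n) = \frac{n^{p-1}-1}{p}$ (an integer by Fermat's little theorem). *)

theory Defs
  imports "HOL-Library.Landau_Symbols" "HOL-Number_Theory.Number_Theory"
begin

(* The division by p is exact when p is prime and does not divide n. *)
definition fermat_quotient :: "nat \<Rightarrow> int \<Rightarrow> int" where
  "fermat_quotient p n = (n ^ (p - 1) - 1) div int p"

definition least_nonvanishing :: "nat \<Rightarrow> nat" where
  "least_nonvanishing p =
     (LEAST n. n > 0 \<and> \<not> p dvd n \<and> \<not> [fermat_quotient p (int n) = 0] (mod int p))"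

lemma fermat_quotient_exact:
  assumes "prime p" "\<not> int p dvd n"
  shows "int p * fermat_quotient p n = n ^ (p - 1) - 1"
proof -
  define m where "m = nat (n mod int p)"
  have "p > 0"
    using assms(1) by (rule prime_gt_0_nat)
  then have m: "int m = n mod int p"
    unfolding m_def by simp
  have "\<not> int p dvd int m"
    using assms(2) unfolding m by (simp add: dvd_mod_iff)
  then have "\<not> p dvd m"
    by simp
  then have "[m ^ (p - 1) = 1] (mod p)"
    by (rule fermat_theorem[OF assms(1)])
  then have "[int (m ^ (p - 1)) = int 1] (mod int p)"
    by (simp only: cong_int_iff)
  then have "[(n mod int p) ^ (p - 1) = 1] (mod int p)"
    by (simp add: m)
  then have "[n ^ (p - 1) = 1] (mod int p)"
    by (simp add: cong_def power_mod)
  then have "int p dvd n ^ (p - 1) - 1"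
    by (simp add: cong_iff_dvd_diff)
  then show ?thesis
    unfolding fermat_quotient_def by simp
qed

(* The minimum is attained for every prime: n = p + 1 has nonzero Fermat quotient mod p. *)
lemma least_nonvanishing_witness:
  assumes "prime p"
  shows "\<exists>n>0. \<not> p dvd n \<and> \<not> [fermat_quotient p (int n) = 0] (mod int p)"
proof -
  let ?P = "int p"
  have p2: "p \<ge> 2" using assms prime_ge_2_nat by blast
  have nd: "\<not> p dvd p + 1"
    using p2 by (subst dvd_add_right_iff) auto
  have "\<exists>c. (1 + ?P) ^ k = 1 + int k * ?P + c * ?P ^ 2" for k
  proof (induction k)
    case 0
    show ?case by (rule exI[of _ 0]) simp
  next
    case (Suc k)
    then obtain c where "(1 + ?P) ^ k = 1 + int k * ?P + c * ?P ^ 2" by blast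
    then have "(1 + ?P) ^ Suc k = 1 + int (Suc k) * ?P + (c + int k + c * ?P) * ?P ^ 2"
      by (simp add: algebra_simps power2_eq_square)
    then show ?case by blast
  qed
  then obtain c where c: "(1 + ?P) ^ (p - 1) = 1 + int (p - 1) * ?P + c * ?P ^ 2" by blast
  have "fermat_quotient p (int (p + 1)) = (?P * (int (p - 1) + c * ?P)) div ?P"
    unfolding fermat_quotient_def using c
    by (simp add: algebra_simps power2_eq_square)
  also have "\<dots> = int (p - 1) + c * ?P"
    using p2 by simp
  finally have q: "fermat_quotient p (int (p + 1)) = int (p - 1) + c * ?P" .
  have "\<not> [fermat_quotient p (int (p + 1)) = 0] (mod ?P)"
  proof
    assume "[fermat_quotient p (int (p + 1)) = 0] (mod ?P)"
    then have "?P dvd int (p - 1)"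
      unfolding q cong_0_iff by (simp add: dvd_add_left_iff)
    then have "p dvd p - 1" by (simp only: int_dvd_int_iff)
    then show False using p2 by (auto dest: dvd_imp_le)
  qed
  with nd show ?thesis by (intro exI[of _ "p + 1"]) auto
qed

end

theory Submission
  imports
    Defs
    "HOL-Computational_Algebra.Computational_Algebra"
    "HOL-Analysis.Convex"
    "HOL-Real_Asymp.Real_Asymp"
begin

text \<open>
  If \<open>q(n) \<equiv> 0\<close> modulo \<open>p\<close> for all \<open>n \<le> y = (log p)\<^sup>\<kappa>\<close>, then, \<open>q\<close> turning products into sums, all
  \<open>y\<close>-smooth numbers lie in the group \<open>\<Gamma>\<close> of \<open>p\<close>-th powers modulo \<open>p\<^sup>2\<close>, so \<open>\<Gamma>\<close> has
  about \<open>X\<^sup>\<alpha>\<close> elements below \<open>X\<close>, where \<open>\<alpha> = 1 - 1/\<kappa>\<close>. This is too many for \<open>X = p^(131/72)\<close> and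
  \<open>\<kappa> > 131/72\<close>, because the number of these elements is \<open>O(p/H)\<close> for \<open>H = p^(13/72)\<close>.

  By Fourier analysis on \<open>\<int>/p\<^sup>2\<close> the bound \<open>O(p/H)\<close> follows from \<open>\<Sum>\<bar>S(d)\<bar> \<le> p\<close>, the sum being
  over \<open>0 < d < H\<close> and \<open>S(d)\<close> being the exponential sum over \<open>d \<Gamma>\<close>. Hoelder's inequality bounds the fourth power of
  the left-hand side by \<open>H\<^sup>2\<close> times the number \<open>R\<close> of pairs \<open>d, d' < H\<close> with \<open>q(d) \<equiv> q(d')\<close>
  times \<open>p\<close> times the additive energy of \<open>\<Gamma>\<close>.

  The additive energy is at most \<open>p^(27/11 + o(1))\<close>. Stepanov's method, applied to Mirimanoff's
  polynomial \<open>((1 - X)\<^sup>p - 1 + X\<^sup>p) / p\<close>, bounds how often its values are popular. The exponent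
  it gives is improved by counting triangles in the graph on \<open>\<Gamma>\<close> that joins elements with
  a popular difference.

  For \<open>R\<close> the assumption on small \<open>n\<close> enters again. Removing common factors and smooth factors leaves coprime
  pairs \<open>(u, v)\<close> of \<open>y\<close>-rough numbers with \<open>q(u) \<equiv> q(v)\<close>. Such pairs from a box can be multiplied
  with each other and with pairs of smooth numbers, with bounded multiplicity \<open>p^o(1)\<close>; sorting the primes into two
  classes keeps the products coprime, and there are at most \<open>p\<close> coprime pairs in a box of area \<open>p\<^sup>2\<close>.
  This gives \<open>R \<le> H p^((1 - 2\<alpha>)/30 + o(1))\<close>, which suffices by a narrow margin.
\<close>

section \<open>Stepanov's method for Mirimanoff's polynomial\<close>

text \<open>Put \<open>H = p^h\<close> and \<open>X = p^(2 - h)\<close>. About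
  \<open>X^\<alpha>\<close> elements below \<open>X\<close> contradict the bound
  \<open>O(p/H)\<close> when \<open>(2 - h) \<alpha> > 1 - h\<close>, which amounts to
  \<open>\<kappa> > 2 - h\<close>. So \<open>2 - h\<close> is the exponent obtained, and the range
  of \<open>d\<close> should be as long as possible. If \<open>R = H p^(r + o(1))\<close>, the bound
  for the sum of the \<open>\<bar>S(d)\<bar>\<close> needs \<open>3 h + r + 2 + 16/11 < 4\<close>,
  where \<open>16/11 = 27/11 - 1\<close> comes from the energy. Even \<open>r = 0\<close> would only
  allow \<open>h < 2/11\<close>; here \<open>r = (1 - 2 \<alpha>)/30 < 13/3930\<close>, and
  \<open>h = 13/72\<close> just fits.

  The 30 is \<open>5 * 6\<close>: a box of sides \<open>H\<close> has area \<open>p^(26/72)\<close>,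
  whose fifth power is below \<open>p^2\<close> while the sixth is not. So at least five copies of a
  box can be multiplied, and pairs of smooth numbers fill the area that is left over by a whole
  number of copies. The smooth numbers thus act twice, as the elements that crowd the group below
  \<open>X\<close> and as this filler.\<close>

declare mult_pCons_left [simp del] mult_pCons_right [simp del]

text \<open>There are more vectors of residues than tuples of values of the linear forms, so two
  vectors give the same tuple and their difference solves the homogeneous system. This produces the
  coefficients of Stepanov's auxiliary polynomial.\<close>

lemma pigeonhole_mod:
  fixes M :: "'k \<Rightarrow> 'i \<Rightarrow> int" and p :: nat
  assumes fin: "finite I" "finite K" and less: "card K < card I" and p: "p > 1"
  obtains l :: "'i \<Rightarrow> int"
  where "\<exists>i\<in>I. \<not> int p dvd l i" "\<And>k. k \<in> K \<Longrightarrow> int p dvd (\<Sum>i\<in>I. M k i * l i)"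
proof -
  define A where "A = PiE I (\<lambda>_. {0..<int p})"
  define B where "B = PiE K (\<lambda>_. {0..<int p})"
  define \<phi> where "\<phi> = (\<lambda>l. \<lambda>k\<in>K. (\<Sum>i\<in>I. M k i * l i) mod int p)"
  have "card A = p ^ card I" "card B = p ^ card K"
    using fin by (simp_all add: A_def B_def card_PiE)
  moreover have "finite B" unfolding B_def using fin by (intro finite_PiE) auto
  moreover have "\<phi> ` A \<subseteq> B"
    unfolding \<phi>_def B_def using p by (auto intro!: restrict_PiE_iff[THEN iffD2])
  ultimately have "\<not> inj_on \<phi> A"
    using less p by (metis card_inj_on_le linorder_not_le power_strict_increasing_iff)
  then obtain l1 l2 where l: "l1 \<in> A" "l2 \<in> A" "\<phi> l1 = \<phi> l2" "l1 \<noteq> l2"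
    by (auto simp: inj_on_def)
  then obtain i where i: "i \<in> I" "l1 i \<noteq> l2 i"
    unfolding A_def by (metis PiE_ext)
  have r: "l1 i \<in> {0..<int p}" "l2 i \<in> {0..<int p}"
    using l i unfolding A_def by (auto simp: PiE_def Pi_def)
  have "\<not> int p dvd l1 i - l2 i"
  proof
    assume "int p dvd l1 i - l2 i"
    then have "l1 i mod int p = l2 i mod int p" by (simp add: mod_eq_dvd_iff)
    then show False using r i by simp
  qed
  moreover have "int p dvd (\<Sum>j\<in>I. M k j * (l1 j - l2 j))" if "k \<in> K" for k
  proof -
    have "\<phi> l1 k = \<phi> l2 k" using l by simp
    then have "(\<Sum>j\<in>I. M k j * l1 j) mod int p = (\<Sum>j\<in>I. M k j * l2 j) mod int p"
      using that by (simp add: \<phi>_def)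
    then show ?thesis
      by (simp add: mod_eq_dvd_iff right_diff_distrib sum_subtractf)
  qed
  ultimately show ?thesis using that[of "\<lambda>j. l1 j - l2 j"] i by blast
qed

text \<open>The derivation \<open>X (1 - X) d/dX\<close>, under which the span of the monomials in \<open>1 - X\<close>, \<open>c\<close> and
  \<open>X\<^sup>p\<close> is stable modulo \<open>p\<close>.\<close>

definition theta :: "int poly \<Rightarrow> int poly" where
  "theta g = [:0, 1, -1:] * pderiv g"

lemma theta_add: "theta (g + h) = theta g + theta h"
  by (simp add: theta_def pderiv_add algebra_simps)

lemma theta_smult: "theta (smult k g) = smult k (theta g)"
  by (simp add: theta_def pderiv_smult)

lemma theta_mult: "theta (g * h) = theta g * h + g * theta h"
  by (simp add: theta_def pderiv_mult algebra_simps)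

lemma theta_power: "theta (g ^ k) = smult (of_nat k) (g ^ (k - 1) * theta g)"
proof (cases k)
  case (Suc n)
  show ?thesis unfolding theta_def Suc pderiv_power_Suc by (simp add: ac_simps)
qed (simp add: theta_def)

lemma funpow_theta_add: "(theta ^^ k) (g + h) = (theta ^^ k) g + (theta ^^ k) h"
  by (induction k) (simp_all add: theta_add)

lemma funpow_theta_smult: "(theta ^^ k) (smult c g) = smult c ((theta ^^ k) g)"
  by (induction k) (simp_all add: theta_smult)

lemma funpow_theta_0: "(theta ^^ k) 0 = 0"
  by (induction k) (simp_all add: theta_def)

lemma funpow_theta_sum: "(theta ^^ k) (sum f I) = (\<Sum>i\<in>I. (theta ^^ k) (f i))"
  by (induction I rule: infinite_finite_induct)
    (simp_all add: funpow_theta_add funpow_theta_0)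

text \<open>Each application of \<open>theta\<close> has to remove one factor \<open>X - x\<close>,
  since a factor left over vanishes at \<open>x\<close>. Hence the iterates detect multiplicities as
  derivatives do, wherever \<open>k!\<close> and \<open>x (1 - x)\<close> are units.\<close>

lemma poly_funpow_theta:
  "poly ((theta ^^ k) ([:-x, 1:] ^ k * h)) x = fact k * (x * (1 - x)) ^ k * poly h x"
proof (induction k arbitrary: h)
  case 0
  then show ?case by simp
next
  case (Suc k)
  define h1 where "h1 = [:0, 1, -1:] * (smult (of_nat (Suc k)) h + [:-x, 1:] * pderiv h)"
  have "theta ([:-x, 1:] ^ Suc k * h) = [:-x, 1:] ^ k * h1"
  proof -
    have "pderiv [:-x, 1:] = 1" by (simp add: pderiv_pCons)
    then show ?thesis
      unfolding theta_def h1_def pderiv_mult pderiv_power_Suc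
      by (simp add: algebra_simps smult_add_right smult_add_left)
  qed
  then have "(theta ^^ Suc k) ([:-x, 1:] ^ Suc k * h) = (theta ^^ k) ([:-x, 1:] ^ k * h1)"
    by (simp only: funpow_Suc_right o_apply)
  then have "poly ((theta ^^ Suc k) ([:-x, 1:] ^ Suc k * h)) x
      = fact k * (x * (1 - x)) ^ k * poly h1 x"
    using Suc.IH by simp
  also have "poly h1 x = x * (1 - x) * of_nat (Suc k) * poly h x"
    unfolding h1_def by (simp add: algebra_simps)
  finally show ?case by (simp add: algebra_simps)
qed

text \<open>Linear factors are split off one at a time within \<open>int poly\<close>, the error
  being a multiple of \<open>p\<close>, which replaces the passage to the residue field. The
  conditions \<open>D \<le> p\<close> and \<open>S \<subseteq> {2..<int p}\<close> make the factor
  in \<open>poly_funpow_theta\<close> a unit modulo \<open>p\<close>.\<close>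

lemma dvd_mod_prime_power_factor:
  fixes p :: nat and g :: "int poly"
  assumes p: "prime p" and fin: "finite S" and S: "S \<subseteq> {2..<int p}"
    and D: "D \<le> p" and van: "\<And>x j. x \<in> S \<Longrightarrow> j < D \<Longrightarrow> int p dvd poly ((theta ^^ j) g) x"
  shows "\<exists>h r. g = (\<Prod>x\<in>S. [:-x, 1:] ^ D) * h + smult (int p) r"
  using fin S van
proof (induction S rule: finite_induct)
  case empty
  show ?case by (intro exI[of _ g] exI[of _ 0]) simp
next
  case (insert x S)
  have ip: "prime (int p)" using p by simp
  define Q where "Q = (\<Prod>x\<in>S. [:-x, 1:] ^ D)"
  have "\<exists>h r. g = [:-x, 1:] ^ k * (Q * h) + smult (int p) r" if "k \<le> D" for k
    using that
  proof (induction k)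
    case 0
    have "\<exists>h r. g = (\<Prod>x\<in>S. [:-x, 1:] ^ D) * h + smult (int p) r"
      by (rule insert.IH) (use insert.prems in auto)
    then show ?case unfolding Q_def by simp
  next
    case (Suc k)
    then obtain h r where g: "g = [:-x, 1:] ^ k * (Q * h) + smult (int p) r" by auto
    have "int p dvd poly ((theta ^^ k) g) x"
      using insert.prems Suc by auto
    moreover have "poly ((theta ^^ k) g) x
       = fact k * (x * (1 - x)) ^ k * poly (Q * h) x + int p * poly ((theta ^^ k) r) x"
      by (subst g) (simp add: funpow_theta_add funpow_theta_smult poly_funpow_theta)
    ultimately have "int p dvd fact k * (x * (1 - x)) ^ k * poly (Q * h) x"
      by (metis dvd_add_times_triv_right_iff mult.commute)
    moreover have "\<not> int p dvd fact k"
    proof -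
      have "\<not> p dvd fact k" using p Suc D by (simp add: prime_dvd_fact_iff)
      then show ?thesis by (metis of_nat_dvd_iff of_nat_fact)
    qed
    moreover have "\<not> int p dvd x" "\<not> int p dvd 1 - x"
      using insert.prems(1) zdvd_not_zless[of x "int p"] zdvd_not_zless[of "x - 1" "int p"]
      by (auto simp: dvd_diff_commute)
    moreover have "\<not> int p dvd poly Q x"
    proof
      assume "int p dvd poly Q x"
      then obtain y where y: "y \<in> S" "int p dvd (x - y) ^ D"
        unfolding Q_def poly_prod using ip insert.hyps
        by (auto simp: prime_dvd_prod_iff)
      then have "int p dvd x - y" using ip prime_dvd_power by blast
      then have "x mod int p = y mod int p" by (simp add: mod_eq_dvd_iff)
      then show False using insert y by auto
    qed
    moreover have "\<not> int p dvd (x * (1 - x)) ^ k"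
      using calculation ip prime_dvd_power prime_dvd_mult_iff by metis
    ultimately have "int p dvd poly h x"
      using ip by (simp add: prime_dvd_mult_iff)
    then obtain t where t: "poly h x = int p * t" by blast
    \<comment> \<open>A root modulo \<open>p\<close> becomes an exact root after subtraction of the
      constant \<open>poly h x\<close>, which is a multiple of \<open>p\<close>.\<close>
    have "poly (h - [:poly h x:]) x = 0" by simp
    then obtain h' where h': "h - [:poly h x:] = [:-x, 1:] * h'"
      by (metis poly_eq_0_iff_dvd dvdE)
    have "h = [:-x, 1:] * h' + smult (int p) [:t:]"
      using h' t by (simp add: algebra_simps)
    then obtain T where "h = [:-x, 1:] * h' + smult (int p) T" by blast
    then have "g = [:-x, 1:] ^ Suc k * (Q * h') + smult (int p) ([:-x, 1:] ^ k * (Q * T) + r)"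
      by (subst g) (simp add: algebra_simps smult_add_right)
    then show ?case by blast
  qed
  from this[of D] show ?case
    using insert.hyps unfolding Q_def by (simp add: mult.assoc)
qed

text \<open>Take the last coefficient of \<open>h\<close> that is not a multiple of
  \<open>m\<close>, say the \<open>i\<close>-th. Since \<open>Q\<close> is monic, the coefficient of
  \<open>Q * h\<close> at \<open>degree Q + i\<close> is congruent to it, so \<open>g\<close>
  reaches that degree.\<close>

lemma degree_ge_of_monic_factor_mod:
  fixes Q h g r :: "int poly"
  assumes g: "g = Q * h + smult m r" and Q: "lead_coeff Q = 1" and nz: "\<not> [:m:] dvd g"
  shows "degree Q \<le> degree g"
proof -
  have "\<exists>i. \<not> m dvd coeff h i"
  proof (rule ccontr)
    assume "\<nexists>i. \<not> m dvd coeff h i"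
    then have "[:m:] dvd h" by (simp add: const_poly_dvd_iff)
    then have "[:m:] dvd Q * h + smult m r"
      by (intro dvd_add dvd_mult) (simp_all add: const_poly_dvd_iff)
    with nz g show False by simp
  qed
  moreover have "i \<le> degree h" if "\<not> m dvd coeff h i" for i
    using that by (metis dvd_0_right le_degree)
  ultimately obtain i where i: "\<not> m dvd coeff h i" and mx: "\<And>j. \<not> m dvd coeff h j \<Longrightarrow> j \<le> i"
    using ex_has_greatest_nat[of "\<lambda>i. \<not> m dvd coeff h i" _ "\<lambda>i. i" "Suc (degree h)"]
    by (metis less_Suc_eq_le)
  have "coeff (Q * h) (degree Q + i)
      = (\<Sum>j\<le>degree Q + i. coeff Q j * coeff h (degree Q + i - j))"
    by (simp add: coeff_mult)
  also have "\<dots> = coeff Q (degree Q) * coeff h i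
      + (\<Sum>j\<in>{..degree Q + i} - {degree Q}. coeff Q j * coeff h (degree Q + i - j))"
    by (subst sum.remove[of _ "degree Q"]) auto
  finally have eq: "coeff (Q * h) (degree Q + i) = coeff h i
      + (\<Sum>j\<in>{..degree Q + i} - {degree Q}. coeff Q j * coeff h (degree Q + i - j))"
    using Q by simp
  have "m dvd (\<Sum>j\<in>{..degree Q + i} - {degree Q}. coeff Q j * coeff h (degree Q + i - j))"
  proof (rule dvd_sum)
    fix j assume j: "j \<in> {..degree Q + i} - {degree Q}"
    show "m dvd coeff Q j * coeff h (degree Q + i - j)"
    proof (cases "j < degree Q")
      case True
      then have "i < degree Q + i - j" by simp
      then have "m dvd coeff h (degree Q + i - j)" using mx by (metis leD)
      then show ?thesis by simp
    next
      case False
      then show ?thesis using j by (simp add: coeff_eq_0)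
    qed
  qed
  then have "\<not> m dvd coeff (Q * h) (degree Q + i)"
    unfolding eq using i by (simp only: dvd_add_left_iff not_False_eq_True)
  then have "\<not> m dvd coeff g (degree Q + i)"
    unfolding g by (simp add: dvd_add_left_iff)
  then have "coeff g (degree Q + i) \<noteq> 0" by auto
  then show ?thesis by (meson le_degree le_add1 order_trans)
qed

lemma card_roots_mult_mod_le_degree:
  fixes p :: nat and g :: "int poly"
  assumes p: "prime p" and S: "S \<subseteq> {2..<int p}"
    and D: "D \<le> p" and van: "\<And>x j. x \<in> S \<Longrightarrow> j < D \<Longrightarrow> int p dvd poly ((theta ^^ j) g) x"
    and nz: "\<not> [:int p:] dvd g"
  shows "D * card S \<le> degree g"
proof -
  have fin: "finite S" using S finite_subset by blast
  obtain h r where g: "g = (\<Prod>x\<in>S. [:-x, 1:] ^ D) * h + smult (int p) r"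
    using dvd_mod_prime_power_factor[OF p fin S D van] by blast
  have "lead_coeff (\<Prod>x\<in>S. [:-x, 1:] ^ D) = 1"
    by (simp add: lead_coeff_prod lead_coeff_power)
  moreover have "degree (\<Prod>x\<in>S. [:-x, 1:] ^ D) = D * card S"
    by (subst degree_prod_eq_sum_degree) (auto simp: degree_power_eq)
  ultimately show ?thesis using degree_ge_of_monic_factor_mod[OF g] nz by metis
qed

section \<open>Mirimanoff's polynomial and the monomials stable under the derivation\<close>

locale mirimanoff =
  fixes p :: nat and c :: "int poly"
  assumes prime_p: "prime p" and odd_p: "odd p"
    and c_eq: "smult (int p) c = [:1, -1:] ^ p - 1 + monom 1 p"
begin

lemma p_ge_3: "p \<ge> 3"
  using prime_ge_2_nat[OF prime_p] odd_p by (cases "p = 2") auto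

lemma W_power_p: "[:1, -1:] ^ p = 1 - monom 1 p + smult (int p) c"
  using c_eq by (simp add: algebra_simps)

lemma pderiv_c: "pderiv c = monom 1 (p - 1) - [:1, -1:] ^ (p - 1)"
proof -
  obtain m where m: "p = Suc m" using p_ge_3 by (cases p) auto
  have "smult (int p) (pderiv c) = pderiv ([:1, -1:] ^ p - 1 + monom 1 p)"
    by (simp add: c_eq[symmetric] pderiv_smult)
  also have "\<dots> = smult (int p) (monom 1 (p - 1) - [:1, -1:] ^ (p - 1))"
  proof -
    have "pderiv [:1, -1:] = (-1 :: int poly)" by (simp add: pderiv_pCons one_pCons)
    then show ?thesis
      unfolding m pderiv_add pderiv_diff pderiv_power_Suc pderiv_monom
      by (simp add: smult_monom smult_diff_right del: of_nat_Suc)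
  qed
  finally have eq: "smult (int p) (pderiv c) = smult (int p) (monom 1 (p - 1) - [:1, -1:] ^ (p - 1))" .
  show ?thesis
  proof (rule poly_eqI)
    fix n
    show "coeff (pderiv c) n = coeff (monom 1 (p - 1) - [:1, -1:] ^ (p - 1)) n"
      using arg_cong[OF eq, of "\<lambda>q. coeff q n"] p_ge_3 by (simp only: coeff_smult) simp
  qed
qed

text \<open>Modulo \<open>p\<close> this is \<open>(X^p - 1) + (1 - X)\<close>, a combination of the
  functions already present. That is why the span of the monomials is stable.\<close>

lemma theta_c: "theta c = monom 1 p - [:0, 1:] - smult (int p) ([:0, 1:] * c)"
proof -
  obtain m where m: "p = Suc m" using p_ge_3 by (cases p) auto
  have X: "[:0, 1:] * monom 1 m = (monom 1 p :: int poly)"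
    unfolding m by (simp add: monom_Suc mult_pCons_left)
  have "theta c = [:1, -1:] * ([:0, 1:] * monom 1 (p - 1)) - [:0, 1:] * ([:1, -1:] * [:1, -1:] ^ (p - 1))"
  proof -
    have "[:0, 1, -1:] = [:1, -1:] * ([:0, 1:] :: int poly)" by (simp add: mult_pCons_left)
    then show ?thesis
      unfolding theta_def pderiv_c by (simp add: right_diff_distrib mult_ac)
  qed
  also have "[:1, -1:] * [:1, -1:] ^ (p - 1) = ([:1, -1:] ^ p :: int poly)"
    unfolding m by simp
  also have "[:0, 1:] * monom 1 (p - 1) = (monom 1 p :: int poly)" using X m by simp
  also have "[:1, -1:] * monom 1 p - [:0, 1:] * [:1, -1:] ^ p
     = monom 1 p - [:0, 1:] - smult (int p) ([:0, 1:] * c)"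
  proof -
    have W: "[:1, -1:] = 1 - ([:0, 1:] :: int poly)" by (simp add: one_pCons)
    show ?thesis unfolding W_power_p unfolding W by (simp add: algebra_simps)
  qed
  finally show ?thesis .
qed

text \<open>Only powers of \<open>X^p\<close> occur besides those of \<open>1 - X\<close> and
  \<open>c\<close>: modulo \<open>p\<close> they are constants for the derivation, and at integers
  they collapse to powers of \<open>X\<close> by Fermat's theorem.\<close>

definition mono :: "nat \<Rightarrow> nat \<Rightarrow> nat \<Rightarrow> int poly" where
  "mono a b e = [:1, -1:] ^ a * c ^ b * monom 1 (p * e)"

lemma theta_mono:
  "\<exists>r. theta (mono a b e) = smult (- int a) (mono a b e) + smult (int a) (mono (Suc a) b e)
     + smult (int b) (mono a (b - 1) (Suc e) + smult (-1) (mono a (b - 1) e) + mono (Suc a) (b - 1) e)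
     + smult (int p) r"
proof -
  let ?W = "[:1, -1:] :: int poly" and ?M = "monom 1 (p * e) :: int poly"
  have W: "theta (?W ^ a) = smult (int a) (?W ^ Suc a - ?W ^ a)"
  proof (cases a)
    case 0
    then show ?thesis by (simp add: theta_def)
  next
    case (Suc a')
    have "theta ?W = ?W * (?W - 1)"
      by (simp add: theta_def pderiv_pCons one_pCons mult_pCons_left)
    then show ?thesis
      unfolding theta_power Suc by (simp add: right_diff_distrib smult_diff_right mult_ac del: of_nat_Suc)
  qed
  have M: "\<exists>r. theta ?M = smult (int p) r"
  proof -
    have "monom (of_nat (p * e) * 1) (p * e - 1) = smult (int p) (smult (int e) (monom 1 (p * e - 1)))"
      by (simp add: smult_monom)
    then show ?thesis unfolding theta_def pderiv_monom by (metis mult_smult_right)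
  qed
  then obtain r where r: "theta ?M = smult (int p) r" by blast
  have C: "theta (c ^ b) = smult (int b) (c ^ (b - 1) * (monom 1 p - 1 + ?W))
      - smult (int p) (smult (int b) (c ^ (b - 1) * ([:0, 1:] * c)))"
  proof -
    have th: "theta c = (monom 1 p - 1 + ?W) - smult (int p) ([:0, 1:] * c)"
      unfolding theta_c by (simp add: one_pCons)
    show ?thesis
      unfolding theta_power th by (simp add: algebra_simps smult_diff_right smult_add_right)
  qed
  have Me: "monom 1 p * ?M = monom 1 (p * Suc e)"
    by (simp add: mult_monom algebra_simps)
  have "theta (mono a b e) = theta (?W ^ a) * (c ^ b * ?M) + ?W ^ a * theta (c ^ b) * ?M
      + ?W ^ a * c ^ b * theta ?M"
    unfolding mono_def theta_mult by (simp add: algebra_simps)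
  also have "\<dots> = smult (- int a) (mono a b e) + smult (int a) (mono (Suc a) b e)
     + smult (int b) (?W ^ a * c ^ (b - 1) * (monom 1 p * ?M) + smult (-1) (mono a (b - 1) e) + mono (Suc a) (b - 1) e)
     + smult (int p) (?W ^ a * c ^ b * r - ?W ^ a * smult (int b) (c ^ (b - 1) * ([:0, 1:] * c)) * ?M)"
    unfolding W C r mono_def by (simp add: algebra_simps smult_add_right smult_diff_right)
  finally show ?thesis unfolding Me mono_def by blast
qed

text \<open>Linear combinations, modulo \<open>p\<close>, of the monomials with
  \<open>a + b + e \<le> d\<close>. The rule \<open>adm_p\<close> absorbs all error terms, and
  \<open>theta\<close> raises \<open>d\<close> by one only.\<close>

inductive adm :: "nat \<Rightarrow> int poly \<Rightarrow> bool" where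
  adm_mono: "a + b + e \<le> d \<Longrightarrow> adm d (mono a b e)"
| adm_add: "adm d g \<Longrightarrow> adm d h \<Longrightarrow> adm d (g + h)"
| adm_smult: "adm d g \<Longrightarrow> adm d (smult k g)"
| adm_p: "adm d (smult (int p) g)"

lemma adm_theta: "adm d g \<Longrightarrow> adm (Suc d) (theta g)"
proof (induction rule: adm.induct)
  case (adm_mono a b e d)
  obtain r where r: "theta (mono a b e) = smult (- int a) (mono a b e) + smult (int a) (mono (Suc a) b e)
     + smult (int b) (mono a (b - 1) (Suc e) + smult (-1) (mono a (b - 1) e) + mono (Suc a) (b - 1) e)
     + smult (int p) r" using theta_mono by blast
  have "adm (Suc d) (smult (int b) (mono a (b - 1) (Suc e) + smult (-1) (mono a (b - 1) e)
     + mono (Suc a) (b - 1) e))"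
  proof (cases "b = 0")
    case True
    then show ?thesis using adm_p[of "Suc d" 0] by simp
  next
    case False
    then show ?thesis using adm_mono by (intro adm.intros) auto
  qed
  then show ?case unfolding r using adm_mono by (intro adm_add adm_smult adm_p adm.adm_mono) auto
qed (auto simp: theta_add theta_smult intro: adm.intros)

lemma adm_funpow_theta: "adm d g \<Longrightarrow> adm (d + j) ((theta ^^ j) g)"
  by (induction j) (auto dest: adm_theta)

text \<open>Where \<open>c\<close> has the value \<open>u\<close>, a monomial becomes
  \<open>u^b (1 - x)^a x^e\<close>, of degree at most \<open>d\<close> instead of about
  \<open>p d\<close>. As \<open>P\<close> depends on \<open>u\<close> but not on \<open>x\<close>,
  vanishing at all points with this value costs only \<open>d + 1\<close> linear conditions; this is
  the economy of Stepanov's method.\<close>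

lemma adm_eval:
  "adm d g \<Longrightarrow> \<exists>P. degree P \<le> d \<and> (\<forall>x. [poly c x = u] (mod int p) \<longrightarrow> [x ^ p = x] (mod int p)
     \<longrightarrow> [poly g x = poly P x] (mod int p))"
proof (induction rule: adm.induct)
  case (adm_mono a b e d)
  define P where "P = smult (u ^ b) ([:1, -1:] ^ a * monom 1 e)"
  have "degree P \<le> degree ([:1, -1:] ^ a * monom 1 e :: int poly)"
    unfolding P_def by (rule degree_smult_le)
  also have "\<dots> \<le> degree ([:1, -1:] ^ a :: int poly) + degree (monom 1 e :: int poly)"
    by (rule degree_mult_le)
  also have "\<dots> \<le> a + e"
    by (simp add: degree_power_eq degree_monom_eq)
  finally have "degree P \<le> d" using adm_mono by simp
  moreover have "[poly (mono a b e) x = poly P x] (mod int p)"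
    if "[poly c x = u] (mod int p)" "[x ^ p = x] (mod int p)" for x
  proof -
    have "[(1 - x) ^ a * poly c x ^ b * (x ^ p) ^ e = (1 - x) ^ a * u ^ b * x ^ e] (mod int p)"
      using that by (intro cong_mult cong_pow cong_refl)
    moreover have "poly (mono a b e) x = (1 - x) ^ a * poly c x ^ b * (x ^ p) ^ e"
      unfolding mono_def by (simp add: poly_monom power_mult)
    moreover have "poly P x = (1 - x) ^ a * u ^ b * x ^ e"
      unfolding P_def by (simp add: poly_monom)
    ultimately show ?thesis by simp
  qed
  ultimately show ?case by blast
next
  case (adm_add d g h)
  then obtain P Q where "degree P \<le> d" "degree Q \<le> d"
    and "\<forall>x. [poly c x = u] (mod int p) \<longrightarrow> [x ^ p = x] (mod int p) \<longrightarrow> [poly g x = poly P x] (mod int p)"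
    and "\<forall>x. [poly c x = u] (mod int p) \<longrightarrow> [x ^ p = x] (mod int p) \<longrightarrow> [poly h x = poly Q x] (mod int p)"
    by blast
  then show ?case by (intro exI[of _ "P + Q"]) (auto intro: degree_add_le cong_add)
next
  case (adm_smult d g k)
  then obtain P where "degree P \<le> d"
    and "\<forall>x. [poly c x = u] (mod int p) \<longrightarrow> [x ^ p = x] (mod int p) \<longrightarrow> [poly g x = poly P x] (mod int p)"
    by blast
  then show ?case
    by (intro exI[of _ "smult k P"]) (auto intro: cong_scalar_left order_trans[OF degree_smult_le])
next
  case (adm_p d g)
  then show ?case by (intro exI[of _ 0]) (auto simp: cong_0_iff)
qed

text \<open>Vanishing of the first \<open>m\<close> coefficients modulo \<open>p\<close>, that is, divisibility by \<open>X\<^sup>m\<close> modulo \<open>p\<close>.\<close>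

definition low_van :: "nat \<Rightarrow> int poly \<Rightarrow> bool" where
  "low_van m g \<longleftrightarrow> (\<forall>i<m. int p dvd coeff g i)"

lemma low_van_add: "low_van m g \<Longrightarrow> low_van m h \<Longrightarrow> low_van m (g + h)"
  by (simp add: low_van_def)

lemma low_van_diff: "low_van m g \<Longrightarrow> low_van m h \<Longrightarrow> low_van m (g - h)"
  by (simp add: low_van_def)

lemma low_van_mult: "low_van m g \<Longrightarrow> low_van m (h * g)"
  by (auto simp: low_van_def coeff_mult intro!: dvd_sum)

lemma low_van_smult: "low_van m g \<Longrightarrow> low_van m (smult k g)"
  by (simp add: low_van_def)

lemma low_van_mono: "low_van m g \<Longrightarrow> k \<le> m \<Longrightarrow> low_van k g"
  by (simp add: low_van_def)

lemma low_van_sum: "(\<And>i. i \<in> I \<Longrightarrow> low_van m (f i)) \<Longrightarrow> low_van m (sum f I)"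
  by (auto simp: low_van_def coeff_sum intro!: dvd_sum)

lemma low_van_pderiv: "low_van m g \<Longrightarrow> low_van (m - 1) (pderiv g)"
  by (auto simp: low_van_def coeff_pderiv)

text \<open>Modulo \<open>p\<close> and \<open>X^p\<close>, the polynomial \<open>c\<close> is the
  power series of \<open>log (1 - X)\<close>, with derivative \<open>-1/(1 - X)\<close>. The
  independence shown below is that of \<open>1 - X\<close> and its logarithm.\<close>

lemma low_van_W_pderiv_c: "low_van (p - 1) ([:1, -1:] * pderiv c + 1)"
proof -
  obtain m where m: "p = Suc m" using p_ge_3 by (cases p) auto
  have "[:1, -1:] * [:1, -1:] ^ (p - 1) = ([:1, -1:] ^ p :: int poly)" unfolding m by simp
  then have "[:1, -1:] * pderiv c + 1 = [:1, -1:] * monom 1 (p - 1) + monom 1 p - smult (int p) c"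
    unfolding pderiv_c right_diff_distrib W_power_p by simp
  moreover have "low_van (p - 1) (monom 1 (p - 1))" "low_van (p - 1) (monom 1 p)"
    "low_van (p - 1) (smult (int p) c)"
    by (auto simp: low_van_def)
  ultimately show ?thesis by (auto intro!: low_van_add low_van_diff low_van_mult)
qed

lemma shift_sum:
  fixes f :: "nat \<Rightarrow> int" and w :: "int poly"
  shows "(\<Sum>b<t. smult (of_nat b * f b) (w * c ^ (b - 1)))
    = (\<Sum>b<t - 1. smult (of_nat (Suc b) * f (Suc b)) (w * c ^ b))"
  by (cases t) (simp_all add: sum.lessThan_Suc_shift del: sum.lessThan_Suc of_nat_Suc)

text \<open>The operator \<open>W d/dX + a\<close> with \<open>W = 1 - X\<close> annihilates \<open>W\<^sup>a\<close> and, modulo \<open>p\<close>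
  and high powers of \<open>X\<close>, acts on \<open>c\<close> as the derivative of \<open>-c\<close> as a formal variable.\<close>

lemma low_van_independent:
  fixes \<beta> :: "nat \<Rightarrow> nat" and l :: "nat \<Rightarrow> nat \<Rightarrow> int"
  assumes "(\<Sum>a<A. \<beta> a) \<le> m" "m \<le> p" "A \<le> p"
    and "low_van m (\<Sum>a<A. \<Sum>b<\<beta> a. smult (l a b) ([:1, -1:] ^ a * c ^ b))"
    and "a < A" "b < \<beta> a"
  shows "int p dvd l a b"
  using assms
proof (induction "\<Sum>a<A. \<beta> a" arbitrary: \<beta> l m a b)
  case 0
  then have "\<beta> a = 0" by auto
  with 0 show ?case by simp
next
  case (Suc s)
  let ?W = "[:1, -1:] :: int poly"
  define a0 where "a0 = a"
  have a0: "a0 < A" "\<beta> a0 > 0" using Suc unfolding a0_def by auto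
  \<comment> \<open>The operator with parameter \<open>a0\<close> shortens the block
    \<open>a0\<close> by its highest power of \<open>c\<close> and keeps the lengths of the other
    blocks; \<open>l'\<close> are the new coefficients.\<close>
  define \<beta>' where "\<beta>' = \<beta>(a0 := \<beta> a0 - 1)"
  define l' where "l' = (\<lambda>a b. (int a0 - int a) * l a b
      - (if Suc b < \<beta> a then of_nat (Suc b) * l a (Suc b) else 0))"
  define F where "F = (\<Sum>a<A. \<Sum>b<\<beta> a. smult (l a b) (?W ^ a * c ^ b))"
  define F1 where "F1 = (\<Sum>a<A. \<Sum>b<\<beta>' a. smult (l' a b) (?W ^ a * c ^ b))"
  have vF: "low_van m F" using Suc.prems unfolding F_def by simp
  have sum\<beta>: "(\<Sum>a<A. \<beta> a) = \<beta> a0 + (\<Sum>a\<in>{..<A} - {a0}. \<beta> a)"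
    using sum.remove[of "{..<A}" a0 \<beta>] a0 by simp
  moreover have "(\<Sum>a<A. \<beta>' a) = \<beta>' a0 + (\<Sum>a\<in>{..<A} - {a0}. \<beta>' a)"
    using sum.remove[of "{..<A}" a0 \<beta>'] a0 by simp
  moreover have "(\<Sum>a\<in>{..<A} - {a0}. \<beta>' a) = (\<Sum>a\<in>{..<A} - {a0}. \<beta> a)"
    unfolding \<beta>'_def by (intro sum.cong) auto
  ultimately have s: "s = (\<Sum>a<A. \<beta>' a)" using Suc.hyps(2) a0 unfolding \<beta>'_def by simp
  have m: "m \<ge> 1" "Suc s \<le> m" using Suc.prems Suc.hyps(2) by auto
  have \<beta>p: "\<beta> a \<le> p" if "a < A" for a
    using member_le_sum[of a "{..<A}" \<beta>] that Suc.prems by auto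
  have dW: "?W * pderiv (?W ^ a) = smult (- int a) (?W ^ a)" for a
  proof (cases a)
    case (Suc n)
    have "pderiv ?W = -1" by (simp add: pderiv_pCons one_pCons)
    then show ?thesis unfolding Suc pderiv_power_Suc by (simp add: ac_simps del: of_nat_Suc)
  qed simp
  have dc: "?W * pderiv (c ^ b) = smult (int b) (c ^ (b - 1) * (?W * pderiv c))" for b
  proof (cases b)
    case (Suc n)
    show ?thesis unfolding Suc pderiv_power_Suc by (simp add: ac_simps del: of_nat_Suc)
  qed simp
  have op_term: "?W * pderiv (?W ^ a * c ^ b) + smult (int a0) (?W ^ a * c ^ b)
     = smult (int a0 - int a) (?W ^ a * c ^ b) - smult (int b) (?W ^ a * c ^ (b - 1))
       + smult (int b) (?W ^ a * c ^ (b - 1) * (?W * pderiv c + 1))" for a b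
  proof -
    have "?W * pderiv (?W ^ a * c ^ b) = (?W * pderiv (?W ^ a)) * c ^ b + ?W ^ a * (?W * pderiv (c ^ b))"
      by (simp add: pderiv_mult algebra_simps)
    also have "\<dots> = smult (- int a) (?W ^ a * c ^ b) + smult (int b) (?W ^ a * c ^ (b - 1) * (?W * pderiv c))"
      unfolding dW dc by (simp add: algebra_simps)
    finally show ?thesis
      by (simp add: algebra_simps smult_add_right smult_add_left smult_diff_left)
  qed
  define R where "R = (\<Sum>a<A. \<Sum>b<\<beta> a. smult (l a b)
      (smult (int b) (?W ^ a * c ^ (b - 1) * (?W * pderiv c + 1))))"
  have inner: "(\<Sum>b<\<beta> a. smult (l a b) (smult (int a0 - int a) (?W ^ a * c ^ b)
        - smult (int b) (?W ^ a * c ^ (b - 1))))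
      = (\<Sum>b<\<beta>' a. smult (l' a b) (?W ^ a * c ^ b))" for a
  proof -
    have "(\<Sum>b<\<beta> a. smult (l a b) (smult (int a0 - int a) (?W ^ a * c ^ b)
        - smult (int b) (?W ^ a * c ^ (b - 1))))
      = (\<Sum>b<\<beta> a. smult ((int a0 - int a) * l a b) (?W ^ a * c ^ b))
        - (\<Sum>b<\<beta> a. smult (of_nat b * l a b) (?W ^ a * c ^ (b - 1)))"
      by (simp add: sum_subtractf smult_diff_right algebra_simps)
    also have "(\<Sum>b<\<beta> a. smult (of_nat b * l a b) (?W ^ a * c ^ (b - 1)))
      = (\<Sum>b<\<beta> a - 1. smult (of_nat (Suc b) * l a (Suc b)) (?W ^ a * c ^ b))"
      by (rule shift_sum)
    also have "\<dots> = (\<Sum>b<\<beta>' a. smult (if Suc b < \<beta> a then of_nat (Suc b) * l a (Suc b) else 0) (?W ^ a * c ^ b))"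
      by (rule sum.mono_neutral_cong_left) (auto simp: \<beta>'_def)
    also have "(\<Sum>b<\<beta> a. smult ((int a0 - int a) * l a b) (?W ^ a * c ^ b))
      = (\<Sum>b<\<beta>' a. smult ((int a0 - int a) * l a b) (?W ^ a * c ^ b))"
      by (cases "a = a0") (simp_all add: \<beta>'_def)
    finally show ?thesis
      unfolding l'_def by (simp add: sum_subtractf smult_diff_left)
  qed
  have "?W * pderiv F + smult (int a0) F
      = (\<Sum>a<A. \<Sum>b<\<beta> a. smult (l a b) (?W * pderiv (?W ^ a * c ^ b) + smult (int a0) (?W ^ a * c ^ b)))"
  proof -
    have ps: "pderiv (sum f I) = (\<Sum>i\<in>I. pderiv (f i))" for f :: "nat \<Rightarrow> int poly" and I
      by (induction I rule: infinite_finite_induct) (simp_all add: pderiv_add)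
    have ss: "smult k (sum f I) = (\<Sum>i\<in>I. smult k (f i))" for k and f :: "nat \<Rightarrow> int poly" and I
      by (induction I rule: infinite_finite_induct) (simp_all add: smult_add_right)
    show ?thesis
    unfolding F_def ps pderiv_smult
    by (simp add: sum_distrib_left ss sum.distrib smult_add_right del: smult_smult)
       (simp add: mult.commute)
  qed
  also have "\<dots> = F1 + R"
    unfolding op_term F1_def R_def inner[symmetric]
    by (simp add: sum.distrib smult_add_right)
  finally have "F1 = ?W * pderiv F + smult (int a0) F - R" by simp
  moreover have "low_van (m - 1) R"
    unfolding R_def
    using low_van_mono[OF low_van_W_pderiv_c, of "m - 1"] Suc.prems
    by (intro low_van_sum low_van_smult low_van_mult) auto
  moreover have "low_van (m - 1) (?W * pderiv F)" "low_van (m - 1) (smult (int a0) F)"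
    using vF low_van_pderiv low_van_mult low_van_smult low_van_mono
    by (blast, meson diff_le_self low_van_mono low_van_smult vF)
  ultimately have vF1: "low_van (m - 1) F1"
    using low_van_add low_van_diff by metis
  have IH: "int p dvd l' a b" if "a < A" "b < \<beta>' a" for a b
    by (rule Suc.hyps(1)[OF s, of "m - 1" l']) (use s m Suc.prems vF1 that in \<open>auto simp: F1_def\<close>)
  have ip: "prime (int p)" using prime_p by simp
  have ndvd: "\<not> int p dvd int (Suc b)" if "Suc b < p" for b
    using that by (metis int_dvd_int_iff nat_dvd_not_less zero_less_Suc)
  \<comment> \<open>In the block \<open>a0\<close> the factor \<open>a0 - a\<close> is zero, so only
    the shifted coefficients \<open>(b + 1) l a0 (b + 1)\<close> remain.\<close>
  have za0: "int p dvd l a0 (Suc b)" if "Suc b < \<beta> a0" for b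
  proof -
    have "int p dvd l' a0 b" using IH[OF a0(1)] that by (simp add: \<beta>'_def)
    then have "int p dvd int (Suc b) * l a0 (Suc b)"
      unfolding l'_def using that by (simp del: of_nat_Suc)
    moreover have "Suc b < p" using \<beta>p[OF a0(1)] that by simp
    ultimately show ?thesis using ip ndvd by (meson prime_dvd_mult_iff)
  qed
  \<comment> \<open>In another block \<open>l' a' b\<close> is the unit \<open>a0 - a'\<close> times
    \<open>l a' b\<close>, minus a multiple of the next coefficient. The coefficients are therefore
    recovered from the highest downwards.\<close>
  have za: "int p dvd l a' b" if "a' < A" "a' \<noteq> a0" "b < \<beta> a'" for a' b
    using that(3)
  proof (induction "\<beta> a' - b" arbitrary: b rule: less_induct)
    case less
    have "int p dvd l' a' b" using IH that less.prems by (simp add: \<beta>'_def)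
    moreover have "int p dvd (if Suc b < \<beta> a' then of_nat (Suc b) * l a' (Suc b) else 0)"
      using less.hyps[of "Suc b"] less.prems by auto
    ultimately have "int p dvd (int a0 - int a') * l a' b"
      unfolding l'_def by (metis dvd_diff_right_iff dvd_diff_left_iff)
    moreover have "\<not> int p dvd int a0 - int a'"
    proof
      assume "int p dvd int a0 - int a'"
      then have "int a0 mod int p = int a' mod int p" by (simp add: mod_eq_dvd_iff)
      moreover have "a0 < p" "a' < p" using a0 that Suc.prems by auto
      ultimately show False using that by simp
    qed
    ultimately show ?case using ip by (meson prime_dvd_mult_iff)
  qed
  \<comment> \<open>The operator annihilates \<open>W^a0\<close>, so \<open>l a0 0\<close> cannot be
    recovered from \<open>F1\<close>. The constant coefficient of \<open>F\<close> gives it once all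
    the others are known.\<close>
  have "coeff F 0 = (\<Sum>a<A. \<Sum>b<\<beta> a. l a b * coeff (?W ^ a * c ^ b) 0)"
    unfolding F_def by (simp add: coeff_sum)
  also have "\<dots> = (\<Sum>b<\<beta> a0. l a0 b * coeff (?W ^ a0 * c ^ b) 0)
      + (\<Sum>a\<in>{..<A} - {a0}. \<Sum>b<\<beta> a. l a b * coeff (?W ^ a * c ^ b) 0)"
    using sum.remove[of "{..<A}" a0 "\<lambda>a. \<Sum>b<\<beta> a. l a b * coeff (?W ^ a * c ^ b) 0"] a0 by simp
  also have "(\<Sum>b<\<beta> a0. l a0 b * coeff (?W ^ a0 * c ^ b) 0)
      = l a0 0 * coeff (?W ^ a0) 0 + (\<Sum>b<\<beta> a0 - 1. l a0 (Suc b) * coeff (?W ^ a0 * c ^ Suc b) 0)"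
    using a0(2) by (cases "\<beta> a0") (simp_all add: sum.lessThan_Suc_shift del: sum.lessThan_Suc)
  also have "coeff (?W ^ a0) 0 = 1" by (simp add: coeff_0_power)
  finally have e0: "coeff F 0 = l a0 0
      + (\<Sum>b<\<beta> a0 - 1. l a0 (Suc b) * coeff (?W ^ a0 * c ^ Suc b) 0)
      + (\<Sum>a\<in>{..<A} - {a0}. \<Sum>b<\<beta> a. l a b * coeff (?W ^ a * c ^ b) 0)" by simp
  have e1: "int p dvd coeff F 0" using vF m unfolding low_van_def by auto
  have e2: "int p dvd (\<Sum>b<\<beta> a0 - 1. l a0 (Suc b) * coeff (?W ^ a0 * c ^ Suc b) 0)"
    using za0 by (intro dvd_sum) auto
  have e3: "int p dvd (\<Sum>a\<in>{..<A} - {a0}. \<Sum>b<\<beta> a. l a b * coeff (?W ^ a * c ^ b) 0)"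
    using za by (intro dvd_sum dvd_mult2) auto
  have z0: "int p dvd l a0 0"
    using dvd_diff[OF dvd_diff[OF e1 e3] e2] unfolding e0 by (simp only: add_diff_cancel_right')
  show ?case
  proof (cases b)
    case 0
    then show ?thesis using z0 a0_def by simp
  next
    case (Suc b')
    then show ?thesis using za0[of b'] Suc.prems a0_def by simp
  qed
qed


lemma degree_c: "degree c \<le> p"
proof -
  have "degree (smult (int p) c) \<le> p"
    unfolding c_eq
    by (intro degree_add_le degree_diff_le) (simp_all add: degree_power_eq degree_monom_eq)
  then show ?thesis using p_ge_3 by simp
qed

lemma fermat_int: "[x ^ p = x] (mod int p)"
proof (cases "int p dvd x")
  case True
  then have "int p dvd x ^ p" using p_ge_3 by (meson dvd_power dvd_trans less_le_trans zero_less_numeral)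
  with True show ?thesis by (simp add: cong_iff_dvd_diff)
next
  case False
  have "int p * fermat_quotient p x = x ^ (p - 1) - 1"
    using fermat_quotient_exact[OF prime_p False] .
  then have "x * x ^ (p - 1) - x = int p * (x * fermat_quotient p x)"
    by (metis left_diff_distrib mult.commute mult.left_commute mult.right_neutral right_diff_distrib)
  moreover have "x * x ^ (p - 1) = x ^ p" using p_ge_3 by (cases p) auto
  ultimately show ?thesis by (simp add: cong_iff_dvd_diff)
qed

lemma degree_mono: "degree (mono a b e) \<le> a + b * p + p * e"
proof -
  have "degree (mono a b e) \<le> degree ([:1, -1:] ^ a * c ^ b) + degree (monom 1 (p * e) :: int poly)"
    unfolding mono_def by (rule degree_mult_le)
  also have "\<dots> \<le> (degree ([:1, -1:] ^ a :: int poly) + degree (c ^ b)) + p * e"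
    by (intro add_mono degree_mult_le) (simp add: degree_monom_eq)
  also have "degree ([:1, -1:] ^ a :: int poly) = a" by (simp add: degree_power_eq)
  also have "degree (c ^ b) \<le> b * p"
    using degree_power_le[of c b] degree_c by (metis le_trans mult.commute mult_le_mono1)
  finally show ?thesis by simp
qed

text \<open>The coefficients of \<open>X^(p e)\<close> up to \<open>X^(p e + p - 1)\<close> involve
  only blocks \<open>e' \<le> e\<close>. When the earlier blocks vanish modulo \<open>p\<close>, the
  block \<open>e\<close> vanishes up to order \<open>p\<close>, and \<open>A B \<le> p\<close>
  suffices for independence.\<close>

lemma low_van_sum_mono_imp_dvd:
  assumes AB: "A * B \<le> p" and "B \<ge> 1"
    and dvd: "[:int p:] dvd (\<Sum>e<E. \<Sum>a<A. \<Sum>b<B. smult (l a b e) (mono a b e))"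
    and "a < A" "b < B" "e < E"
  shows "int p dvd l a b e"
  using \<open>e < E\<close> \<open>a < A\<close> \<open>b < B\<close>
proof (induction e arbitrary: a b rule: less_induct)
  case (less e)
  define F where "F = (\<lambda>e. \<Sum>a<A. \<Sum>b<B. smult (l a b e) ([:1, -1:] ^ a * c ^ b))"
  have eq: "(\<Sum>a<A. \<Sum>b<B. smult (l a b e) (mono a b e)) = monom 1 (p * e) * F e" for e
    unfolding F_def mono_def by (simp add: sum_distrib_left mult_ac)
  have A: "A \<le> p" using AB \<open>B \<ge> 1\<close> by (metis dual_order.trans mult.right_neutral mult_le_mono2)
  have "low_van p (F e)"
    unfolding low_van_def
  proof (intro allI impI)
    fix i assume i: "i < p"
    have "coeff (\<Sum>e<E. monom 1 (p * e) * F e) (p * e + i)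
       = (\<Sum>e'<E. coeff (monom 1 (p * e') * F e') (p * e + i))"
      by (simp add: coeff_sum)
    also have "\<dots> = coeff (monom 1 (p * e) * F e) (p * e + i)
        + (\<Sum>e'\<in>{..<E} - {e}. coeff (monom 1 (p * e') * F e') (p * e + i))"
      using sum.remove[of "{..<E}" e] less.prems by simp
    also have "coeff (monom 1 (p * e) * F e) (p * e + i) = coeff (F e) i"
      by (simp add: coeff_monom_mult)
    finally have *: "coeff (\<Sum>e<E. monom 1 (p * e) * F e) (p * e + i) = coeff (F e) i
        + (\<Sum>e'\<in>{..<E} - {e}. coeff (monom 1 (p * e') * F e') (p * e + i))" .
    have "int p dvd (\<Sum>e'\<in>{..<E} - {e}. coeff (monom 1 (p * e') * F e') (p * e + i))"
    proof (rule dvd_sum)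
      fix e' assume e': "e' \<in> {..<E} - {e}"
      show "int p dvd coeff (monom 1 (p * e') * F e') (p * e + i)"
      proof (cases "e' < e")
        case True
        then have "int p dvd coeff (F e') j" for j
          unfolding F_def using less.IH[OF True] e' by (auto simp: coeff_sum intro!: dvd_sum dvd_mult2)
        then show ?thesis by (simp add: coeff_monom_mult)
      next
        case False
        then have "Suc e \<le> e'" using e' by auto
        then have "p * Suc e \<le> p * e'" by (rule mult_le_mono2)
        then have "p * e + i < p * e'" using i by simp
        then show ?thesis by (simp add: coeff_monom_mult)
      qed
    qed
    moreover have "int p dvd coeff (\<Sum>e<E. monom 1 (p * e) * F e) (p * e + i)"
      using dvd unfolding eq const_poly_dvd_iff by blast
    ultimately show "int p dvd coeff (F e) i"
      unfolding * by (simp add: dvd_add_left_iff)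
  qed
  then show ?case
    unfolding F_def
    using low_van_independent[of "\<lambda>_. B" A p "\<lambda>a b. l a b e" a b] AB A less.prems by simp
qed

text \<open>Stepanov's method: a polynomial in \<open>1 - X\<close>, \<open>c\<close> and \<open>X\<^sup>p\<close> that vanishes to order
  \<open>D\<close> wherever \<open>c\<close> takes a value in \<open>U\<close> exists by counting coefficients.\<close>

lemma stepanov:
  fixes U :: "int set"
  assumes U: "finite U" and AB: "A * B \<le> p" and B: "B \<ge> 1" and D: "D \<le> p"
    and count: "card U * D * (A + 2 * B + D) < A * B * B"
  shows "D * card {x \<in> {2..<int p}. \<exists>u\<in>U. [poly c x = u] (mod int p)} \<le> A + 2 * p * B"
proof -
  let ?S = "{x \<in> {2..<int p}. \<exists>u\<in>U. [poly c x = u] (mod int p)}"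
  \<comment> \<open>A strict bound for the degrees \<open>a + b + e + j\<close> from
    \<open>adm_eval\<close>. There are \<open>card U * D * T\<close> equations for
    \<open>A * B * B\<close> unknowns.\<close>
  define T where "T = A + 2 * B + D"
  define I where "I = {..<A} \<times> {..<B} \<times> {..<B}"
  define K where "K = U \<times> {..<D} \<times> {..<T}"
  define mn where "mn = (\<lambda>(a, b, e). mono a b e)"
  have "\<forall>u j i. \<exists>P. i \<in> I \<longrightarrow> j < D \<longrightarrow> degree P < T \<and> (\<forall>x. [poly c x = u] (mod int p) \<longrightarrow>
      [poly ((theta ^^ j) (mn i)) x = poly P x] (mod int p))"
  proof (intro allI)
    fix u j and i :: "nat \<times> nat \<times> nat"
    obtain a b e where i: "i = (a, b, e)" by (cases i)
    have "adm (a + b + e + j) ((theta ^^ j) (mn i))"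
      unfolding mn_def i by (auto intro: adm_funpow_theta adm_mono)
    from adm_eval[OF this, of u] fermat_int obtain P where P: "degree P \<le> a + b + e + j"
      "\<forall>x. [poly c x = u] (mod int p) \<longrightarrow> [poly ((theta ^^ j) (mn i)) x = poly P x] (mod int p)"
      by blast
    show "\<exists>P. i \<in> I \<longrightarrow> j < D \<longrightarrow> degree P < T \<and> (\<forall>x. [poly c x = u] (mod int p) \<longrightarrow>
      [poly ((theta ^^ j) (mn i)) x = poly P x] (mod int p))"
      using P by (intro exI[of _ P]) (auto simp: I_def i T_def)
  qed
  then obtain P where P: "\<And>u j i. i \<in> I \<Longrightarrow> j < D \<Longrightarrow> degree (P u j i) < T"
    "\<And>u j i x. i \<in> I \<Longrightarrow> j < D \<Longrightarrow> [poly c x = u] (mod int p)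
      \<Longrightarrow> [poly ((theta ^^ j) (mn i)) x = poly (P u j i) x] (mod int p)"
    by metis
  have "card K < card I"
    using count by (simp add: K_def I_def T_def card_cartesian_product algebra_simps)
  then obtain l where l: "\<exists>i\<in>I. \<not> int p dvd l i"
    and lK: "\<And>k. k \<in> K \<Longrightarrow> int p dvd (\<Sum>i\<in>I. (case k of (u, j, t) \<Rightarrow> \<lambda>i. coeff (P u j i) t) i * l i)"
  proof -
    assume *: "card K < card I"
      "\<And>l. \<exists>i\<in>I. \<not> int p dvd l i \<Longrightarrow> (\<And>k. k \<in> K \<Longrightarrow> int p dvd
        (\<Sum>i\<in>I. (case k of (u, j, t) \<Rightarrow> \<lambda>i. coeff (P u j i) t) i * l i)) \<Longrightarrow> thesis"
    have "finite I" "finite K" "p > 1" using U p_ge_3 by (simp_all add: I_def K_def)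
    then show thesis
      using pigeonhole_mod[of I K p "\<lambda>(u, j, t). \<lambda>i. coeff (P u j i) t"] * by blast
  qed
  define \<Psi> where "\<Psi> = (\<Sum>i\<in>I. smult (l i) (mn i))"
  have \<Psi>: "\<Psi> = (\<Sum>e<B. \<Sum>a<A. \<Sum>b<B. smult (l (a, b, e)) (mono a b e))"
  proof -
    have "\<Psi> = (\<Sum>a<A. \<Sum>b<B. \<Sum>e<B. smult (l (a, b, e)) (mono a b e))"
      by (simp add: \<Psi>_def I_def mn_def sum.cartesian_product split_def)
    also have "\<dots> = (\<Sum>a<A. \<Sum>e<B. \<Sum>b<B. smult (l (a, b, e)) (mono a b e))"
      by (intro sum.cong refl sum.swap)
    also have "\<dots> = (\<Sum>e<B. \<Sum>a<A. \<Sum>b<B. smult (l (a, b, e)) (mono a b e))"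
      by (rule sum.swap)
    finally show ?thesis .
  qed
  have "int p dvd poly ((theta ^^ j) \<Psi>) x" if x: "x \<in> ?S" and j: "j < D" for x j
  proof -
    obtain u where u: "u \<in> U" "[poly c x = u] (mod int p)" using x by auto
    have e1: "poly ((theta ^^ j) \<Psi>) x = (\<Sum>i\<in>I. l i * poly ((theta ^^ j) (mn i)) x)"
      unfolding \<Psi>_def funpow_theta_sum funpow_theta_smult by (simp add: poly_sum)
    have e2: "[(\<Sum>i\<in>I. l i * poly ((theta ^^ j) (mn i)) x) = (\<Sum>i\<in>I. l i * poly (P u j i) x)] (mod int p)"
      using P(2) u j by (intro cong_sum cong_mult cong_refl) auto
    have e3: "(\<Sum>i\<in>I. l i * poly (P u j i) x)
        = (\<Sum>t<T. x ^ t * (\<Sum>i\<in>I. coeff (P u j i) t * l i))"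
    proof -
      have "poly (P u j i) x = (\<Sum>t<T. coeff (P u j i) t * x ^ t)" if "i \<in> I" for i
        unfolding poly_altdef
        by (rule sum.mono_neutral_left) (use P(1)[OF that j, of u] in \<open>auto simp: coeff_eq_0\<close>)
      then have "(\<Sum>i\<in>I. l i * poly (P u j i) x)
          = (\<Sum>i\<in>I. \<Sum>t<T. x ^ t * (coeff (P u j i) t * l i))"
        by (simp add: sum_distrib_left mult_ac)
      then show ?thesis by (subst (asm) sum.swap) (simp add: sum_distrib_left)
    qed
    have e4: "int p dvd (\<Sum>t<T. x ^ t * (\<Sum>i\<in>I. coeff (P u j i) t * l i))"
    proof (rule dvd_sum, rule dvd_mult)
      fix t assume "t \<in> {..<T}"
      then show "int p dvd (\<Sum>i\<in>I. coeff (P u j i) t * l i)"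
        using lK[of "(u, j, t)"] u j by (simp add: K_def)
    qed
    show ?thesis
      using e4 unfolding e1 e3[symmetric] by (simp only: cong_dvd_iff[OF e2])
  qed
  \<comment> \<open>The crucial point of the method: a nontrivial choice of coefficients must not
    give a polynomial that is zero modulo \<open>p\<close>.\<close>
  moreover have "\<not> [:int p:] dvd \<Psi>"
    using l low_van_sum_mono_imp_dvd[OF AB B, where E = B and l = "\<lambda>a b e. l (a, b, e)"]
    unfolding \<Psi> I_def by auto
  ultimately have "D * card ?S \<le> degree \<Psi>"
    using D by (intro card_roots_mult_mod_le_degree[OF prime_p]) auto
  also have "degree \<Psi> \<le> A + 2 * p * B"
    unfolding \<Psi>_def
  proof (rule degree_sum_le)
    fix i assume "i \<in> I"
    then obtain a b e where i: "i = (a, b, e)" "a < A" "b < B" "e < B" by (auto simp: I_def)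
    have "degree (smult (l i) (mn i)) \<le> a + b * p + p * e"
      unfolding mn_def i using degree_mono[of a b e] by simp
    also have "\<dots> \<le> A + B * p + p * B"
      using i by (intro add_mono mult_le_mono) auto
    finally show "degree (smult (l i) (mn i)) \<le> A + 2 * p * B" by (simp add: algebra_simps)
  qed (simp add: I_def)
  finally show ?thesis .
qed

end

section \<open>Popular values of Mirimanoff's polynomial\<close>

context mirimanoff begin

text \<open>With \<open>J = card U\<close>, the parameters in \<open>stepanov\<close> are
  \<open>B\<close> near \<open>(p J)^(1/3)\<close>, \<open>A\<close> near \<open>p/B\<close> and
  \<open>D\<close> near \<open>B^2/(4 J)\<close>. Then \<open>J T\<close> is at most
  \<open>3 p B/D\<close>, of order \<open>p J/B\<close>, so \<open>T\<close> is of order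
  \<open>p/B\<close> and \<open>J T^3\<close> of order \<open>p^2\<close>. The constant is
  \<open>8 * 24^3\<close>, from \<open>p J < 8 B^3\<close> and
  \<open>B T \<le> 24 p\<close>.\<close>

lemma card_popular_values:
  fixes U :: "int set"
  assumes U: "U \<subseteq> {0..<int p}" and T: "T \<ge> 1"
    and pop: "\<And>u. u \<in> U \<Longrightarrow> T \<le> card {x \<in> {2..<int p}. [poly c x = u] (mod int p)}"
  shows "card U * T ^ 3 \<le> 110592 * p ^ 2"
proof -
  define N where "N = (\<lambda>u. {x \<in> {2..<int p}. [poly c x = u] (mod int p)})"
  define J where "J = card U"
  have fU: "finite U" using U finite_subset by blast
  define S where "S = {x \<in> {2..<int p}. \<exists>u\<in>U. [poly c x = u] (mod int p)}"
  have S: "S = (\<Union>u\<in>U. N u)" by (auto simp: S_def N_def)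
  have dis: "N u \<inter> N v = {}" if "u \<in> U" "v \<in> U" "u \<noteq> v" for u v
  proof -
    have "u \<in> {0..<int p}" "v \<in> {0..<int p}" using that U by auto
    then have "\<not> [u = v] (mod int p)" using that by (simp add: Cong.cong_def)
    then show ?thesis unfolding N_def by (auto dest: cong_trans cong_sym)
  qed
  have "J * T = (\<Sum>u\<in>U. T)" by (simp add: J_def)
  also have "\<dots> \<le> (\<Sum>u\<in>U. card (N u))" using pop unfolding N_def by (intro sum_mono)
  also have "\<dots> = card S"
  proof -
    have "finite (N u)" for u
      unfolding N_def by (rule finite_subset[of _ "{2..<int p}"]) auto
    then show ?thesis unfolding S using fU dis by (subst card_UN_disjoint) auto
  qed
  finally have JT: "J * T \<le> card S" .
  have "card S \<le> card {2..<int p}" unfolding S_def by (intro card_mono) auto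
  then have "card S \<le> p" by simp
  with JT have JTp: "J * T \<le> p" by simp
  \<comment> \<open>If \<open>J^2 > p\<close>, the trivial bound \<open>J T \<le> p\<close> is
    strong enough; if \<open>J^2 \<le> p\<close>, then \<open>B^2 \<le> p\<close>, so that
    \<open>B \<le> A\<close>.\<close>
  consider "J = 0" | "J \<ge> 1" "p < 1024" | "J ^ 2 > p" | "J \<ge> 1" "J ^ 2 \<le> p" "p \<ge> 1024" by linarith
  then have "J * T ^ 3 \<le> 110592 * p ^ 2"
  proof cases
    case 2
    have "T \<le> J * T" using 2 by simp
    then have "T \<le> p" using JTp by linarith
    then have "T ^ 2 \<le> p * 1024" using mult_mono[of T p T 1024] 2 by (simp add: power2_eq_square)
    then have "(J * T) * T ^ 2 \<le> p * (p * 1024)" using JTp by (intro mult_mono) auto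
    then show ?thesis by (simp add: power2_eq_square power3_eq_cube algebra_simps)
  next
    case 3
    have "p * (J * T ^ 3) \<le> J ^ 2 * (J * T ^ 3)" using 3 by (intro mult_right_mono) auto
    also have "\<dots> = (J * T) ^ 3" by (simp add: power_mult_distrib power2_eq_square power3_eq_cube)
    also have "\<dots> \<le> p ^ 3" using JTp by (rule power_mono) simp
    also have "\<dots> = p * p ^ 2" by (simp add: power2_eq_square power3_eq_cube)
    finally have "J * T ^ 3 \<le> p ^ 2" using p_ge_3 by simp
    then show ?thesis by simp
  next
    case 4
    define B where "B = (LEAST b. p * J < (b + 1) ^ 3)"
    have "p * J < (p * J + 1) ^ 3" using self_le_power[of "p * J + 1" 3] by simp
    then have B1: "p * J < (B + 1) ^ 3" unfolding B_def by (rule LeastI)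
    have B2: "B ^ 3 \<le> p * J"
    proof (cases B)
      case (Suc b)
      then have "\<not> p * J < (b + 1) ^ 3" unfolding B_def by (metis lessI not_less_Least)
      then show ?thesis using Suc by simp
    qed simp
    have B: "B \<ge> 1"
    proof (rule ccontr)
      assume "\<not> B \<ge> 1"
      then have "B = 0" by simp
      then have "p * J < 1" using B1 by simp
      then show False using 4 by simp
    qed
    have "(B + 1) ^ 3 \<le> (2 * B) ^ 3" using B by (intro power_mono) auto
    then have B3: "p * J < 8 * B ^ 3" using B1 by (simp add: power_mult_distrib)
    \<comment> \<open>The assumption \<open>p \<ge> 1024\<close> of this case makes
      \<open>B^2\<close> large enough compared with \<open>J\<close> for the rounded quotient
      \<open>D\<close> to be positive.\<close>
    have B8: "8 * J \<le> B ^ 2"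
    proof (rule ccontr)
      assume "\<not> 8 * J \<le> B ^ 2"
      then have "B ^ 2 \<le> 8 * J" by simp
      then have "(B ^ 2) ^ 3 \<le> (8 * J) ^ 3" by (rule power_mono) simp
      then have "B ^ 6 \<le> 512 * J ^ 3" by (simp add: power_mult_distrib flip: power_mult)
      moreover have "(p * J) ^ 2 < (8 * B ^ 3) ^ 2" using B3 by (intro power_strict_mono) auto
      then have "p ^ 2 * J ^ 2 < 64 * B ^ 6" by (simp add: power_mult_distrib flip: power_mult)
      moreover have "J ^ 3 = J * J ^ 2" by (simp add: power2_eq_square power3_eq_cube)
      ultimately have "p ^ 2 * J ^ 2 < (32768 * J) * J ^ 2" by linarith
      then have 5: "p ^ 2 < 32768 * J" by (simp only: mult_less_cancel2)
      moreover have "(J ^ 2) ^ 2 \<le> p ^ 2" using 4 by (intro power_mono) auto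
      moreover have "(J ^ 2) ^ 2 = J ^ 3 * J" by (simp add: power2_eq_square power3_eq_cube)
      ultimately have "J ^ 3 * J < 32768 * J" by linarith
      then have "J ^ 3 < 32 ^ 3" by (simp only: mult_less_cancel2) simp
      then have "J < 32" by (rule power_less_imp_less_base) simp
      then have "p ^ 2 < 1024 ^ 2" using 5 by simp
      then have "p < 1024" by (rule power_less_imp_less_base) simp
      with 4 show False by simp
    qed
    have "(B ^ 2) ^ 3 \<le> p ^ 3"
    proof -
      have "(B ^ 3) ^ 2 \<le> (p * J) ^ 2" using B2 by (intro power_mono) auto
      also have "\<dots> \<le> p ^ 2 * p" using 4 by (simp add: power_mult_distrib)
      also have "\<dots> = p ^ 3" by (simp add: power2_eq_square power3_eq_cube)
      finally show ?thesis by (simp flip: power_mult)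
    qed
    then have B2p: "B ^ 2 \<le> p" by (subst (asm) power_mono_iff) simp_all
    define A where "A = p div B"
    have AB: "A * B \<le> p" unfolding A_def by simp
    have BA: "B \<le> A" unfolding A_def using B2p B by (simp add: less_eq_div_iff_mult_less_eq power2_eq_square)
    \<comment> \<open>Subtracting 1 gives \<open>4 J D < B^2\<close>, which makes the comparison of
      equations and unknowns strict.\<close>
    define D where "D = (B ^ 2 - 1) div (4 * J)"
    have "4 * J \<le> B ^ 2 - 1" using B8 4 by simp
    then have D1: "D \<ge> 1" unfolding D_def using 4 by (simp add: less_eq_div_iff_mult_less_eq)
    have D2: "4 * J * D \<le> B ^ 2 - 1" unfolding D_def by simp
    have "B ^ 2 - 1 < 4 * J * (D + 1)"
      unfolding D_def using 4 by (metis add.commute dividend_less_times_div less_numeral_extra(1)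
          less_le_trans mult_pos_pos plus_1_eq_Suc mult_Suc_right zero_less_numeral)
    then have "B ^ 2 \<le> 4 * J * (D + 1)" by simp
    also have "\<dots> \<le> 4 * J * (2 * D)" using D1 by (intro mult_left_mono) auto
    finally have D3: "B ^ 2 \<le> 8 * (J * D)" by simp
    have DA: "D \<le> A"
    proof -
      have "4 * J * (D * B) \<le> B ^ 2 * B" using D2 B by (simp add: mult.assoc[symmetric])
      also have "\<dots> \<le> p * J" using B2 by (simp add: power2_eq_square power3_eq_cube)
      finally have "J * (4 * (D * B)) \<le> J * p" by (simp add: algebra_simps)
      then have "4 * (D * B) \<le> p" using 4 by simp
      then have "D * B \<le> p" by simp
      then show ?thesis unfolding A_def using B by (simp add: less_eq_div_iff_mult_less_eq)
    qed
    have Ap: "A \<le> p" unfolding A_def by simp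
    have "J * D * (A + 2 * B + D) \<le> J * D * (4 * A)" using BA DA by (intro mult_left_mono) auto
    also have "\<dots> = A * (4 * J * D)" by simp
    also have "\<dots> < A * B ^ 2"
    proof (rule mult_strict_left_mono)
      show "4 * J * D < B ^ 2" using D2 B8 4 by linarith
    qed (use B BA in simp)
    finally have "J * D * (A + 2 * B + D) < A * B * B" by (simp add: power2_eq_square)
    then have "D * card S \<le> A + 2 * p * B"
      unfolding S_def J_def using stepanov[OF fU AB B] DA Ap by simp
    also have "\<dots> \<le> p * B + 2 * p * B" using Ap B by (intro add_right_mono) (metis le_trans mult.right_neutral mult_le_mono2)
    finally have "D * card S \<le> 3 * p * B" by linarith
    then have *: "D * (J * T) \<le> 3 * p * B" using JT by (meson le_trans mult_le_mono2)
    have "B * (B * T) \<le> 8 * (J * D) * T" using D3 by (simp add: power2_eq_square mult.assoc[symmetric])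
    also have "\<dots> = 8 * (D * (J * T))" by simp
    also have "\<dots> \<le> 8 * (3 * p * B)" using * by (rule mult_le_mono2)
    also have "\<dots> = B * (24 * p)" by simp
    finally have "B * (B * T) \<le> B * (24 * p)" .
    then have "B * T \<le> 24 * p" using B by simp
    then have "(B * T) ^ 3 \<le> (24 * p) ^ 3" by (rule power_mono) simp
    then have "B ^ 3 * T ^ 3 \<le> 13824 * p ^ 3" by (simp add: power_mult_distrib)
    moreover have "(p * J) * T ^ 3 \<le> (8 * B ^ 3) * T ^ 3" using B3 by (intro mult_right_mono) auto
    moreover have "p ^ 3 = p * p ^ 2" by (simp add: power2_eq_square power3_eq_cube)
    ultimately have "p * (J * T ^ 3) \<le> p * (110592 * p ^ 2)" by linarith
    then show ?thesis using p_ge_3 by simp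
  qed simp
  then show ?thesis by (simp add: J_def)
qed

end

section \<open>Additive energy of the \<open>p\<close>-th powers modulo \<open>p\<^sup>2\<close>\<close>

lemma sum_card_fibres_mult:
  fixes f :: "'a \<Rightarrow> 'c" and g :: "'b \<Rightarrow> 'c"
  assumes "finite A" "finite B" "finite S" "f ` A \<subseteq> S"
  shows "(\<Sum>s\<in>S. card {a\<in>A. f a = s} * card {b\<in>B. g b = s}) = card {(a, b). a \<in> A \<and> b \<in> B \<and> f a = g b}"
proof -
  have "{(a, b). a \<in> A \<and> b \<in> B \<and> f a = g b} = (\<Union>s\<in>S. {a\<in>A. f a = s} \<times> {b\<in>B. g b = s})"
    using assms(4) by auto
  also have "card \<dots> = (\<Sum>s\<in>S. card ({a\<in>A. f a = s} \<times> {b\<in>B. g b = s}))"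
    using assms by (intro card_UN_disjoint) auto
  finally show ?thesis by (simp add: card_cartesian_product)
qed

lemma Cauchy_Schwarz_nat:
  fixes a b :: "'a \<Rightarrow> nat"
  shows "(\<Sum>s\<in>S. a s * b s)\<^sup>2 \<le> (\<Sum>s\<in>S. (a s)\<^sup>2) * (\<Sum>s\<in>S. (b s)\<^sup>2)"
proof -
  have "real ((\<Sum>s\<in>S. a s * b s)\<^sup>2) \<le> real ((\<Sum>s\<in>S. (a s)\<^sup>2) * (\<Sum>s\<in>S. (b s)\<^sup>2))"
    using Cauchy_Schwarz_ineq_sum[of "\<lambda>s. real (a s)" "\<lambda>s. real (b s)" S] by simp
  then show ?thesis by (simp only: of_nat_le_iff)
qed

lemma card_collisions:
  assumes "finite A"
  shows "(card A)\<^sup>2 \<le> card (f ` A) * card {(a, b). a \<in> A \<and> b \<in> A \<and> f a = f b}"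
proof -
  have "card A = (\<Sum>s\<in>f ` A. card {a\<in>A. f a = s})"
    using sum.image_gen[OF assms, of "\<lambda>_. 1 :: nat" f] by simp
  then have "(card A)\<^sup>2 \<le> (\<Sum>s\<in>f ` A. 1\<^sup>2) * (\<Sum>s\<in>f ` A. (card {a\<in>A. f a = s})\<^sup>2)"
    using Cauchy_Schwarz_nat[of "\<lambda>_. 1" "\<lambda>s. card {a\<in>A. f a = s}" "f ` A"] by simp
  also have "(\<Sum>s\<in>f ` A. (card {a\<in>A. f a = s})\<^sup>2) = card {(a, b). a \<in> A \<and> b \<in> A \<and> f a = f b}"
    using sum_card_fibres_mult[of A A "f ` A" f f] assms by (simp add: power2_eq_square)
  finally show ?thesis by simp
qed

section \<open>Units modulo p^2, Fermat quotients and p-th powers\<close>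

locale odd_prime =
  fixes p :: nat
  assumes prime_p: "prime p" and odd_p: "odd p"
begin

abbreviation P :: int where "P \<equiv> int p"
abbreviation Q :: int where "Q \<equiv> P * P"

lemma p_ge_3: "p \<ge> 3"
  using prime_ge_2_nat[OF prime_p] odd_p by (cases "p = 2") auto

lemma prime_P: "prime P" using prime_p by simp

lemma P_pos: "P > 0" using p_ge_3 by simp

definition fq :: "int \<Rightarrow> int" where "fq d = fermat_quotient p d mod P"

lemma fq_range: "0 \<le> fq d" "fq d < P" using P_pos by (simp_all add: fq_def)

lemma fq_in: "fq d \<in> {0..<P}" using fq_range by simp

lemma cong_P_mult: "[P * a = P * b] (mod Q) \<longleftrightarrow> [a = b] (mod P)"
  using P_pos by (simp add: cong_iff_dvd_diff right_diff_distrib[symmetric])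

lemma cong_Q_P: "[a = b] (mod Q) \<Longrightarrow> [a = b] (mod P)"
  by (rule cong_dvd_modulus) auto

lemma power_fq: "\<not> P dvd d \<Longrightarrow> [d ^ (p - 1) = 1 + P * fq d] (mod Q)"
proof -
  assume d: "\<not> P dvd d"
  have "d ^ (p - 1) = 1 + P * fermat_quotient p d"
    using fermat_quotient_exact[OF prime_p d] by simp
  moreover have "[P * fermat_quotient p d = P * fq d] (mod Q)"
    unfolding cong_P_mult fq_def by (simp add: Cong.cong_def)
  ultimately show ?thesis by (simp add: cong_add_lcancel)
qed

lemma fq_eq_iff:
  assumes "\<not> P dvd d" "\<not> P dvd e"
  shows "fq d = fq e \<longleftrightarrow> [d ^ (p - 1) = e ^ (p - 1)] (mod Q)"
proof
  assume "fq d = fq e"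
  then show "[d ^ (p - 1) = e ^ (p - 1)] (mod Q)"
    using power_fq[OF assms(1)] power_fq[OF assms(2)] by (metis cong_sym cong_trans)
next
  assume "[d ^ (p - 1) = e ^ (p - 1)] (mod Q)"
  then have "[1 + P * fq d = 1 + P * fq e] (mod Q)"
    using power_fq[OF assms(1)] power_fq[OF assms(2)] by (meson cong_sym cong_trans)
  then have "[fq d = fq e] (mod P)" by (simp add: cong_add_lcancel cong_P_mult)
  then show "fq d = fq e" by (simp add: Cong.cong_def fq_range)
qed

text \<open>The power \<open>d^p\<close> depends on \<open>d\<close> modulo \<open>p\<close> only
  and differs from \<open>d\<close> by the factor \<open>1 + P * fq d\<close>. Therefore the residue
  modulo \<open>p\<close> and the Fermat quotient determine a unit modulo \<open>p^2\<close>
  (\<open>unit_eqI\<close>), and the units with \<open>fq d = 0\<close> are the \<open>p\<close>-th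
  powers.\<close>

lemma unit_rep: "\<not> P dvd d \<Longrightarrow> [d ^ p = d + P * (d * fq d)] (mod Q)"
proof -
  assume d: "\<not> P dvd d"
  have "[d * d ^ (p - 1) = d * (1 + P * fq d)] (mod Q)"
    by (rule cong_scalar_left[OF power_fq[OF d]])
  moreover have "d * d ^ (p - 1) = d ^ p" using p_ge_3 by (cases p) auto
  ultimately show ?thesis by (simp add: algebra_simps)
qed

text \<open>One factor \<open>p\<close> comes from \<open>x - y\<close>; the other from the
  cofactor, a sum of \<open>p\<close> terms that are all congruent modulo \<open>p\<close>.\<close>

lemma pow_p_cong: "[x = y] (mod P) \<Longrightarrow> [x ^ p = y ^ p] (mod Q)"
proof -
  assume xy: "[x = y] (mod P)"
  have "x ^ p - y ^ p = (x - y) * (\<Sum>i<p. y ^ (p - Suc i) * x ^ i)"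
    by (rule power_diff_sumr2)
  moreover have "[(\<Sum>i<p. y ^ (p - Suc i) * x ^ i) = (\<Sum>i<p. x ^ (p - Suc i) * x ^ i)] (mod P)"
    using xy by (intro cong_sum cong_mult cong_pow cong_refl) (rule cong_sym)
  moreover have "(\<Sum>i<p. x ^ (p - Suc i) * x ^ i) = P * x ^ (p - 1)"
    by (simp add: power_add[symmetric])
  ultimately have "P dvd (\<Sum>i<p. y ^ (p - Suc i) * x ^ i)"
    by (metis cong_dvd_iff dvd_triv_left)
  then have "Q dvd x ^ p - y ^ p"
    using xy \<open>x ^ p - y ^ p = _\<close> by (simp add: cong_iff_dvd_diff mult_dvd_mono)
  then show ?thesis by (simp add: cong_iff_dvd_diff)
qed

lemma fermat_little: "\<not> P dvd x \<Longrightarrow> [x ^ (p - 1) = 1] (mod P)"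
  using fermat_quotient_exact[OF prime_p, of x] by (metis cong_iff_dvd_diff dvd_triv_left)

lemma pow_p_mod_P: "[x ^ p = x] (mod P)"
proof (cases "P dvd x")
  case True
  then have "P dvd x ^ p" using p_ge_3 by (meson dvd_power dvd_trans less_le_trans zero_less_numeral)
  with True show ?thesis by (simp add: cong_iff_dvd_diff)
next
  case False
  have "[x * x ^ (p - 1) = x * 1] (mod P)" by (rule cong_scalar_left[OF fermat_little[OF False]])
  moreover have "x * x ^ (p - 1) = x ^ p" using p_ge_3 by (cases p) auto
  ultimately show ?thesis by simp
qed

lemma not_dvd_pow: "\<not> P dvd x \<Longrightarrow> \<not> P dvd x ^ k"
  using prime_P prime_dvd_power by blast

lemma not_dvd_mult: "\<not> P dvd x \<Longrightarrow> \<not> P dvd y \<Longrightarrow> \<not> P dvd x * y"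
  using prime_P prime_dvd_mult_iff by blast

text \<open>So \<open>fq\<close> is constant on the cosets of the group of \<open>p\<close>-th
  powers. Conversely, by \<open>fq_class\<close>, it separates them.\<close>

lemma fq_mult_pow:
  assumes "\<not> P dvd x" "\<not> P dvd d"
  shows "fq (x ^ p * d) = fq d"
proof -
  have "[(x ^ (p - 1)) ^ p = 1 ^ p] (mod Q)"
    by (rule pow_p_cong[OF fermat_little[OF assms(1)]])
  then have "[(x ^ p) ^ (p - 1) * d ^ (p - 1) = 1 * d ^ (p - 1)] (mod Q)"
    by (intro cong_scalar_right) (simp add: power_mult[symmetric] mult.commute)
  then show ?thesis
    using assms by (subst fq_eq_iff) (auto simp: power_mult_distrib not_dvd_pow not_dvd_mult)
qed

lemma fq_uminus: "\<not> P dvd d \<Longrightarrow> fq (- d) = fq d"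
  using odd_p by (subst fq_eq_iff) auto

lemma fq_cong: "\<not> P dvd d \<Longrightarrow> [d = e] (mod Q) \<Longrightarrow> fq d = fq e"
  using cong_dvd_iff[OF cong_Q_P[of d e]] by (subst fq_eq_iff) (auto intro: cong_pow)

lemma unit_eqI:
  assumes "\<not> P dvd d" "[d = e] (mod P)" "fq d = fq e"
  shows "[d = e] (mod Q)"
proof -
  have e: "\<not> P dvd e" using assms cong_dvd_iff by blast
  have 1: "[d + P * (d * fq d) = e + P * (e * fq e)] (mod Q)"
    using unit_rep[OF assms(1)] unit_rep[OF e] pow_p_cong[OF assms(2)]
    by (meson cong_sym cong_trans)
  have "[P * (d * fq d) = P * (e * fq e)] (mod Q)"
    unfolding cong_P_mult assms(3) by (rule cong_scalar_right[OF assms(2)])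
  from cong_diff[OF 1 this] show ?thesis by simp
qed

text \<open>Index set for the \<open>p\<close>-th powers modulo \<open>p^2\<close>: the map
  \<open>x \<mapsto> x^p\<close> depends on \<open>x\<close> modulo \<open>p\<close> only and is
  injective on \<open>G\<close>.\<close>

definition G :: "int set" where "G = {1..<P}"

lemma finite_G [simp]: "finite G" by (simp add: G_def)

lemma card_G: "card G = p - 1" by (simp add: G_def)

lemma G_not_dvd: "x \<in> G \<Longrightarrow> \<not> P dvd x"
  by (auto simp: G_def dest: zdvd_imp_le)

lemma mod_in_G: "\<not> P dvd x \<Longrightarrow> x mod P \<in> G"
proof -
  assume "\<not> P dvd x"
  then have "x mod P \<noteq> 0" by (simp add: dvd_eq_mod_eq_0)
  moreover have "x mod P \<ge> 0" "x mod P < P"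
    using P_pos by (simp_all only: pos_mod_sign pos_mod_bound)
  ultimately show ?thesis unfolding G_def atLeastLessThan_iff by linarith
qed

lemma G_eqI: "x \<in> G \<Longrightarrow> y \<in> G \<Longrightarrow> [x = y] (mod P) \<Longrightarrow> x = y"
  by (auto simp: G_def Cong.cong_def)

lemma diff_pow_not_dvd: "x \<in> G \<Longrightarrow> y \<in> G \<Longrightarrow> x \<noteq> y \<Longrightarrow> \<not> P dvd x ^ p - y ^ p"
proof
  assume *: "x \<in> G" "y \<in> G" "x \<noteq> y" "P dvd x ^ p - y ^ p"
  then have "[x ^ p = y ^ p] (mod P)" by (simp add: cong_iff_dvd_diff)
  then have "[x = y] (mod P)" using pow_p_mod_P by (meson cong_sym cong_trans)
  with * G_eqI show False by blast
qed

definition k2 :: "int \<Rightarrow> int \<Rightarrow> int" where "k2 y z = fq (y ^ p - z ^ p)"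

lemma k2_sym: "y \<in> G \<Longrightarrow> z \<in> G \<Longrightarrow> y \<noteq> z \<Longrightarrow> k2 y z = k2 z y"
  using fq_uminus[OF diff_pow_not_dvd, of z y] by (simp add: k2_def)

text \<open>For \<open>y \<noteq> z\<close> the number of representations \<open>MM y z\<close> of \<open>y\<^sup>p - z\<^sup>p\<close> equals \<open>NN (k2 y z)\<close>, so that
  the additive energy of the \<open>p\<close>-th powers is \<open>(p - 1)\<^sup>2 + (p - 1) S2\<close>.\<close>

definition NN :: "int \<Rightarrow> nat" where
  "NN u = card {x \<in> {2..<P}. fq (x ^ p - (x - 1) ^ p) = u}"

definition MM :: "int \<Rightarrow> int \<Rightarrow> nat" where
  "MM y z = card {(g, h). g \<in> G \<and> h \<in> G \<and> [g ^ p - h ^ p = y ^ p - z ^ p] (mod Q)}"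

lemma scale_bij:
  assumes "t \<in> G"
  shows "bij_betw (\<lambda>x. (t * x) mod P) G G"
proof -
  have "inj_on (\<lambda>x. (t * x) mod P) G"
  proof (rule inj_onI)
    fix x y assume xy: "x \<in> G" "y \<in> G" "(t * x) mod P = (t * y) mod P"
    then have "P dvd t * (x - y)" by (simp add: mod_eq_dvd_iff right_diff_distrib)
    then have "P dvd x - y" using G_not_dvd[OF assms] prime_P prime_dvd_mult_iff by blast
    then show "x = y" using xy G_eqI by (simp add: cong_iff_dvd_diff)
  qed
  moreover have "(\<lambda>x. (t * x) mod P) ` G \<subseteq> G"
    using mod_in_G[OF not_dvd_mult[OF G_not_dvd[OF assms] G_not_dvd]] by auto
  ultimately show ?thesis
    by (simp add: bij_betw_def endo_inj_surj)
qed

lemma scale_diff: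
  assumes "t \<in> G"
  shows "[((t * x) mod P) ^ p - ((t * y) mod P) ^ p = t ^ p * (x ^ p - y ^ p)] (mod Q)"
proof -
  have "[((t * x) mod P) ^ p = (t * x) ^ p] (mod Q)" "[((t * y) mod P) ^ p = (t * y) ^ p] (mod Q)"
    by (intro pow_p_cong; simp add: Cong.cong_def)+
  from cong_diff[OF this] show ?thesis by (simp add: power_mult_distrib algebra_simps)
qed

lemma fq_scale:
  assumes "t \<in> G" "\<not> P dvd x ^ p - y ^ p"
  shows "fq (((t * x) mod P) ^ p - ((t * y) mod P) ^ p) = fq (x ^ p - y ^ p)"
proof -
  have "fq (t ^ p * (x ^ p - y ^ p)) = fq (x ^ p - y ^ p)"
    using fq_mult_pow G_not_dvd assms by blast
  moreover have "fq (t ^ p * (x ^ p - y ^ p)) = fq (((t * x) mod P) ^ p - ((t * y) mod P) ^ p)"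
    using assms by (intro fq_cong cong_sym[OF scale_diff] not_dvd_mult not_dvd_pow) (auto dest: G_not_dvd)
  ultimately show ?thesis by simp
qed

text \<open>A pair with difference \<open>d\<close> is \<open>d\<close> times a pair
  \<open>(x, x - 1)\<close>. This scaling multiplies the difference of the \<open>p\<close>-th
  powers by \<open>d^p\<close> and so preserves its Fermat quotient. The range of \<open>x\<close>
  starts at 2 because \<open>x - 1\<close> must be a unit as well.\<close>

lemma card_diff_fibre:
  assumes "d \<in> G"
  shows "card {(g, h). g \<in> G \<and> h \<in> G \<and> [g - h = d] (mod P) \<and> fq (g ^ p - h ^ p) = u} = NN u"
proof -
  let ?f = "\<lambda>x. ((d * x) mod P, (d * (x - 1)) mod P)"
  have sub: "{2..<P} \<subseteq> G" by (auto simp: G_def)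
  have unit: "\<not> P dvd x ^ p - (x - 1) ^ p" if "x \<in> {2..<P}" for x
    using that by (intro diff_pow_not_dvd) (auto simp: G_def)
  have "bij_betw ?f {x \<in> {2..<P}. fq (x ^ p - (x - 1) ^ p) = u}
     {(g, h). g \<in> G \<and> h \<in> G \<and> [g - h = d] (mod P) \<and> fq (g ^ p - h ^ p) = u}"
  proof (rule bij_betwI')
    fix x y assume x: "x \<in> {x \<in> {2..<P}. fq (x ^ p - (x - 1) ^ p) = u}"
      and y: "y \<in> {x \<in> {2..<P}. fq (x ^ p - (x - 1) ^ p) = u}"
    have "x \<in> G" "y \<in> G" using x y sub by auto
    then show "(?f x = ?f y) = (x = y)"
      using inj_on_eq_iff[OF bij_betw_imp_inj_on[OF scale_bij[OF assms]]] by auto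
  next
    fix x assume x: "x \<in> {x \<in> {2..<P}. fq (x ^ p - (x - 1) ^ p) = u}"
    have "(d * x) mod P \<in> G" "(d * (x - 1)) mod P \<in> G"
      using x assms bij_betwE[OF scale_bij[OF assms]] by (auto simp: G_def)
    moreover have "[(d * x) mod P - (d * (x - 1)) mod P = d] (mod P)"
    proof -
      have "[(d * x) mod P - (d * (x - 1)) mod P = d * x - d * (x - 1)] (mod P)"
        by (intro cong_diff) (simp_all add: Cong.cong_def)
      moreover have "d * x - d * (x - 1) = d" by (simp add: algebra_simps)
      ultimately show ?thesis by simp
    qed
    moreover have "fq (((d * x) mod P) ^ p - ((d * (x - 1)) mod P) ^ p) = u"
      using fq_scale[OF assms unit] x by auto
    ultimately show "?f x \<in> {(g, h). g \<in> G \<and> h \<in> G \<and> [g - h = d] (mod P) \<and> fq (g ^ p - h ^ p) = u}"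
      by blast
  next
    fix gh assume gh: "gh \<in> {(g, h). g \<in> G \<and> h \<in> G \<and> [g - h = d] (mod P) \<and> fq (g ^ p - h ^ p) = u}"
    obtain g h where eq: "gh = (g, h)" by (cases gh)
    have g: "g \<in> G" "h \<in> G" "[g - h = d] (mod P)" "fq (g ^ p - h ^ p) = u" using gh eq by auto
    have "g \<in> (\<lambda>x. (d * x) mod P) ` G"
      using bij_betw_imp_surj_on[OF scale_bij[OF assms]] g by simp
    then obtain x where x: "x \<in> G" "(d * x) mod P = g" by blast
    have "[d * (x - 1) = h] (mod P)"
    proof -
      have "[d * x = g] (mod P)" using x by (auto simp: Cong.cong_def)
      from cong_diff[OF this cong_sym[OF g(3)]] show ?thesis by (simp add: algebra_simps)
    qed
    then have h: "(d * (x - 1)) mod P = h" using g by (auto simp: Cong.cong_def G_def)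
    have "x \<noteq> 1" using h g by (auto simp: G_def)
    then have x2: "x \<in> {2..<P}" using x by (auto simp: G_def)
    have "fq (x ^ p - (x - 1) ^ p) = u"
      using fq_scale[OF assms unit[OF x2]] x h g by simp
    then show "\<exists>x\<in>{x \<in> {2..<P}. fq (x ^ p - (x - 1) ^ p) = u}. gh = ?f x"
      using x2 x h eq by auto
  qed
  then show ?thesis unfolding NN_def by (simp add: bij_betw_same_card)
qed

text \<open>The unit \<open>y^p - z^p\<close> is determined modulo \<open>p^2\<close> by its residue
  \<open>y - z\<close> modulo \<open>p\<close> and its Fermat quotient, which is the situation of
  \<open>card_diff_fibre\<close>.\<close>

lemma MM_eq:
  assumes "y \<in> G" "z \<in> G" "y \<noteq> z"
  shows "MM y z = NN (k2 y z)"
proof -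
  define d where "d = (y - z) mod P"
  have "\<not> P dvd y - z" using assms G_eqI by (auto simp: cong_iff_dvd_diff)
  then have d: "d \<in> G" unfolding d_def by (rule mod_in_G)
  have "[g ^ p - h ^ p = y ^ p - z ^ p] (mod Q) \<longleftrightarrow> [g - h = d] (mod P) \<and> fq (g ^ p - h ^ p) = k2 y z"
    if "g \<in> G" "h \<in> G" for g h
  proof -
    have 1: "[g ^ p - h ^ p = g - h] (mod P)" "[y ^ p - z ^ p = d] (mod P)"
      using cong_diff[OF pow_p_mod_P pow_p_mod_P] by (auto simp: d_def)
    have u: "\<not> P dvd y ^ p - z ^ p" using diff_pow_not_dvd assms by blast
    show ?thesis
    proof
      assume *: "[g ^ p - h ^ p = y ^ p - z ^ p] (mod Q)"
      then have "[g - h = d] (mod P)" using 1 by (meson cong_Q_P cong_sym cong_trans)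
      moreover have "fq (g ^ p - h ^ p) = k2 y z"
        unfolding k2_def using fq_cong[OF u cong_sym[OF *]] by simp
      ultimately show "[g - h = d] (mod P) \<and> fq (g ^ p - h ^ p) = k2 y z" by simp
    next
      assume *: "[g - h = d] (mod P) \<and> fq (g ^ p - h ^ p) = k2 y z"
      have "[y ^ p - z ^ p = g ^ p - h ^ p] (mod P)" using * 1 by (meson cong_sym cong_trans)
      then have "[y ^ p - z ^ p = g ^ p - h ^ p] (mod Q)"
        using * u by (intro unit_eqI) (auto simp: k2_def)
      then show "[g ^ p - h ^ p = y ^ p - z ^ p] (mod Q)" by (rule cong_sym)
    qed
  qed
  then have "{(g, h). g \<in> G \<and> h \<in> G \<and> [g ^ p - h ^ p = y ^ p - z ^ p] (mod Q)}
     = {(g, h). g \<in> G \<and> h \<in> G \<and> [g - h = d] (mod P) \<and> fq (g ^ p - h ^ p) = k2 y z}" by auto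
  then show ?thesis unfolding MM_def using card_diff_fibre[OF d] by simp
qed

lemma MM_diag: "y \<in> G \<Longrightarrow> MM y y = p - 1"
proof -
  have "{(g, h). g \<in> G \<and> h \<in> G \<and> [g ^ p - h ^ p = y ^ p - y ^ p] (mod Q)} = (\<lambda>g. (g, g)) ` G"
  proof -
    have "g = h" if "g \<in> G" "h \<in> G" "[g ^ p - h ^ p = 0] (mod Q)" for g h
      using that diff_pow_not_dvd[of g h] cong_Q_P[OF that(3)] by (auto simp: cong_0_iff)
    then show ?thesis by auto
  qed
  then show ?thesis unfolding MM_def by (simp add: card_image inj_on_def card_G)
qed

text \<open>All pairs with \<open>k2 g h = u\<close> are counted twice: by \<open>g\<close>, where
  scaling shows that the \<open>p - 1\<close> rows are equally long, and by \<open>g - h\<close>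
  modulo \<open>p\<close>, where each of the \<open>p - 1\<close> classes has \<open>NN u\<close>
  members.\<close>

lemma card_row:
  assumes g: "g \<in> G"
  shows "card {h \<in> G. h \<noteq> g \<and> k2 g h = u} = NN u"
proof -
  let ?R = "\<lambda>g. {h \<in> G. h \<noteq> g \<and> k2 g h = u}"
  have one: "1 \<in> G" using p_ge_3 by (simp add: G_def)
  have eq: "card (?R g) = card (?R 1)" if g: "g \<in> G" for g
  proof -
    have g1: "(g * 1) mod P = g" using g by (simp add: G_def)
    have b: "bij_betw (\<lambda>x. (g * x) mod P) G G" by (rule scale_bij[OF g])
    have k: "k2 g ((g * h) mod P) = k2 1 h" if "h \<in> G" "h \<noteq> 1" for h
      using fq_scale[OF g, of 1 h] diff_pow_not_dvd[OF one, of h] that g1 by (simp add: k2_def)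
    have ne: "(g * h) mod P = g \<longleftrightarrow> h = 1" if "h \<in> G" for h
      using bij_betw_imp_inj_on[OF b] that one g1 by (metis inj_onD)
    have "bij_betw (\<lambda>x. (g * x) mod P) (?R 1) (?R g)"
      unfolding bij_betw_def
    proof
      show "inj_on (\<lambda>x. (g * x) mod P) (?R 1)"
        using bij_betw_imp_inj_on[OF b] by (rule inj_on_subset) auto
      show "(\<lambda>x. (g * x) mod P) ` ?R 1 = ?R g"
      proof (intro equalityI subsetI)
        fix h assume "h \<in> (\<lambda>x. (g * x) mod P) ` ?R 1"
        then show "h \<in> ?R g" using k ne bij_betwE[OF b] by auto
      next
        fix h assume h: "h \<in> ?R g"
        then have "h \<in> (\<lambda>x. (g * x) mod P) ` G" using bij_betw_imp_surj_on[OF b] by simp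
        then obtain x where x: "x \<in> G" "(g * x) mod P = h" by blast
        then show "h \<in> (\<lambda>x. (g * x) mod P) ` ?R 1"
          using h ne[OF x(1)] k[OF x(1)] by (intro image_eqI[of _ _ x]) auto
      qed
    qed
    then show ?thesis by (simp add: bij_betw_same_card)
  qed
  define A where "A = {(g, h). g \<in> G \<and> h \<in> G \<and> g \<noteq> h \<and> k2 g h = u}"
  have finA: "finite A" unfolding A_def by (rule finite_subset[of _ "G \<times> G"]) auto
  have "A = (SIGMA g:G. ?R g)" unfolding A_def by auto
  then have "card A = (\<Sum>g\<in>G. card (?R g))" by simp
  also have "\<dots> = (p - 1) * card (?R 1)" using eq by (simp add: card_G)
  finally have 1: "card A = (p - 1) * card (?R 1)" .
  have A_UN: "A = (\<Union>d\<in>G. {(g, h). g \<in> G \<and> h \<in> G \<and> [g - h = d] (mod P) \<and> fq (g ^ p - h ^ p) = u})"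
    (is "A = (\<Union>d\<in>G. ?F d)")
  proof (intro equalityI subsetI)
    fix gh assume "gh \<in> A"
    then obtain g h where gh: "gh = (g, h)" "g \<in> G" "h \<in> G" "g \<noteq> h" "k2 g h = u" by (auto simp: A_def)
    then have "\<not> P dvd g - h" using G_eqI by (auto simp: cong_iff_dvd_diff)
    then have "(g - h) mod P \<in> G" by (rule mod_in_G)
    moreover have "[g - h = (g - h) mod P] (mod P)" by (simp add: Cong.cong_def)
    ultimately show "gh \<in> (\<Union>d\<in>G. ?F d)"
      using gh by (intro UN_I[of "(g - h) mod P"]) (auto simp: k2_def)
  next
    fix gh assume "gh \<in> (\<Union>d\<in>G. ?F d)"
    then obtain d g h where d: "d \<in> G" "gh = (g, h)" "g \<in> G" "h \<in> G" "[g - h = d] (mod P)"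
      "fq (g ^ p - h ^ p) = u" by auto
    have "g \<noteq> h"
    proof
      assume "g = h"
      then have "P dvd d" using cong_sym[OF d(5)] by (simp add: cong_0_iff)
      then show False using G_not_dvd d by blast
    qed
    then show "gh \<in> A" using d by (simp add: A_def k2_def)
  qed
  have "card A = (\<Sum>d\<in>G. card (?F d))"
    unfolding A_UN
  proof (rule card_UN_disjoint[OF finite_G])
    show "\<forall>d\<in>G. finite (?F d)"
      by (intro ballI, rule finite_subset[of _ "G \<times> G"]) auto
    show "\<forall>d\<in>G. \<forall>d'\<in>G. d \<noteq> d' \<longrightarrow> ?F d \<inter> ?F d' = {}"
    proof (intro ballI impI)
      fix d d' assume "d \<in> G" "d' \<in> G" "d \<noteq> d'"
      then have "\<not> [d = d'] (mod P)" using G_eqI by blast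
      then have n1: "\<not> ([x = d] (mod P) \<and> [x = d'] (mod P))" for x by (meson cong_sym cong_trans)
      have n2: "[fst z - snd z = d] (mod P) \<and> [fst z - snd z = d'] (mod P)"
        if "z \<in> ?F d" "z \<in> ?F d'" for z
        using that by (simp add: case_prod_beta)
      show "?F d \<inter> ?F d' = {}"
      proof (rule equals0I)
        fix z assume z: "z \<in> ?F d \<inter> ?F d'"
        from n1 n2[OF IntD1[OF z] IntD2[OF z]] show False by (rule notE)
      qed
    qed
  qed
  also have "\<dots> = (\<Sum>d\<in>G. NN u)"
  proof (rule sum.cong)
    fix d assume "d \<in> G"
    then show "card (?F d) = NN u" by (rule card_diff_fibre)
  qed simp
  also have "\<dots> = (p - 1) * NN u" by (simp add: card_G)
  finally have "(p - 1) * card (?R 1) = (p - 1) * NN u" using 1 by simp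
  then have "card (?R 1) = NN u" using p_ge_3 by simp
  then show ?thesis using eq[OF g] by simp
qed

definition S2 :: nat where "S2 = (\<Sum>u\<in>{0..<P}. (NN u)\<^sup>2)"
definition S3 :: nat where "S3 = (\<Sum>u\<in>{0..<P}. (NN u) ^ 3)"

lemma sum_row:
  fixes f :: "int \<Rightarrow> nat"
  assumes g: "g \<in> G"
  shows "(\<Sum>h\<in>G - {g}. f (k2 g h)) = (\<Sum>u\<in>{0..<P}. NN u * f u)"
proof -
  have "(\<Sum>h\<in>G - {g}. f (k2 g h)) = (\<Sum>u\<in>{0..<P}. \<Sum>h\<in>{h \<in> G - {g}. k2 g h = u}. f (k2 g h))"
    by (intro sum.group[symmetric]) (auto simp: k2_def fq_in fq_range)
  also have "\<dots> = (\<Sum>u\<in>{0..<P}. card {h \<in> G. h \<noteq> g \<and> k2 g h = u} * f u)"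
  proof (intro sum.cong refl)
    fix u
    have "{h \<in> G - {g}. k2 g h = u} = {h \<in> G. h \<noteq> g \<and> k2 g h = u}" by auto
    then show "(\<Sum>h\<in>{h \<in> G - {g}. k2 g h = u}. f (k2 g h)) = card {h \<in> G. h \<noteq> g \<and> k2 g h = u} * f u"
      by simp
  qed
  finally show ?thesis using card_row[OF g] by simp
qed

lemma sum_MM: "g \<in> G \<Longrightarrow> (\<Sum>h\<in>G. MM g h) = (p - 1) + S2"
proof -
  assume g: "g \<in> G"
  have "(\<Sum>h\<in>G. MM g h) = MM g g + (\<Sum>h\<in>G - {g}. MM g h)"
    using g by (simp add: sum.remove)
  also have "(\<Sum>h\<in>G - {g}. MM g h) = (\<Sum>h\<in>G - {g}. NN (k2 g h))"
    using g by (intro sum.cong) (auto simp: MM_eq)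
  finally show ?thesis using g sum_row[OF g, of NN] by (simp add: MM_diag S2_def power2_eq_square)
qed

lemma sum_MM_sq: "g \<in> G \<Longrightarrow> (\<Sum>h\<in>G. (MM g h)\<^sup>2) = (p - 1)\<^sup>2 + S3"
proof -
  assume g: "g \<in> G"
  have "(\<Sum>h\<in>G. (MM g h)\<^sup>2) = (MM g g)\<^sup>2 + (\<Sum>h\<in>G - {g}. (MM g h)\<^sup>2)"
    using g by (simp add: sum.remove)
  also have "(\<Sum>h\<in>G - {g}. (MM g h)\<^sup>2) = (\<Sum>h\<in>G - {g}. (NN (k2 g h))\<^sup>2)"
    using g by (intro sum.cong) (auto simp: MM_eq)
  finally show ?thesis using g sum_row[OF g, of "\<lambda>u. (NN u)\<^sup>2"]
    by (simp add: MM_diag S3_def power2_eq_square power3_eq_cube mult.assoc)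
qed

text \<open>Cauchy-Schwarz for the numbers of representations by \<open>y^p - g^p\<close> with
  \<open>y\<close> in \<open>Y\<close> and with \<open>y\<close> in \<open>G\<close>. The mixed sum
  is known exactly since all rows of \<open>MM\<close> have the same sum. Every subset thus has at
  least its proportional share of the total.\<close>

lemma energy_lower:
  assumes Y: "Y \<subseteq> G"
  shows "(card Y)\<^sup>2 * ((p - 1) + S2) \<le> (p - 1) * (\<Sum>y\<in>Y. \<Sum>z\<in>Y. MM y z)"
proof -
  let ?f = "\<lambda>(y, g). (y ^ p - g ^ p) mod Q"
  define e where "e = (p - 1) + S2"
  have finY: "finite Y" using finite_subset[OF Y finite_G] .
  have QQ: "Q > 0" using P_pos by simp
  define a where "a = (\<lambda>s. card {yg \<in> Y \<times> G. ?f yg = s})"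
  define b where "b = (\<lambda>s. card {yg \<in> G \<times> G. ?f yg = s})"
  have conv: "card {(u, v). u \<in> A \<times> G \<and> v \<in> B \<times> G \<and> ?f u = ?f v} =
      (\<Sum>y\<in>A. \<Sum>z\<in>B. MM y z)" if AB: "A \<subseteq> G" "B \<subseteq> G" for A B
  proof -
    have fin: "finite A" "finite B" using finite_subset[OF _ finite_G] AB by auto
    define T where "T = (SIGMA yz:A \<times> B. {(g, h). g \<in> G \<and> h \<in> G \<and> [g ^ p - h ^ p = fst yz ^ p - snd yz ^ p] (mod Q)})"
    have "bij_betw (\<lambda>((y, g), (z, h)). ((y, z), (g, h)))
       {(u, v). u \<in> A \<times> G \<and> v \<in> B \<times> G \<and> ?f u = ?f v} T"
    proof (rule bij_betw_byWitness[where f' = "\<lambda>((y, z), (g, h)). ((y, g), (z, h))"])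
      have *: "(y ^ p - g ^ p) mod Q = (z ^ p - h ^ p) mod Q \<longleftrightarrow> [g ^ p - h ^ p = y ^ p - z ^ p] (mod Q)" for y g z h
        unfolding mod_eq_dvd_iff cong_iff_dvd_diff
        by (subst dvd_minus_iff[symmetric]) (simp add: algebra_simps)
      show "(\<lambda>((y, g), z, h). ((y, z), g, h)) ` {(u, v). u \<in> A \<times> G \<and> v \<in> B \<times> G \<and> ?f u = ?f v} \<subseteq> T"
        unfolding T_def using * by auto
      show "(\<lambda>((y, z), g, h). ((y, g), z, h)) ` T \<subseteq> {(u, v). u \<in> A \<times> G \<and> v \<in> B \<times> G \<and> ?f u = ?f v}"
        unfolding T_def using * by auto
    qed auto
    then have "card {(u, v). u \<in> A \<times> G \<and> v \<in> B \<times> G \<and> ?f u = ?f v} = card T"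
      by (rule bij_betw_same_card)
    also have "\<dots> = (\<Sum>yz\<in>A \<times> B. MM (fst yz) (snd yz))"
      unfolding T_def MM_def
      by (subst card_SigmaI) (use fin in \<open>auto intro: finite_subset[of _ "G \<times> G"]\<close>)
    also have "\<dots> = (\<Sum>y\<in>A. \<Sum>z\<in>B. MM y z)"
      by (simp add: sum.cartesian_product split_def)
    finally show ?thesis .
  qed
  have im: "?f ` (A \<times> G) \<subseteq> {0..<Q}" for A using QQ by auto
  have ab: "(\<Sum>s\<in>{0..<Q}. a s * b s) = (\<Sum>y\<in>Y. \<Sum>z\<in>G. MM y z)"
    unfolding a_def b_def by (subst sum_card_fibres_mult[OF _ _ _ im]) (use finY conv[OF Y subset_refl] in auto)
  have aa: "(\<Sum>s\<in>{0..<Q}. a s * a s) = (\<Sum>y\<in>Y. \<Sum>z\<in>Y. MM y z)"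
    unfolding a_def by (subst sum_card_fibres_mult[OF _ _ _ im]) (use finY conv[OF Y Y] in auto)
  have bb: "(\<Sum>s\<in>{0..<Q}. b s * b s) = (\<Sum>y\<in>G. \<Sum>z\<in>G. MM y z)"
    unfolding b_def by (subst sum_card_fibres_mult[OF _ _ _ im]) (use conv[OF subset_refl subset_refl] in auto)
  have "(\<Sum>y\<in>Y. \<Sum>z\<in>G. MM y z) = card Y * e"
    using Y by (subst sum.cong[OF refl sum_MM]) (auto simp: e_def)
  moreover have "(\<Sum>y\<in>G. \<Sum>z\<in>G. MM y z) = (p - 1) * e"
    by (subst sum.cong[OF refl sum_MM]) (auto simp: e_def card_G)
  ultimately have "(card Y * e)\<^sup>2 \<le> (\<Sum>y\<in>Y. \<Sum>z\<in>Y. MM y z) * ((p - 1) * e)"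
    using Cauchy_Schwarz_nat[of a b "{0..<Q}"] ab aa bb by (simp add: power2_eq_square)
  then have "e * ((card Y)\<^sup>2 * e) \<le> e * ((p - 1) * (\<Sum>y\<in>Y. \<Sum>z\<in>Y. MM y z))"
    by (simp only: power2_eq_square mult_ac)
  moreover have "e > 0" using p_ge_3 by (simp add: e_def)
  ultimately show ?thesis unfolding e_def by (simp only: mult_le_cancel1)
qed

end

section \<open>Triangles in the graph of popular differences\<close>

context odd_prime begin

text \<open>Neighbourhoods in the graph on \<open>G\<close> whose edges have \<open>k2\<close> in
  \<open>U\<close>. By \<open>card_row\<close> this graph is regular, of degree
  \<open>lam U\<close>.\<close>

definition nbh :: "int set \<Rightarrow> int \<Rightarrow> int set" where
  "nbh U x = {y \<in> G. y \<noteq> x \<and> k2 x y \<in> U}"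

definition lam :: "int set \<Rightarrow> nat" where "lam U = (\<Sum>u\<in>U. NN u)"

definition tri_set :: "int set \<Rightarrow> int set \<Rightarrow> (int \<times> int \<times> int) set" where
  "tri_set U W = (SIGMA x:G. SIGMA y:nbh U x. {z \<in> nbh U x. z \<noteq> y \<and> k2 y z \<in> W})"

lemma nbh_subset: "nbh U x \<subseteq> G" by (auto simp: nbh_def)

lemma finite_nbh [simp]: "finite (nbh U x)"
  using finite_subset[OF nbh_subset finite_G] .

lemma card_nbh:
  assumes "x \<in> G" "U \<subseteq> {0..<P}"
  shows "card (nbh U x) = lam U"
proof -
  have "card (nbh U x) = (\<Sum>y\<in>nbh U x. 1)" by simp
  also have "\<dots> = (\<Sum>y\<in>G - {x}. if k2 x y \<in> U then 1 else 0)"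
    by (rule sum.mono_neutral_cong_left) (auto simp: nbh_def)
  also have "\<dots> = (\<Sum>u\<in>{0..<P}. NN u * (if u \<in> U then 1 else 0))"
    by (rule sum_row[OF assms(1)])
  also have "\<dots> = (\<Sum>u\<in>U. NN u)"
    using assms(2) by (intro sum.mono_neutral_cong_right) auto
  finally show ?thesis by (simp add: lam_def)
qed

lemma finite_tri_set [simp]: "finite (tri_set U W)"
  by (simp add: tri_set_def)

lemma card_tri_set:
  "card (tri_set U W) = (\<Sum>x\<in>G. \<Sum>y\<in>nbh U x. card {z \<in> nbh U x. z \<noteq> y \<and> k2 y z \<in> W})"
  by (simp add: tri_set_def)

text \<open>\<open>energy_lower\<close> for the neighbourhood of each vertex: the neighbours have
  many popular differences among themselves. The terms with \<open>y = z\<close> contribute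
  \<open>p - 1\<close> each; the others count triangles weighted by \<open>NN\<close> of the third
  side.\<close>

lemma lam_sq_le:
  assumes U: "U \<subseteq> {0..<P}"
  shows "(lam U)\<^sup>2 * S2 \<le> (p - 1)\<^sup>2 * lam U + (\<Sum>x\<in>G. \<Sum>y\<in>nbh U x. \<Sum>z\<in>nbh U x - {y}. NN (k2 y z))"
proof -
  have "(p - 1) * ((lam U)\<^sup>2 * ((p - 1) + S2)) = (\<Sum>x\<in>G. (lam U)\<^sup>2 * ((p - 1) + S2))"
    by (simp add: card_G)
  also have "\<dots> \<le> (\<Sum>x\<in>G. (p - 1) * (\<Sum>y\<in>nbh U x. \<Sum>z\<in>nbh U x. MM y z))"
    using energy_lower[OF nbh_subset] card_nbh[OF _ U] by (intro sum_mono) metis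
  also have "\<dots> = (p - 1) * (\<Sum>x\<in>G. \<Sum>y\<in>nbh U x. \<Sum>z\<in>nbh U x. MM y z)"
    by (simp add: sum_distrib_left)
  finally have "(lam U)\<^sup>2 * ((p - 1) + S2) \<le> (\<Sum>x\<in>G. \<Sum>y\<in>nbh U x. \<Sum>z\<in>nbh U x. MM y z)"
    using p_ge_3 by simp
  also have "\<dots> = (\<Sum>x\<in>G. \<Sum>y\<in>nbh U x. (p - 1) + (\<Sum>z\<in>nbh U x - {y}. NN (k2 y z)))"
  proof (intro sum.cong refl)
    fix x y assume xy: "x \<in> G" "y \<in> nbh U x"
    then have y: "y \<in> G" using nbh_subset by auto
    have "(\<Sum>z\<in>nbh U x. MM y z) = MM y y + (\<Sum>z\<in>nbh U x - {y}. MM y z)"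
      using xy by (simp add: sum.remove)
    also have "(\<Sum>z\<in>nbh U x - {y}. MM y z) = (\<Sum>z\<in>nbh U x - {y}. NN (k2 y z))"
      using y nbh_subset by (intro sum.cong refl MM_eq) auto
    finally show "(\<Sum>z\<in>nbh U x. MM y z) = (p - 1) + (\<Sum>z\<in>nbh U x - {y}. NN (k2 y z))"
      using MM_diag[OF y] by simp
  qed
  also have "\<dots> = (\<Sum>x\<in>G. lam U * (p - 1)) + (\<Sum>x\<in>G. \<Sum>y\<in>nbh U x. \<Sum>z\<in>nbh U x - {y}. NN (k2 y z))"
    using card_nbh[OF _ U] by (simp add: sum.distrib)
  also have "(\<Sum>x\<in>G. lam U * (p - 1)) = (p - 1)\<^sup>2 * lam U"
    by (simp add: card_G power2_eq_square)
  finally show ?thesis by (simp add: algebra_simps)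
qed

definition level :: "nat \<Rightarrow> int set" where
  "level i = {u \<in> {0..<P}. 2 ^ i \<le> NN u \<and> NN u < 2 ^ Suc i}"

lemma level_subset: "level i \<subseteq> {0..<P}" by (auto simp: level_def)

lemma finite_level [simp]: "finite (level i)"
  using finite_subset[OF level_subset] by simp

lemma NN_less: "NN u < p"
proof -
  have "NN u \<le> card {2..<P}" unfolding NN_def by (intro card_mono) auto
  then show ?thesis using p_ge_3 by simp
qed

lemma ex_level:
  assumes "u \<in> {0..<P}" "NN u > 0" "p \<le> 2 ^ l"
  shows "\<exists>i<l. u \<in> level i"
proof -
  obtain i where i: "2 ^ i \<le> NN u" "NN u < 2 ^ Suc i"
    using ex_power_ivl1[of 2 "NN u"] assms by auto
  then have "2 ^ i < (2 :: nat) ^ l" using NN_less[of u] assms by linarith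
  then have "i < l" by simp
  with i assms show ?thesis by (auto simp: level_def)
qed

lemma sum_levels_ge:
  fixes f :: "nat \<Rightarrow> nat"
  assumes u: "u \<in> {0..<P}" and l: "p \<le> 2 ^ l" and f0: "f 0 = 0"
    and f: "\<And>i. u \<in> level i \<Longrightarrow> f (NN u) \<le> g i"
  shows "f (NN u) \<le> (\<Sum>i<l. g i * (if u \<in> level i then 1 else 0 :: nat))"
proof (cases "NN u > 0")
  case True
  then obtain i where i: "i < l" "u \<in> level i" using ex_level[OF u _ l] by auto
  have "f (NN u) \<le> g i * (if u \<in> level i then 1 else 0)" using f i by simp
  also have "\<dots> \<le> (\<Sum>i<l. g i * (if u \<in> level i then 1 else 0))"
    using i by (intro member_le_sum) auto
  finally show ?thesis .
qed (use f0 in simp)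

lemma sum_over_levels:
  fixes f :: "nat \<Rightarrow> nat"
  assumes l: "p \<le> 2 ^ l" and f0: "f 0 = 0"
    and f: "\<And>u i. u \<in> level i \<Longrightarrow> f (NN u) \<le> g i"
  shows "(\<Sum>u\<in>{0..<P}. f (NN u)) \<le> (\<Sum>i<l. g i * card (level i))"
proof -
  have "(\<Sum>u\<in>{0..<P}. f (NN u)) \<le> (\<Sum>u\<in>{0..<P}. \<Sum>i<l. g i * (if u \<in> level i then 1 else 0))"
    using sum_levels_ge[OF _ l, of _ f g] f0 f by (intro sum_mono) blast
  also have "\<dots> = (\<Sum>i<l. g i * (\<Sum>u\<in>{0..<P}. if u \<in> level i then 1 else 0))"
    by (subst sum.swap) (simp add: sum_distrib_left)
  also have "\<dots> = (\<Sum>i<l. g i * card (level i))"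
  proof (intro sum.cong refl)
    fix i
    have "(\<Sum>u\<in>{0..<P}. if u \<in> level i then 1 else 0 :: nat) = (\<Sum>u\<in>level i. 1)"
      using level_subset by (intro sum.mono_neutral_cong_right) auto
    then show "g i * (\<Sum>u\<in>{0..<P}. if u \<in> level i then 1 else 0) = g i * card (level i)" by simp
  qed
  finally show ?thesis .
qed

lemma sum_NN_tri_le:
  assumes l: "p \<le> 2 ^ l"
  shows "(\<Sum>x\<in>G. \<Sum>y\<in>nbh U x. \<Sum>z\<in>nbh U x - {y}. NN (k2 y z))
    \<le> (\<Sum>i<l. 2 ^ Suc i * card (tri_set U (level i)))"
proof -
  have "(\<Sum>z\<in>nbh U x - {y}. NN (k2 y z))
     \<le> (\<Sum>i<l. 2 ^ Suc i * card {z \<in> nbh U x. z \<noteq> y \<and> k2 y z \<in> level i})" for x y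
  proof -
    have "(\<Sum>z\<in>nbh U x - {y}. NN (k2 y z))
      \<le> (\<Sum>z\<in>nbh U x - {y}. \<Sum>i<l. 2 ^ Suc i * (if k2 y z \<in> level i then 1 else 0))"
    proof (rule sum_mono)
      fix z
      show "NN (k2 y z) \<le> (\<Sum>i<l. 2 ^ Suc i * (if k2 y z \<in> level i then 1 else 0))"
        by (rule sum_levels_ge[OF _ l, of _ "\<lambda>n. n"]) (auto simp: level_def k2_def fq_range)
    qed
    also have "\<dots> = (\<Sum>i<l. 2 ^ Suc i * (\<Sum>z\<in>nbh U x - {y}. if k2 y z \<in> level i then 1 else 0))"
      by (subst sum.swap) (simp only: sum_distrib_left)
    also have "\<dots> = (\<Sum>i<l. 2 ^ Suc i * card {z \<in> nbh U x. z \<noteq> y \<and> k2 y z \<in> level i})"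
    proof (intro sum.cong refl)
      fix i
      have "(\<Sum>z\<in>nbh U x - {y}. if k2 y z \<in> level i then 1 else 0 :: nat)
         = (\<Sum>z\<in>{z \<in> nbh U x. z \<noteq> y \<and> k2 y z \<in> level i}. 1)"
        by (intro sum.mono_neutral_cong_right) auto
      then show "2 ^ Suc i * (\<Sum>z\<in>nbh U x - {y}. if k2 y z \<in> level i then 1 else 0)
        = 2 ^ Suc i * card {z \<in> nbh U x. z \<noteq> y \<and> k2 y z \<in> level i}" by simp
    qed
    finally show ?thesis .
  qed
  then have "(\<Sum>x\<in>G. \<Sum>y\<in>nbh U x. \<Sum>z\<in>nbh U x - {y}. NN (k2 y z))
     \<le> (\<Sum>x\<in>G. \<Sum>y\<in>nbh U x. \<Sum>i<l. 2 ^ Suc i * card {z \<in> nbh U x. z \<noteq> y \<and> k2 y z \<in> level i})"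
    by (intro sum_mono)
  also have "\<dots> = (\<Sum>x\<in>G. \<Sum>i<l. \<Sum>y\<in>nbh U x. 2 ^ Suc i * card {z \<in> nbh U x. z \<noteq> y \<and> k2 y z \<in> level i})"
    by (intro sum.cong refl sum.swap)
  also have "\<dots> = (\<Sum>i<l. \<Sum>x\<in>G. \<Sum>y\<in>nbh U x. 2 ^ Suc i * card {z \<in> nbh U x. z \<noteq> y \<and> k2 y z \<in> level i})"
    by (rule sum.swap)
  also have "\<dots> = (\<Sum>i<l. 2 ^ Suc i * card (tri_set U (level i)))"
    unfolding card_tri_set by (simp only: sum_distrib_left)
  finally show ?thesis .
qed

text \<open>After \<open>y\<close>, choose \<open>z\<close> along an edge of \<open>W\<close> and
  \<open>x\<close> along an edge of \<open>U\<close>; the condition on the side from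
  \<open>x\<close> to \<open>z\<close> is dropped.\<close>

lemma card_tri_set_le:
  assumes U: "U \<subseteq> {0..<P}" and W: "W \<subseteq> {0..<P}"
  shows "card (tri_set U W) \<le> (p - 1) * lam W * lam U"
proof -
  let ?B = "SIGMA y:G. SIGMA z:nbh W y. nbh U y"
  have "inj_on (\<lambda>(x, y, z). (y, z, x)) (tri_set U W)" by (auto simp: inj_on_def)
  moreover have "(\<lambda>(x, y, z). (y, z, x)) ` tri_set U W \<subseteq> ?B"
    unfolding tri_set_def nbh_def using k2_sym by fastforce
  ultimately have "card (tri_set U W) \<le> card ?B"
    by (rule card_inj_on_le) simp
  also have "card ?B = (\<Sum>y\<in>G. lam W * lam U)"
    using card_nbh[OF _ U] card_nbh[OF _ W] by simp
  finally show ?thesis by (simp add: card_G)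
qed

text \<open>The trace of a triangle in \<open>a = x^p - y^p\<close> and
  \<open>b = x^p - z^p\<close>, for which \<open>a - b = z^p - y^p\<close>. That \<open>a\<close>
  and \<open>b\<close> are differences of \<open>p\<close>-th powers is forgotten.\<close>

definition pairs :: "int set \<Rightarrow> int set \<Rightarrow> (int \<times> int) set" where
  "pairs U W = {(a, b). a \<in> {0..<Q} \<and> b \<in> {0..<Q} \<and> \<not> P dvd a \<and> \<not> P dvd b \<and> \<not> P dvd a - b
     \<and> fq a \<in> U \<and> fq b \<in> U \<and> fq (a - b) \<in> W}"

lemma finite_pairs [simp]: "finite (pairs U W)"
  by (rule finite_subset[of _ "{0..<Q} \<times> {0..<Q}"]) (auto simp: pairs_def)

lemma Q_eqI: "a \<in> {0..<Q} \<Longrightarrow> b \<in> {0..<Q} \<Longrightarrow> [a = b] (mod Q) \<Longrightarrow> a = b"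
  by (auto simp: Cong.cong_def)

text \<open>The residues of \<open>a\<close> and \<open>b\<close> modulo \<open>p\<close> and
  \<open>fq (a - b)\<close> fix \<open>a - b\<close> modulo \<open>p^2\<close>. Two distinct pairs
  sharing these data satisfy \<open>a (fq a - fq a') = b (fq b - fq b')\<close> modulo
  \<open>p\<close> with \<open>fq b \<noteq> fq b'\<close>. Hence \<open>a\<close> modulo
  \<open>p\<close> and four elements of \<open>U\<close> determine the collision.\<close>

lemma card_pairs:
  assumes U: "finite U" and W: "finite W"
  shows "(card (pairs U W))\<^sup>2 \<le> ((p - 1)\<^sup>2 * card W) * (card (pairs U W) + (p - 1) * card U ^ 4)"
proof -
  let ?A = "pairs U W"
  let ?g = "\<lambda>(a, b). (a mod P, b mod P, fq (a - b))"
  have "?g ` ?A \<subseteq> G \<times> G \<times> W"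
    by (auto simp: pairs_def mod_in_G)
  then have 1: "card (?g ` ?A) \<le> (p - 1)\<^sup>2 * card W"
    using card_mono[of "G \<times> G \<times> W" "?g ` ?A"] W
    by (simp add: card_cartesian_product card_G power2_eq_square)
  let ?C = "{(s, t). s \<in> ?A \<and> t \<in> ?A \<and> ?g s = ?g t}"
  let ?D = "{(s, t). s \<in> ?A \<and> t \<in> ?A \<and> ?g s = ?g t \<and> s \<noteq> t}"
  have finD: "finite ?D" by (rule finite_subset[of _ "?A \<times> ?A"]) auto
  have "?C \<subseteq> (\<lambda>s. (s, s)) ` ?A \<union> ?D" by auto
  then have "card ?C \<le> card ((\<lambda>s. (s, s)) ` ?A \<union> ?D)" using finD by (intro card_mono) auto
  also have "\<dots> \<le> card ((\<lambda>s. (s, s)) ` ?A) + card ?D" by (rule card_Un_le)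
  also have "\<dots> \<le> card ?A + card ?D" by (simp add: card_image_le)
  finally have 2: "card ?C \<le> card ?A + card ?D" .
  have key: "a' \<noteq> a \<and> b' \<noteq> b \<and> \<not> P dvd fq b - fq b' \<and> P dvd a * (fq a - fq a') - b * (fq b - fq b')"
    if ab: "(a, b) \<in> ?A" "(a', b') \<in> ?A" "?g (a, b) = ?g (a', b')" "(a, b) \<noteq> (a', b')" for a b a' b'
  proof -
    have am: "[a = a'] (mod P)" "[b = b'] (mod P)" using ab by (auto simp: Cong.cong_def)
    have na: "\<not> P dvd a" "\<not> P dvd a'" "\<not> P dvd b" "\<not> P dvd b'" "\<not> P dvd a - b" using ab by (auto simp: pairs_def)
    have r: "a \<in> {0..<Q}" "a' \<in> {0..<Q}" "b \<in> {0..<Q}" "b' \<in> {0..<Q}" using ab by (auto simp: pairs_def)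
    have "[a - b = a' - b'] (mod Q)"
      using ab na by (intro unit_eqI cong_diff am) auto
    then have d: "Q dvd (a - a') - (b - b')" by (simp add: cong_iff_dvd_diff algebra_simps)
    have ne: "a \<noteq> a'" "b \<noteq> b'"
    proof -
      have "a = a' \<longleftrightarrow> b = b'"
        using d Q_eqI[of a a'] Q_eqI[of b' b] r by (auto simp: cong_iff_dvd_diff)
      then show "a \<noteq> a'" "b \<noteq> b'" using ab by auto
    qed
    have "fq b \<noteq> fq b'" using unit_eqI[OF na(3) am(2)] Q_eqI r ne by blast
    then have "\<not> P dvd fq b - fq b'"
      using fq_range[of b] fq_range[of b'] by (simp add: mod_eq_dvd_iff[symmetric])
    moreover have "P dvd a * (fq a - fq a') - b * (fq b - fq b')"
    proof -
      \<comment> \<open>The two instances of \<open>unit_rep\<close> are subtracted; the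
        \<open>p\<close>-th powers agree because the units are congruent modulo
        \<open>p\<close>.\<close>
      have A: "Q dvd (a - a') + P * (a * (fq a - fq a'))"
        if "[a = a'] (mod P)" "\<not> P dvd a" "\<not> P dvd a'" for a a'
      proof -
        have "[a + P * (a * fq a) = a' + P * (a' * fq a')] (mod Q)"
          using unit_rep[OF that(2)] unit_rep[OF that(3)] pow_p_cong[OF that(1)]
          by (meson cong_sym cong_trans)
        moreover have "[P * (a * fq a') = P * (a' * fq a')] (mod Q)"
          unfolding cong_P_mult by (rule cong_scalar_right[OF that(1)])
        ultimately have "[(a + P * (a * fq a)) - P * (a * fq a') = (a' + P * (a' * fq a')) - P * (a' * fq a')] (mod Q)"
          by (rule cong_diff)
        then show ?thesis by (simp add: cong_iff_dvd_diff algebra_simps)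
      qed
      have "Q dvd ((a - a') + P * (a * (fq a - fq a'))) - ((b - b') + P * (b * (fq b - fq b'))) - ((a - a') - (b - b'))"
        by (intro dvd_diff A am na d)
      also have "((a - a') + P * (a * (fq a - fq a'))) - ((b - b') + P * (b * (fq b - fq b'))) - ((a - a') - (b - b'))
         = P * (a * (fq a - fq a') - b * (fq b - fq b'))" by (simp add: algebra_simps)
      finally show ?thesis using P_pos by (simp only: dvd_mult_cancel_left) simp
    qed
    ultimately show ?thesis using ne by auto
  qed
  let ?h = "\<lambda>((a, b), (a', b')). (a mod P, fq a, fq a', fq b, fq b')"
  have "inj_on ?h ?D"
  proof (rule inj_onI)
    fix s t assume s: "s \<in> ?D" and t: "t \<in> ?D" and eq: "?h s = ?h t"
    obtain a b a' b' where s': "s = ((a, b), (a', b'))" by (metis prod.exhaust)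
    obtain c d c' d' where t': "t = ((c, d), (c', d'))" by (metis prod.exhaust)
    have S: "(a, b) \<in> ?A" "(a', b') \<in> ?A" "?g (a, b) = ?g (a', b')" "(a, b) \<noteq> (a', b')" using s s' by auto
    have T: "(c, d) \<in> ?A" "(c', d') \<in> ?A" "?g (c, d) = ?g (c', d')" "(c, d) \<noteq> (c', d')" using t t' by auto
    have e: "[a = c] (mod P)" "fq a = fq c" "fq a' = fq c'" "fq b = fq d" "fq b' = fq d'"
      using eq s' t' by (auto simp: Cong.cong_def)
    have n: "\<not> P dvd a" "\<not> P dvd a'" "\<not> P dvd b" "\<not> P dvd b'" "\<not> P dvd d" using S T by (auto simp: pairs_def)
    have r: "a \<in> {0..<Q}" "a' \<in> {0..<Q}" "b \<in> {0..<Q}" "b' \<in> {0..<Q}"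
      "c \<in> {0..<Q}" "c' \<in> {0..<Q}" "d \<in> {0..<Q}" "d' \<in> {0..<Q}" using S T by (auto simp: pairs_def)
    have "P dvd (a * (fq a - fq a') - b * (fq b - fq b')) - (c * (fq a - fq a') - d * (fq b - fq b'))
        - (a - c) * (fq a - fq a')"
    proof (rule dvd_diff[OF dvd_diff])
      show "P dvd a * (fq a - fq a') - b * (fq b - fq b')" using key[OF S] by simp
      show "P dvd c * (fq a - fq a') - d * (fq b - fq b')" using key[OF T] e by simp
      show "P dvd (a - c) * (fq a - fq a')" using e(1) by (simp add: cong_iff_dvd_diff)
    qed
    also have "(a * (fq a - fq a') - b * (fq b - fq b')) - (c * (fq a - fq a') - d * (fq b - fq b'))
        - (a - c) * (fq a - fq a') = (d - b) * (fq b - fq b')" by (simp add: algebra_simps)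
    finally have "P dvd d - b" using key[OF S] prime_P prime_dvd_mult_iff by blast
    then have bd: "[b = d] (mod P)" by (simp add: cong_iff_dvd_diff dvd_diff_commute)
    have aa: "[a = a'] (mod P)" "[b = b'] (mod P)" "[c = c'] (mod P)" "[d = d'] (mod P)"
      using S T by (auto simp: Cong.cong_def)
    have "a = c" using unit_eqI[OF n(1) e(1,2)] Q_eqI r by blast
    moreover have "b = d" using unit_eqI[OF n(3) bd e(4)] Q_eqI r by blast
    moreover have "a' = c'"
      using unit_eqI[OF n(2) _ e(3)] Q_eqI r aa e(1) by (meson cong_sym cong_trans)
    moreover have "b' = d'"
      using unit_eqI[OF n(4) _ e(5)] Q_eqI r aa bd by (meson cong_sym cong_trans)
    ultimately show "s = t" using s' t' by simp
  qed
  moreover have "?h ` ?D \<subseteq> G \<times> U \<times> U \<times> U \<times> U"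
    by (auto simp: pairs_def mod_in_G)
  ultimately have "card ?D \<le> card (G \<times> U \<times> U \<times> U \<times> U)"
    using U by (intro card_inj_on_le) auto
  then have 3: "card ?D \<le> (p - 1) * card U ^ 4"
    by (simp add: card_cartesian_product card_G power4_eq_xxxx)
  have "(card ?A)\<^sup>2 \<le> card (?g ` ?A) * card ?C" by (rule card_collisions) simp
  also have "\<dots> \<le> ((p - 1)\<^sup>2 * card W) * (card ?A + (p - 1) * card U ^ 4)"
    using 1 2 3 by (intro mult_le_mono) auto
  finally show ?thesis .
qed

text \<open>Triangles with the same pair of differences satisfy
  \<open>y^p - y'^p = x^p - x'^p = z^p - z'^p\<close>. For given \<open>x\<close> and
  \<open>x'\<close> there are at most \<open>MM x x'\<close> choices of \<open>(y, y')\<close> and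
  as many of \<open>(z, z')\<close>; the squares of \<open>MM\<close> bring in the third moment
  \<open>S3\<close>.\<close>

lemma card_tri_set_sq_le:
  assumes U: "U \<subseteq> {0..<P}" and W: "W \<subseteq> {0..<P}"
  shows "(card (tri_set U W))\<^sup>2 \<le> card (pairs U W) * ((p - 1) * ((p - 1)\<^sup>2 + S3))"
proof -
  let ?T = "tri_set U W"
  let ?f = "\<lambda>(x, y, z). ((x ^ p - y ^ p) mod Q, (x ^ p - z ^ p) mod Q)"
  have Q: "Q > 0" using P_pos by simp
  have "?f ` ?T \<subseteq> pairs U W"
  proof
    fix s assume "s \<in> ?f ` ?T"
    then obtain x y z where t: "(x, y, z) \<in> ?T" and s: "s = ((x ^ p - y ^ p) mod Q, (x ^ p - z ^ p) mod Q)"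
      by auto
    have G: "x \<in> G" "y \<in> G" "z \<in> G" "y \<noteq> x" "z \<noteq> x" "z \<noteq> y" "k2 x y \<in> U" "k2 x z \<in> U" "k2 y z \<in> W"
      using t by (auto simp: tri_set_def nbh_def)
    have n: "\<not> P dvd x ^ p - y ^ p" "\<not> P dvd x ^ p - z ^ p" "\<not> P dvd z ^ p - y ^ p"
      using G diff_pow_not_dvd by blast+
    have m: "[x ^ p - y ^ p = (x ^ p - y ^ p) mod Q] (mod Q)" "[x ^ p - z ^ p = (x ^ p - z ^ p) mod Q] (mod Q)"
      by (simp_all add: Cong.cong_def)
    have m3: "[z ^ p - y ^ p = (x ^ p - y ^ p) mod Q - (x ^ p - z ^ p) mod Q] (mod Q)"
      using cong_diff[OF m] by simp
    have "\<not> P dvd (x ^ p - y ^ p) mod Q" "\<not> P dvd (x ^ p - z ^ p) mod Q"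
      "\<not> P dvd (x ^ p - y ^ p) mod Q - (x ^ p - z ^ p) mod Q"
      using cong_dvd_iff[OF cong_Q_P[OF m(1)]] cong_dvd_iff[OF cong_Q_P[OF m(2)]]
        cong_dvd_iff[OF cong_Q_P[OF m3]] n by blast+
    moreover have "fq ((x ^ p - y ^ p) mod Q) = k2 x y" "fq ((x ^ p - z ^ p) mod Q) = k2 x z"
      "fq ((x ^ p - y ^ p) mod Q - (x ^ p - z ^ p) mod Q) = k2 y z"
      using fq_cong[OF n(1) m(1)] fq_cong[OF n(2) m(2)] fq_cong[OF n(3) m3] k2_sym[of y z] G
      by (simp_all add: k2_def)
    ultimately show "s \<in> pairs U W"
      using G Q unfolding s pairs_def by simp
  qed
  then have 1: "card (?f ` ?T) \<le> card (pairs U W)" by (intro card_mono) auto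
  let ?C = "{(s, t). s \<in> ?T \<and> t \<in> ?T \<and> ?f s = ?f t}"
  let ?M = "\<lambda>x x'. {(g, h). g \<in> G \<and> h \<in> G \<and> [g ^ p - h ^ p = x ^ p - x' ^ p] (mod Q)}"
  let ?h = "\<lambda>((x, y, z), (x', y', z')). (x, x', (y, y'), (z, z'))"
  have finM: "finite (?M x x')" for x x' by (rule finite_subset[of _ "G \<times> G"]) auto
  let ?E = "SIGMA x:G. SIGMA x':G. ?M x x' \<times> ?M x x'"
  have "inj_on ?h ?C" by (auto simp: inj_on_def)
  moreover have "?h ` ?C \<subseteq> ?E"
  proof -
    have *: "[y ^ p - y' ^ p = x ^ p - x' ^ p] (mod Q)" if "(x ^ p - y ^ p) mod Q = (x' ^ p - y' ^ p) mod Q" for x y x' y'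
      using that unfolding mod_eq_dvd_iff cong_iff_dvd_diff
      by (subst dvd_minus_iff[symmetric]) (simp add: algebra_simps)
    show ?thesis
      unfolding tri_set_def nbh_def using * by auto
  qed
  ultimately have "card ?C \<le> card ?E"
    using finM by (intro card_inj_on_le) auto
  also have "card ?E = (\<Sum>x\<in>G. \<Sum>x'\<in>G. (MM x x')\<^sup>2)"
    using finM by (simp add: card_cartesian_product MM_def power2_eq_square)
  also have "\<dots> = (p - 1) * ((p - 1)\<^sup>2 + S3)"
    using sum_MM_sq by (simp add: card_G)
  finally have 2: "card ?C \<le> (p - 1) * ((p - 1)\<^sup>2 + S3)" .
  have "(card ?T)\<^sup>2 \<le> card (?f ` ?T) * card ?C" by (rule card_collisions) simp
  also have "\<dots> \<le> card (pairs U W) * ((p - 1) * ((p - 1)\<^sup>2 + S3))"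
    using 1 2 by (rule mult_le_mono)
  finally show ?thesis .
qed

end

section \<open>Elimination of the parameters in the energy bound\<close>

lemma le_of_square_le_mult_add:
  fixes a b c :: real
  assumes "a\<^sup>2 \<le> b * (a + c)" "a \<ge> 0" "b \<ge> 0" "c \<ge> 0"
  shows "a \<le> 2 * b \<or> a\<^sup>2 \<le> 2 * b * c"
proof (cases "c \<le> a")
  case True
  then have "b * (a + c) \<le> b * (2 * a)" using assms by (intro mult_left_mono) auto
  then have "a * a \<le> (2 * b) * a" using assms by (simp add: power2_eq_square)
  then show ?thesis using assms by (cases "a = 0") auto
next
  case False
  then have "b * (a + c) \<le> b * (2 * c)" using assms by (intro mult_left_mono) auto
  then show ?thesis using assms by simp
qed

text \<open>Here \<open>S\<close> is \<open>S2\<close>, \<open>l\<close> the number of dyadic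
  levels, \<open>J\<close> the size of the level \<open>U\<close> that dominates \<open>S2\<close>,
  \<open>D\<close> the size of \<open>NN\<close> on it up to a factor 2, \<open>lb\<close> the
  degree \<open>lam U\<close>, and \<open>C\<close> the constant for popular values.\<close>

context
  fixes p l S J D lb C :: real
  assumes p: "p \<ge> 1" and l: "l \<ge> 1" and C: "C \<ge> 1" and S: "S \<ge> 0" and J: "J > 0" and D: "D \<ge> 1"
    and S_le: "S \<le> 4 * l * (J * D\<^sup>2)" and JD3: "J * D ^ 3 \<le> C * p\<^sup>2" and JD: "J * D \<le> lb"
begin

lemma lb_pos: "lb > 0"
  using J D JD by (meson less_le_trans mult_pos_pos zero_less_one)

lemma S_sq_le: "S\<^sup>2 \<le> 16 * l\<^sup>2 * C * p\<^sup>2 * lb"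
proof -
  have "S\<^sup>2 \<le> (4 * l * (J * D\<^sup>2))\<^sup>2" using S S_le by (intro power_mono)
  also have "\<dots> = 16 * l\<^sup>2 * ((J * D ^ 3) * (J * D))"
    by (simp add: power_mult_distrib power2_eq_square power3_eq_cube)
  also have "\<dots> \<le> 16 * l\<^sup>2 * ((C * p\<^sup>2) * lb)"
    using mult_mono[OF JD3 JD] J D C p by (intro mult_left_mono) auto
  finally show ?thesis by (simp add: mult_ac)
qed

lemma energy_case_diag:
  assumes "lb\<^sup>2 * S \<le> 2 * p\<^sup>2 * lb"
  shows "S ^ 3 \<le> 32 * C * l\<^sup>2 * p ^ 4"
proof -
  have "lb * (lb * S) \<le> lb * (2 * p\<^sup>2)" using assms by (simp add: power2_eq_square mult_ac)
  then have a: "lb * S \<le> 2 * p\<^sup>2" using lb_pos by simp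
  have "S ^ 3 = S\<^sup>2 * S" by (simp add: power2_eq_square power3_eq_cube)
  also have "\<dots> \<le> (16 * l\<^sup>2 * C * p\<^sup>2 * lb) * S" using S_sq_le S by (intro mult_right_mono)
  also have "\<dots> = 16 * l\<^sup>2 * C * p\<^sup>2 * (lb * S)" by simp
  also have "\<dots> \<le> 16 * l\<^sup>2 * C * p\<^sup>2 * (2 * p\<^sup>2)" using a C p by (intro mult_left_mono) auto
  also have "\<dots> = 32 * C * l\<^sup>2 * p ^ 4" by (simp add: power2_eq_square power4_eq_xxxx)
  finally show ?thesis .
qed

text \<open>\<open>K\<close> and \<open>T\<close> are the size and the popularity of the level of
  the third side, \<open>tr\<close> counts triangles and \<open>A\<close> pairs. If \<open>A\<close>
  is of order \<open>p^2 K\<close>, the fourth power of \<open>lb^2 S\<close> contains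
  \<open>K^2 T^4 = (K T^3) (K T)\<close>. Otherwise four factors estimated through \<open>A\<close>
  are combined with one estimated by \<open>tr1\<close>, which gives \<open>(K T^3)^2\<close>.
  Either way \<open>K\<close> and \<open>T\<close> disappear.\<close>

lemma energy_case_tri:
  fixes K T tr A :: real
  assumes K: "K \<ge> 0" and T: "T \<ge> 1" and tr: "tr \<ge> 0" and A: "A \<ge> 0"
    and V: "lb\<^sup>2 * S \<le> 4 * l * T * tr"
    and KT3: "K * T ^ 3 \<le> C * p\<^sup>2" and KT: "K * T \<le> p"
    and tr1: "tr \<le> p * lb * (2 * K * T)" and tr2: "tr\<^sup>2 \<le> A * (9 * l * C * p ^ 3)"
    and A2: "A\<^sup>2 \<le> (p\<^sup>2 * K) * (A + p * J ^ 4)"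
  shows "S ^ 20 \<le> 16 ^ 8 * 82944 * C ^ 11 * l ^ 22 * p ^ 29 \<or> S ^ 11 \<le> 4096 * 331776 * C ^ 5 * l ^ 13 * p ^ 16"
proof -
  define V where "V = lb\<^sup>2 * S"
  have V0: "V \<ge> 0" using S by (simp add: V_def)
  have Vle: "V \<le> 4 * l * T * tr" using V by (simp add: V_def)
  have "A \<le> 2 * (p\<^sup>2 * K) \<or> A\<^sup>2 \<le> 2 * (p\<^sup>2 * K) * (p * J ^ 4)"
    using A2 A K p J by (intro le_of_square_le_mult_add) auto
  then show ?thesis
  proof
    assume A': "A \<le> 2 * (p\<^sup>2 * K)"
    have "tr\<^sup>2 \<le> 2 * (p\<^sup>2 * K) * (9 * l * C * p ^ 3)"
    proof (rule order_trans[OF tr2])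
      show "A * (9 * l * C * p ^ 3) \<le> 2 * (p\<^sup>2 * K) * (9 * l * C * p ^ 3)"
        using l C p by (intro mult_right_mono[OF A']) auto
    qed
    then have "16 * l\<^sup>2 * T\<^sup>2 * tr\<^sup>2 \<le> 16 * l\<^sup>2 * T\<^sup>2 * (2 * (p\<^sup>2 * K) * (9 * l * C * p ^ 3))"
      by (intro mult_left_mono) auto
    moreover have "V\<^sup>2 \<le> (4 * l * T * tr)\<^sup>2" using Vle V0 by (intro power_mono)
    ultimately have "V\<^sup>2 \<le> 288 * l ^ 3 * C * p ^ 5 * (T\<^sup>2 * K)"
      by (simp add: power_mult_distrib power2_eq_square eval_nat_numeral mult_ac)
    then have "(V\<^sup>2)\<^sup>2 \<le> (288 * l ^ 3 * C * p ^ 5 * (T\<^sup>2 * K))\<^sup>2" by (intro power_mono) auto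
    also have "\<dots> = 82944 * l ^ 6 * C\<^sup>2 * p ^ 10 * ((K * T ^ 3) * (K * T))"
      by (simp add: power_mult_distrib power2_eq_square eval_nat_numeral mult_ac)
    also have "\<dots> \<le> 82944 * l ^ 6 * C\<^sup>2 * p ^ 10 * ((C * p\<^sup>2) * p)"
      using mult_mono[OF KT3 KT] K T C p l by (intro mult_left_mono) auto
    finally have V4: "V ^ 4 \<le> 82944 * l ^ 6 * C ^ 3 * p ^ 13"
      by (simp add: power2_eq_square eval_nat_numeral mult_ac)
    \<comment> \<open>The eighth power is chosen so that \<open>lb ^ 8 * S ^ 4\<close> is
      \<open>V ^ 4\<close>.\<close>
    have "(S\<^sup>2) ^ 8 \<le> (16 * l\<^sup>2 * C * p\<^sup>2 * lb) ^ 8" using S_sq_le by (intro power_mono) auto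
    then have "(S\<^sup>2) ^ 8 * S ^ 4 \<le> (16 * l\<^sup>2 * C * p\<^sup>2 * lb) ^ 8 * S ^ 4" using S by (intro mult_right_mono) auto
    also have "\<dots> = (16 * l\<^sup>2 * C * p\<^sup>2) ^ 8 * V ^ 4"
      unfolding V_def power_mult_distrib by (simp add: power_mult[symmetric])
    also have "\<dots> \<le> (16 * l\<^sup>2 * C * p\<^sup>2) ^ 8 * (82944 * l ^ 6 * C ^ 3 * p ^ 13)"
      using V4 by (intro mult_left_mono) auto
    also have "\<dots> = 16 ^ 8 * 82944 * (C ^ 8 * C ^ 3) * (l ^ 16 * l ^ 6) * (p ^ 16 * p ^ 13)"
      unfolding power_mult_distrib by (simp add: power_mult[symmetric] mult_ac)
    also have "\<dots> = 16 ^ 8 * 82944 * C ^ 11 * l ^ 22 * p ^ 29"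
      by (simp only: power_add[symmetric]) simp
    also have "(S\<^sup>2) ^ 8 * S ^ 4 = S ^ 20" by (simp add: power_mult[symmetric] power_add[symmetric])
    finally show ?thesis by blast
  next
    assume A': "A\<^sup>2 \<le> 2 * (p\<^sup>2 * K) * (p * J ^ 4)"
    have "(tr\<^sup>2)\<^sup>2 \<le> (A * (9 * l * C * p ^ 3))\<^sup>2" using tr2 by (intro power_mono) auto
    also have "\<dots> = A\<^sup>2 * (81 * l\<^sup>2 * C\<^sup>2 * p ^ 6)"
      by (simp add: power_mult_distrib power_mult[symmetric])
    also have "\<dots> \<le> 2 * (p\<^sup>2 * K) * (p * J ^ 4) * (81 * l\<^sup>2 * C\<^sup>2 * p ^ 6)"
      using A' by (intro mult_right_mono) auto
    finally have tr4: "tr ^ 4 \<le> 2 * (p\<^sup>2 * K) * (p * J ^ 4) * (81 * l\<^sup>2 * C\<^sup>2 * p ^ 6)"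
      by (simp add: power_mult[symmetric])
    have "V ^ 4 \<le> (4 * l * T * tr) ^ 4" using Vle V0 by (intro power_mono)
    also have "\<dots> = 256 * l ^ 4 * T ^ 4 * tr ^ 4" by (simp add: power_mult_distrib)
    also have "\<dots> \<le> 256 * l ^ 4 * T ^ 4 * (2 * (p\<^sup>2 * K) * (p * J ^ 4) * (81 * l\<^sup>2 * C\<^sup>2 * p ^ 6))"
      using tr4 by (intro mult_left_mono) auto
    finally have V4: "V ^ 4 \<le> 256 * l ^ 4 * T ^ 4 * (2 * (p\<^sup>2 * K) * (p * J ^ 4) * (81 * l\<^sup>2 * C\<^sup>2 * p ^ 6))" .
    have "4 * l * T * tr \<le> 4 * l * T * (p * lb * (2 * K * T))" using tr1 l T by (intro mult_left_mono) auto
    then have V1: "V \<le> 4 * l * T * (p * lb * (2 * K * T))" using Vle by linarith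
    have "V ^ 4 * V \<le> (256 * l ^ 4 * T ^ 4 * (2 * (p\<^sup>2 * K) * (p * J ^ 4) * (81 * l\<^sup>2 * C\<^sup>2 * p ^ 6)))
       * (4 * l * T * (p * lb * (2 * K * T)))"
      using V4 V1 V0 K p l C J T lb_pos by (intro mult_mono) auto
    also have "\<dots> = 331776 * l ^ 7 * C\<^sup>2 * p ^ 10 * lb * J ^ 4 * (K * T ^ 3)\<^sup>2"
      by (simp add: power_mult_distrib power2_eq_square eval_nat_numeral mult_ac)
    also have "\<dots> \<le> 331776 * l ^ 7 * C\<^sup>2 * p ^ 10 * lb * J ^ 4 * (C * p\<^sup>2)\<^sup>2"
      using KT3 K T l C p lb_pos J by (intro mult_left_mono power_mono) auto
    finally have V5: "V ^ 4 * V \<le> 331776 * l ^ 7 * C\<^sup>2 * p ^ 10 * lb * J ^ 4 * (C * p\<^sup>2)\<^sup>2" .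
    have "V ^ 4 * V = lb * (lb ^ 9 * S ^ 5)"
      unfolding V_def by (simp add: power_mult_distrib eval_nat_numeral mult_ac)
    with V5 have "lb * (lb ^ 9 * S ^ 5) \<le> lb * (331776 * l ^ 7 * C\<^sup>2 * p ^ 10 * J ^ 4 * (C * p\<^sup>2)\<^sup>2)"
      by (simp add: mult_ac)
    then have "lb ^ 9 * S ^ 5 \<le> 331776 * l ^ 7 * C\<^sup>2 * p ^ 10 * J ^ 4 * (C * p\<^sup>2)\<^sup>2"
      using lb_pos by simp
    moreover have "(J * D) ^ 9 * S ^ 5 \<le> lb ^ 9 * S ^ 5"
      using JD J D S by (intro mult_right_mono power_mono) auto
    ultimately have "(J * D) ^ 9 * S ^ 5 \<le> 331776 * l ^ 7 * C\<^sup>2 * p ^ 10 * J ^ 4 * (C * p\<^sup>2)\<^sup>2" by linarith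
    moreover have "(J * D) ^ 9 * S ^ 5 = J ^ 4 * (J ^ 5 * D ^ 9 * S ^ 5)"
      by (simp add: power_mult_distrib eval_nat_numeral mult_ac)
    moreover have "331776 * l ^ 7 * C\<^sup>2 * p ^ 10 * J ^ 4 * (C * p\<^sup>2)\<^sup>2
        = J ^ 4 * (331776 * l ^ 7 * C\<^sup>2 * p ^ 10 * (C * p\<^sup>2)\<^sup>2)" by simp
    ultimately have "J ^ 4 * (J ^ 5 * D ^ 9 * S ^ 5) \<le> J ^ 4 * (331776 * l ^ 7 * C\<^sup>2 * p ^ 10 * (C * p\<^sup>2)\<^sup>2)"
      by (simp only:)
    then have b: "J ^ 5 * D ^ 9 * S ^ 5 \<le> 331776 * l ^ 7 * C\<^sup>2 * p ^ 10 * (C * p\<^sup>2)\<^sup>2"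
      using J by simp
    \<comment> \<open>The sixth power fits since \<open>(J D^2)^6\<close> is \<open>J^5 D^9\<close>,
      bounded above together with \<open>S^5\<close>, times \<open>J D^3\<close>.\<close>
    have "S ^ 6 \<le> (4 * l * (J * D\<^sup>2)) ^ 6" using S S_le by (intro power_mono)
    also have "\<dots> = 4096 * l ^ 6 * (J ^ 5 * D ^ 9) * (J * D ^ 3)"
      by (simp add: power_mult_distrib eval_nat_numeral mult_ac)
    also have "\<dots> \<le> 4096 * l ^ 6 * (J ^ 5 * D ^ 9) * (C * p\<^sup>2)"
      using JD3 l J D by (intro mult_left_mono) auto
    finally have "S ^ 6 * S ^ 5 \<le> 4096 * l ^ 6 * (J ^ 5 * D ^ 9) * (C * p\<^sup>2) * S ^ 5"
      using S by (intro mult_right_mono) auto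
    also have "\<dots> = 4096 * l ^ 6 * (C * p\<^sup>2) * (J ^ 5 * D ^ 9 * S ^ 5)" by simp
    also have "\<dots> \<le> 4096 * l ^ 6 * (C * p\<^sup>2) * (331776 * l ^ 7 * C\<^sup>2 * p ^ 10 * (C * p\<^sup>2)\<^sup>2)"
      using b l C p by (intro mult_left_mono) auto
    also have "\<dots> = 4096 * 331776 * C ^ 5 * l ^ 13 * p ^ 16"
      by (simp add: power_mult_distrib eval_nat_numeral mult_ac)
    also have "S ^ 6 * S ^ 5 = S ^ 11" by (simp add: power_add[symmetric])
    finally show ?thesis by blast
  qed
qed

end

lemma ex_mirimanoff_poly:
  assumes p: "prime p" and odd: "odd p"
  shows "\<exists>c :: int poly. mirimanoff p c"
proof -
  have p0: "p > 0" using p prime_gt_0_nat by blast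
  let ?x = "[:0, -1:] :: int poly"
  have "[:1, -1:] ^ p = (?x + 1) ^ p" by (simp add: one_pCons)
  also have "\<dots> = (\<Sum>k\<le>p. of_nat (p choose k) * ?x ^ k)"
    by (simp add: binomial_ring)
  also have "\<dots> = of_nat (p choose 0) * ?x ^ 0 + of_nat (p choose p) * ?x ^ p
      + (\<Sum>k\<in>{..p} - {0} - {p}. of_nat (p choose k) * ?x ^ k)"
    using p0 by (subst sum.remove[of _ 0], simp, simp, subst sum.remove[of _ p]) auto
  also have "?x ^ p = - monom 1 p"
  proof -
    have "?x = - monom 1 1" by (simp add: monom_altdef)
    then show ?thesis using odd by (simp add: power_minus_odd monom_power)
  qed
  finally have eq: "[:1, -1:] ^ p - 1 + monom 1 p = (\<Sum>k\<in>{..p} - {0} - {p}. of_nat (p choose k) * ?x ^ k)"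
    by simp
  have "[:int p:] dvd (\<Sum>k\<in>{..p} - {0} - {p}. of_nat (p choose k) * ?x ^ k)"
  proof (rule dvd_sum)
    fix k assume k: "k \<in> {..p} - {0} - {p}"
    then have "p dvd p choose k" using p by (intro dvd_choose_prime) auto
    then obtain m where "p choose k = p * m" by blast
    then have "of_nat (p choose k) = [:int p:] * (of_nat m :: int poly)"
      by (simp add: of_nat_poly mult_pCons_left)
    then have "of_nat (p choose k) * ?x ^ k = [:int p:] * (of_nat m * ?x ^ k)"
      by (simp only: mult.assoc)
    then show "[:int p:] dvd of_nat (p choose k) * ?x ^ k" by (rule dvdI)
  qed
  then obtain c where "[:1, -1:] ^ p - 1 + monom 1 p = [:int p:] * c" unfolding eq by blast
  then have "smult (int p) c = [:1, -1:] ^ p - 1 + monom 1 p" by (simp add: mult_pCons_left)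
  then show ?thesis using p odd by (intro exI[of _ c]) (unfold_locales; simp)
qed

section \<open>The energy bound\<close>

context odd_prime begin

lemma fq_one_add: "[fq (1 + P * k) = - k] (mod P)"
proof -
  have n: "\<not> P dvd 1 + P * k"
  proof
    assume "P dvd 1 + P * k"
    then have "P dvd 1" by (metis dvd_add_times_triv_right_iff mult.commute)
    then show False using prime_P by (simp add: prime_int_iff)
  qed
  have "[(1 + P * k) ^ m = 1 + P * (int m * k)] (mod Q)" for m
  proof (induction m)
    case (Suc m)
    have "[(1 + P * k) * (1 + P * k) ^ m = (1 + P * k) * (1 + P * (int m * k))] (mod Q)"
      by (rule cong_scalar_left[OF Suc])
    moreover have "(1 + P * k) * (1 + P * (int m * k)) = 1 + P * (int (Suc m) * k) + Q * (k * (int m * k))"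
      by (simp add: algebra_simps)
    ultimately show ?case by (simp add: Cong.cong_def)
  qed simp
  from this[of "p - 1"] have "[1 + P * (int (p - 1) * k) = 1 + P * fq (1 + P * k)] (mod Q)"
    using power_fq[OF n] by (meson cong_sym cong_trans)
  then have "[int (p - 1) * k = fq (1 + P * k)] (mod P)"
    by (simp add: cong_add_lcancel cong_P_mult)
  moreover have "int (p - 1) * k = - k + P * k" using p_ge_3 by (simp add: algebra_simps of_nat_diff)
  moreover have "[- k + P * k = - k] (mod P)" by (simp add: cong_iff_dvd_diff)
  ultimately show ?thesis by (metis cong_sym cong_trans)
qed

text \<open>As \<open>p\<close> is odd, \<open>x^p - (x - 1)^p = 1 + P * poly c x\<close>, whose
  Fermat quotient is \<open>- poly c x\<close> modulo \<open>p\<close>. So \<open>NN\<close> counts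
  the level sets of Mirimanoff's polynomial.\<close>

lemma card_NN_ge:
  assumes "T \<ge> 1"
  shows "card {u \<in> {0..<P}. T \<le> NN u} * T ^ 3 \<le> 110592 * p ^ 2"
proof -
  obtain c where "mirimanoff p c" using ex_mirimanoff_poly prime_p odd_p by blast
  then interpret mirimanoff p c .
  let ?A = "{u \<in> {0..<P}. T \<le> NN u}"
  have fqc: "[fq (x ^ p - (x - 1) ^ p) = - poly c x] (mod P)" for x
  proof -
    have "P * poly c x = (1 - x) ^ p - 1 + x ^ p"
      using arg_cong[OF c_eq, of "\<lambda>q. poly q x"] by (simp add: poly_monom)
    moreover have "(x - 1) ^ p = - ((1 - x) ^ p)"
      using power_minus_odd[OF odd_p, of "1 - x"] by simp
    ultimately have "x ^ p - (x - 1) ^ p = 1 + P * poly c x" by simp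
    then show ?thesis using fq_one_add by simp
  qed
  have NN: "NN u \<le> card {x \<in> {2..<P}. [poly c x = (- u) mod P] (mod P)}" for u
  proof -
    have "{x \<in> {2..<P}. fq (x ^ p - (x - 1) ^ p) = u} \<subseteq> {x \<in> {2..<P}. [poly c x = (- u) mod P] (mod P)}"
    proof safe
      fix x assume "u = fq (x ^ p - (x - 1) ^ p)"
      then have "[- u = poly c x] (mod P)" using fqc[of x] cong_minus_minus_iff[of u "- poly c x" P] by simp
      then show "[poly c x = (- fq (x ^ p - (x - 1) ^ p)) mod P] (mod P)"
        using \<open>u = _\<close> by (simp add: cong_sym_eq)
    qed
    moreover have "finite {x \<in> {2..<P}. [poly c x = (- u) mod P] (mod P)}"
      by (rule finite_subset[of _ "{2..<P}"]) auto
    ultimately show ?thesis unfolding NN_def by (intro card_mono)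
  qed
  have "inj_on (\<lambda>u. (- u) mod P) ?A"
  proof (rule inj_onI)
    fix u v assume u: "u \<in> ?A" "v \<in> ?A" "(- u) mod P = (- v) mod P"
    then have "[u = v] (mod P)" using cong_minus_minus_iff[of u v P] by (simp add: Cong.cong_def)
    then show "u = v" using u by (simp add: Cong.cong_def)
  qed
  then have "card ?A = card ((\<lambda>u. (- u) mod P) ` ?A)" by (simp add: card_image)
  moreover have "card ((\<lambda>u. (- u) mod P) ` ?A) * T ^ 3 \<le> 110592 * p ^ 2"
  proof (rule card_popular_values[OF _ assms])
    show "(\<lambda>u. (- u) mod P) ` ?A \<subseteq> {0..<P}" using P_pos by auto
    show "T \<le> card {x \<in> {2..<P}. [poly c x = w] (mod P)}" if w: "w \<in> (\<lambda>u. (- u) mod P) ` ?A" for w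
    proof -
      obtain u where "w = (- u) mod P" "T \<le> NN u" using w by blast
      then show ?thesis using NN[of u] by simp
    qed
  qed
  ultimately show ?thesis by simp
qed

lemma card_level_cube: "card (level i) * 8 ^ i \<le> 110592 * p ^ 2"
proof -
  have "finite {u \<in> {0..<P}. 2 ^ i \<le> NN u}" by (rule finite_subset[of _ "{0..<P}"]) auto
  then have "card (level i) \<le> card {u \<in> {0..<P}. 2 ^ i \<le> NN u}"
    by (intro card_mono) (auto simp: level_def)
  then have "card (level i) * (2 ^ i) ^ 3 \<le> card {u \<in> {0..<P}. 2 ^ i \<le> NN u} * (2 ^ i) ^ 3"
    by (rule mult_right_mono) simp
  also have "\<dots> \<le> 110592 * p ^ 2" by (rule card_NN_ge) simp
  also have "(2 ^ i) ^ 3 = (8 :: nat) ^ i" by (simp add: power_mult[symmetric] mult.commute[of i] power_mult)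
  finally show ?thesis .
qed

lemma lam_level: "card (level i) * 2 ^ i \<le> lam (level i)" "lam (level i) \<le> 2 * (card (level i) * 2 ^ i)"
proof -
  have "(\<Sum>u\<in>level i. 2 ^ i) \<le> lam (level i)" unfolding lam_def by (intro sum_mono) (auto simp: level_def)
  then show "card (level i) * 2 ^ i \<le> lam (level i)" by simp
  have "lam (level i) \<le> (\<Sum>u\<in>level i. 2 ^ Suc i)" unfolding lam_def by (intro sum_mono) (auto simp: level_def)
  then show "lam (level i) \<le> 2 * (card (level i) * 2 ^ i)" by simp
qed

lemma lam_le: "U \<subseteq> {0..<P} \<Longrightarrow> lam U \<le> p"
proof -
  assume U: "U \<subseteq> {0..<P}"
  have "1 \<in> G" using p_ge_3 by (simp add: G_def)
  then have "lam U = card (nbh U 1)" using card_nbh U by simp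
  also have "\<dots> \<le> card G" by (intro card_mono nbh_subset) simp
  finally show ?thesis by (simp add: card_G)
qed

text \<open>The exponents 4/3, 29/20 and 16/11 belong to three regimes: the diagonal dominates in
  \<open>lam_sq_le\<close>, or it dominates in \<open>card_pairs\<close>, or it does in neither. The
  last exponent is the largest. Choosing dominant dyadic levels for \<open>S2\<close> and for the
  third sides costs only powers of \<open>l\<close>.\<close>

theorem S2_bound:
  assumes l: "p \<le> 2 ^ l"
  shows "real S2 ^ 3 \<le> 10 ^ 80 * real l ^ 22 * real p ^ 4
    \<or> real S2 ^ 20 \<le> 10 ^ 80 * real l ^ 22 * real p ^ 29
    \<or> real S2 ^ 11 \<le> 10 ^ 80 * real l ^ 22 * real p ^ 16"
proof (cases "S2 = 0")
  case False
  let ?C = "110592 :: real"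
  have l1: "l \<ge> 1" using l p_ge_3 by (cases l) auto
  have S2a: "S2 \<le> (\<Sum>i<l. 4 ^ Suc i * card (level i))"
    unfolding S2_def
  proof (rule sum_over_levels[OF l, of "\<lambda>n. n\<^sup>2"])
    fix u i assume "u \<in> level i"
    then have "NN u \<le> 2 ^ Suc i" by (auto simp: level_def)
    then have "(NN u)\<^sup>2 \<le> (2 ^ Suc i)\<^sup>2" by (rule power_mono) simp
    also have "(2 ^ Suc i)\<^sup>2 = (4 :: nat) ^ Suc i"
      by (simp add: power2_eq_square flip: power_mult_distrib)
    finally show "(NN u)\<^sup>2 \<le> 4 ^ Suc i" .
  qed simp
  have ex_max: "\<exists>j<l. (\<Sum>i<l. g i) \<le> l * g j" for g :: "nat \<Rightarrow> nat"
  proof -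
    have "Max (g ` {..<l}) \<in> g ` {..<l}" using l1 by (intro Max_in) (auto simp: lessThan_empty_iff)
    then obtain j where "j < l" "Max (g ` {..<l}) = g j" by auto
    moreover have "(\<Sum>i<l. g i) \<le> l * Max (g ` {..<l})"
      using sum_bounded_above[of "{..<l}" g "Max (g ` {..<l})"] by simp
    ultimately show ?thesis by auto
  qed
  obtain i where i: "i < l" "(\<Sum>i<l. 4 ^ Suc i * card (level i)) \<le> l * (4 ^ Suc i * card (level i))"
    using ex_max by blast
  define U where "U = level i"
  define J where "J = card U"
  have S2_le: "S2 \<le> 4 * l * (J * (2 ^ i)\<^sup>2)"
  proof -
    have 4: "(4 :: nat) ^ i = (2 ^ i)\<^sup>2" by (simp add: power2_eq_square flip: power_mult_distrib)
    have "S2 \<le> l * (4 ^ Suc i * card (level i))" using S2a i by linarith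
    also have "\<dots> = 4 * l * (J * (2 ^ i)\<^sup>2)" unfolding U_def J_def power_Suc 4 by simp
    finally show ?thesis .
  qed
  then have J: "J > 0" using False by (cases J) auto
  have U: "U \<subseteq> {0..<P}" unfolding U_def by (rule level_subset)
  have e8: "(8 :: real) ^ i = (2 ^ i) ^ 3" for i by (simp add: power3_eq_cube flip: power_mult_distrib)
  have cube: "real (card (level i)) * (2 ^ i) ^ 3 \<le> ?C * (real p)\<^sup>2" for i
  proof -
    have "real (card (level i) * 8 ^ i) \<le> real (110592 * p ^ 2)"
      using card_level_cube[of i] by (simp only: of_nat_le_iff)
    then show ?thesis unfolding e8[symmetric] by simp
  qed
  have KT: "real (card (level i)) * 2 ^ i \<le> real p" for i
  proof -
    have "card (level i) * 2 ^ i \<le> p" using lam_level(1)[of i] lam_le[OF level_subset, of i] by linarith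
    then have "real (card (level i) * 2 ^ i) \<le> real p" by (simp only: of_nat_le_iff)
    then show ?thesis by simp
  qed
  have S3: "real S3 \<le> 8 * real l * ?C * (real p)\<^sup>2"
  proof -
    have "S3 \<le> (\<Sum>i<l. 8 ^ Suc i * card (level i))"
      unfolding S3_def
    proof (rule sum_over_levels[OF l, of "\<lambda>n. n ^ 3"])
      fix u i assume "u \<in> level i"
      then have "NN u \<le> 2 ^ Suc i" by (auto simp: level_def)
      then have "(NN u) ^ 3 \<le> (2 ^ Suc i) ^ 3" by (rule power_mono) simp
      also have "(2 ^ Suc i) ^ 3 = (8 :: nat) ^ Suc i"
        by (simp add: power3_eq_cube flip: power_mult_distrib)
      finally show "(NN u) ^ 3 \<le> 8 ^ Suc i" .
    qed simp
    also have "\<dots> \<le> (\<Sum>i<l. 8 * (110592 * p ^ 2))"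
      using card_level_cube by (intro sum_mono) (simp add: mult.commute)
    finally have "S3 \<le> l * (8 * (110592 * p ^ 2))" by simp
    then have "real S3 \<le> real (l * (8 * (110592 * p ^ 2)))" by (simp only: of_nat_le_iff)
    then show ?thesis by simp
  qed
  have lamJ: "real J * 2 ^ i \<le> real (lam U)"
  proof -
    have "real (J * 2 ^ i) \<le> real (lam U)"
      using lam_level(1)[of i] unfolding J_def U_def by (simp only: of_nat_le_iff)
    then show ?thesis by simp
  qed
  have hyps: "real p \<ge> 1" "real l \<ge> 1" "?C \<ge> 1" "real S2 \<ge> 0" "real J > 0" "(2 :: real) ^ i \<ge> 1"
    "real S2 \<le> 4 * real l * (real J * (2 ^ i)\<^sup>2)"
    "real J * (2 ^ i) ^ 3 \<le> ?C * (real p)\<^sup>2" "real J * 2 ^ i \<le> real (lam U)"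
  proof -
    have "real S2 \<le> real (4 * l * (J * (2 ^ i)\<^sup>2))" using S2_le by (simp only: of_nat_le_iff)
    then show "real S2 \<le> 4 * real l * (real J * (2 ^ i)\<^sup>2)" by simp
  qed (use p_ge_3 l1 J cube[of i] lamJ in \<open>auto simp: U_def J_def\<close>)
  define tr where "tr = (\<lambda>j. card (tri_set U (level j)))"
  have main: "(lam U)\<^sup>2 * S2 \<le> p\<^sup>2 * lam U + (\<Sum>j<l. 2 ^ Suc j * tr j)"
  proof -
    have "(p - 1)\<^sup>2 * lam U \<le> p\<^sup>2 * lam U" by (intro mult_right_mono power_mono) auto
    then show ?thesis
      using lam_sq_le[OF U] sum_NN_tri_le[OF l, of U] unfolding tr_def by linarith
  qed
  show ?thesis
  proof (cases "(\<Sum>j<l. 2 ^ Suc j * tr j) \<le> p\<^sup>2 * lam U")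
    case True
    then have "(lam U)\<^sup>2 * S2 \<le> 2 * p\<^sup>2 * lam U" using main by linarith
    then have "real ((lam U)\<^sup>2 * S2) \<le> real (2 * p\<^sup>2 * lam U)" by (simp only: of_nat_le_iff)
    then have "real S2 ^ 3 \<le> 32 * ?C * (real l)\<^sup>2 * real p ^ 4"
      by (intro energy_case_diag[OF hyps]) simp
    also have "\<dots> \<le> 10 ^ 80 * real l ^ 22 * real p ^ 4"
      using l1 by (intro mult_right_mono mult_mono power_increasing) auto
    finally show ?thesis by blast
  next
    case False
    then have "(lam U)\<^sup>2 * S2 \<le> 2 * (\<Sum>j<l. 2 ^ Suc j * tr j)" using main by linarith
    moreover obtain j where "j < l" "(\<Sum>j<l. 2 ^ Suc j * tr j) \<le> l * (2 ^ Suc j * tr j)"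
      using ex_max by blast
    ultimately have "(lam U)\<^sup>2 * S2 \<le> 4 * l * 2 ^ j * tr j" by simp
    then have "real ((lam U)\<^sup>2 * S2) \<le> real (4 * l * 2 ^ j * tr j)" by (simp only: of_nat_le_iff)
    then have V: "(real (lam U))\<^sup>2 * real S2 \<le> 4 * real l * 2 ^ j * real (tr j)" by simp
    have t1: "real (tr j) \<le> real p * real (lam U) * (2 * real (card (level j)) * 2 ^ j)"
    proof -
      have "tr j \<le> (p - 1) * lam (level j) * lam U"
        unfolding tr_def by (rule card_tri_set_le[OF U level_subset])
      also have "\<dots> \<le> p * (2 * (card (level j) * 2 ^ j)) * lam U"
        by (intro mult_le_mono lam_level) auto
      finally have "real (tr j) \<le> real (p * (2 * (card (level j) * 2 ^ j)) * lam U)"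
        by (simp only: of_nat_le_iff)
      then show ?thesis by (simp add: mult_ac)
    qed
    define A where "A = card (pairs U (level j))"
    have t2: "(real (tr j))\<^sup>2 \<le> real A * (9 * real l * ?C * real p ^ 3)"
    proof -
      have "(tr j)\<^sup>2 \<le> A * ((p - 1) * ((p - 1)\<^sup>2 + S3))"
        unfolding tr_def A_def by (rule card_tri_set_sq_le[OF U level_subset])
      also have "\<dots> \<le> A * (p * (p\<^sup>2 + S3))"
        by (intro mult_le_mono add_mono power_mono) auto
      finally have "real ((tr j)\<^sup>2) \<le> real (A * (p * (p\<^sup>2 + S3)))" by (simp only: of_nat_le_iff)
      then have "(real (tr j))\<^sup>2 \<le> real A * (real p * ((real p)\<^sup>2 + real S3))" by simp
      also have "\<dots> \<le> real A * (real p * ((real l * ?C) * (real p)\<^sup>2 + 8 * real l * ?C * (real p)\<^sup>2))"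
      proof -
        have "1 * (real p)\<^sup>2 \<le> (real l * ?C) * (real p)\<^sup>2" using l1 by (intro mult_right_mono) auto
        then show ?thesis using S3 by (intro mult_left_mono add_mono) auto
      qed
      also have "\<dots> = real A * (9 * real l * ?C * real p ^ 3)"
        by (simp add: power2_eq_square power3_eq_cube)
      finally show ?thesis .
    qed
    have t3: "(real A)\<^sup>2 \<le> ((real p)\<^sup>2 * real (card (level j))) * (real A + real p * real J ^ 4)"
    proof -
      have "A\<^sup>2 \<le> ((p - 1)\<^sup>2 * card (level j)) * (A + (p - 1) * J ^ 4)"
        unfolding A_def J_def by (rule card_pairs) (auto simp: U_def)
      also have "\<dots> \<le> (p\<^sup>2 * card (level j)) * (A + p * J ^ 4)"
        by (intro mult_le_mono add_mono power_mono) auto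
      finally have "real (A\<^sup>2) \<le> real ((p\<^sup>2 * card (level j)) * (A + p * J ^ 4))" by (simp only: of_nat_le_iff)
      then show ?thesis by simp
    qed
    have "real S2 ^ 20 \<le> 16 ^ 8 * 82944 * ?C ^ 11 * real l ^ 22 * real p ^ 29
        \<or> real S2 ^ 11 \<le> 4096 * 331776 * ?C ^ 5 * real l ^ 13 * real p ^ 16"
      by (rule energy_case_tri[OF hyps, of "real (card (level j))" "2 ^ j" "real (tr j)" "real A"])
        (use V t1 t2 t3 cube[of j] KT[of j] in auto)
    moreover have "16 ^ 8 * 82944 * ?C ^ 11 * real l ^ 22 * real p ^ 29 \<le> 10 ^ 80 * real l ^ 22 * real p ^ 29"
      by (intro mult_right_mono) auto
    moreover have "4096 * 331776 * ?C ^ 5 * real l ^ 13 * real p ^ 16 \<le> 10 ^ 80 * real l ^ 22 * real p ^ 16"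
      using l1 by (intro mult_right_mono mult_mono power_increasing) auto
    ultimately show ?thesis by linarith
  qed
qed simp

end

section \<open>Exponential sums over the \<open>p\<close>-th powers\<close>

context odd_prime begin

definition ee :: "int \<Rightarrow> complex" where
  "ee n = cis (2 * pi * of_int n / of_int Q)"

definition SS :: "int \<Rightarrow> complex" where
  "SS a = (\<Sum>x\<in>G. ee (a * x ^ p))"

lemma Q_pos: "Q > 0" using P_pos by simp

lemma ee_add: "ee (m + n) = ee m * ee n"
  by (simp add: ee_def cis_mult ring_distribs add_divide_distrib)

lemma ee_0 [simp]: "ee 0 = 1" by (simp add: ee_def)

lemma norm_ee [simp]: "norm (ee n) = 1" by (simp add: ee_def)

lemma cnj_ee: "cnj (ee n) = ee (- n)" by (simp add: ee_def cis_cnj)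

lemma ee_dvd:
  assumes "Q dvd n"
  shows "ee n = 1"
proof -
  obtain k where n: "n = Q * k" using assms by blast
  have "2 * pi * of_int n / of_int Q = 2 * pi * of_int k"
    using p_ge_3 by (simp add: n field_simps)
  moreover have "cis (2 * pi * of_int k) = 1"
    by (rule cis_multiple_2pi) simp
  ultimately show ?thesis by (simp only: ee_def)
qed

lemma ee_cong: "[m = n] (mod Q) \<Longrightarrow> ee m = ee n"
  using ee_add[of "m - n" n] ee_dvd[of "m - n"] by (simp add: cong_iff_dvd_diff)

lemma ee_eq_1_imp: "ee n = 1 \<Longrightarrow> Q dvd n"
proof -
  assume "ee n = 1"
  then have "cos (2 * pi * of_int n / of_int Q) = 1" by (simp add: ee_def cis.ctr complex_eq_iff)
  then obtain k :: int where "2 * pi * of_int n / of_int Q = of_int k * 2 * pi"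
    using cos_one_2pi_int by blast
  then have "real_of_int n = of_int k * of_int Q"
    using p_ge_3 by (simp add: field_simps)
  then have "n = k * Q" by (metis of_int_eq_iff of_int_mult)
  then show ?thesis by simp
qed

lemma sum_ee:
  "(\<Sum>a\<in>{0..<Q}. ee (a * n)) = (if Q dvd n then of_int Q else 0)"
proof (cases "Q dvd n")
  case True
  then have "ee (a * n) = 1" for a by (intro ee_dvd) simp
  then show ?thesis using True Q_pos by simp
next
  case False
  have bij: "bij_betw (\<lambda>a. (a + 1) mod Q) {0..<Q} {0..<Q}"
  proof -
    have "inj_on (\<lambda>a. (a + 1) mod Q) {0..<Q}"
    proof (rule inj_onI)
      fix x y assume xy: "x \<in> {0..<Q}" "y \<in> {0..<Q}" "(x + 1) mod Q = (y + 1) mod Q"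
      then have "[x = y] (mod Q)" by (metis cong_add_rcancel Cong.cong_def)
      then show "x = y" using xy by (simp add: Cong.cong_def)
    qed
    moreover have "(\<lambda>a. (a + 1) mod Q) ` {0..<Q} \<subseteq> {0..<Q}" using Q_pos by auto
    ultimately show ?thesis by (simp add: bij_betw_def endo_inj_surj)
  qed
  let ?s = "\<Sum>a\<in>{0..<Q}. ee (a * n)"
  have "?s = (\<Sum>a\<in>{0..<Q}. ee (((a + 1) mod Q) * n))"
    by (rule sum.reindex_bij_betw[OF bij, symmetric])
  also have "\<dots> = (\<Sum>a\<in>{0..<Q}. ee n * ee (a * n))"
  proof (intro sum.cong refl)
    fix a
    have "[((a + 1) mod Q) * n = (a + 1) * n] (mod Q)" by (intro cong_scalar_right) (simp add: Cong.cong_def)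
    then have "ee (((a + 1) mod Q) * n) = ee ((a + 1) * n)" by (rule ee_cong)
    also have "(a + 1) * n = n + a * n" by (simp add: algebra_simps)
    finally show "ee (((a + 1) mod Q) * n) = ee n * ee (a * n)" by (simp only: ee_add)
  qed
  also have "\<dots> = ee n * ?s" by (simp only: sum_distrib_left)
  finally have "(1 - ee n) * ?s = 0" by (simp add: algebra_simps)
  moreover have "ee n \<noteq> 1" using ee_eq_1_imp False by blast
  ultimately show ?thesis using False by simp
qed

lemma norm_SS_le: "norm (SS a) \<le> real p"
proof -
  have "norm (SS a) \<le> (\<Sum>x\<in>G. norm (ee (a * x ^ p)))" unfolding SS_def by (rule norm_sum)
  then show ?thesis by (simp add: card_G)
qed

lemma SS_uminus: "norm (SS (- a)) = norm (SS a)"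
proof -
  have "SS (- a) = cnj (SS a)" unfolding SS_def by (simp add: cnj_ee)
  then show ?thesis by simp
qed

text \<open>By orthogonality the fourth moment is \<open>Q\<close> times the additive energy, which
  is the sum of all \<open>MM y z\<close>.\<close>

lemma sum_norm_SS_fourth:
  "(\<Sum>a\<in>{0..<Q}. norm (SS a) ^ 4) = of_int Q * real ((p - 1) * ((p - 1) + S2))"
proof -
  have sq: "SS a * cnj (SS a) = (\<Sum>y\<in>G. \<Sum>z\<in>G. ee (a * (y ^ p - z ^ p)))" for a
    unfolding SS_def by (simp add: sum_product cnj_ee ee_add[symmetric] algebra_simps)
  have four: "complex_of_real (norm (SS a) ^ 4) = (\<Sum>y\<in>G. \<Sum>z\<in>G. \<Sum>g\<in>G. \<Sum>h\<in>G.
      ee (a * ((y ^ p - z ^ p) - (g ^ p - h ^ p))))" for a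
  proof -
    have "complex_of_real (norm (SS a) ^ 4) = (SS a * cnj (SS a)) * cnj (SS a * cnj (SS a))"
      by (simp add: complex_norm_square[symmetric] power4_eq_xxxx power2_eq_square)
    also have "\<dots> = (\<Sum>y\<in>G. \<Sum>z\<in>G. ee (a * (y ^ p - z ^ p))) * cnj (\<Sum>g\<in>G. \<Sum>h\<in>G. ee (a * (g ^ p - h ^ p)))"
      unfolding sq ..
    also have "\<dots> = (\<Sum>y\<in>G. \<Sum>z\<in>G. \<Sum>g\<in>G. \<Sum>h\<in>G. ee (a * (y ^ p - z ^ p)) * cnj (ee (a * (g ^ p - h ^ p))))"
      by (simp only: cnj_sum sum_distrib_right) (simp only: sum_distrib_left)
    also have "\<dots> = (\<Sum>y\<in>G. \<Sum>z\<in>G. \<Sum>g\<in>G. \<Sum>h\<in>G. ee (a * ((y ^ p - z ^ p) - (g ^ p - h ^ p))))"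
      unfolding cnj_ee ee_add[symmetric] by (simp add: algebra_simps)
    finally show ?thesis .
  qed
  have "complex_of_real (\<Sum>a\<in>{0..<Q}. norm (SS a) ^ 4)
     = (\<Sum>a\<in>{0..<Q}. \<Sum>y\<in>G. \<Sum>z\<in>G. \<Sum>g\<in>G. \<Sum>h\<in>G. ee (a * ((y ^ p - z ^ p) - (g ^ p - h ^ p))))"
    unfolding of_real_sum four ..
  also have "\<dots> = (\<Sum>y\<in>G. \<Sum>z\<in>G. \<Sum>g\<in>G. \<Sum>h\<in>G. \<Sum>a\<in>{0..<Q}. ee (a * ((y ^ p - z ^ p) - (g ^ p - h ^ p))))"
    by (rule trans[OF sum.swap], rule sum.cong[OF refl], rule trans[OF sum.swap], rule sum.cong[OF refl],
        rule trans[OF sum.swap], rule sum.cong[OF refl], rule sum.swap)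
  also have "\<dots> = (\<Sum>y\<in>G. \<Sum>z\<in>G. \<Sum>g\<in>G. \<Sum>h\<in>G. of_int Q * (if [g ^ p - h ^ p = y ^ p - z ^ p] (mod Q) then 1 else 0))"
    unfolding sum_ee
    by (intro sum.cong refl) (auto simp: cong_iff_dvd_diff dvd_diff_commute)
  also have "\<dots> = (\<Sum>y\<in>G. \<Sum>z\<in>G. of_int Q * of_nat (MM y z))"
  proof (intro sum.cong refl)
    fix y z
    have "(\<Sum>g\<in>G. \<Sum>h\<in>G. of_int Q * (if [g ^ p - h ^ p = y ^ p - z ^ p] (mod Q) then 1 else 0 :: complex))
      = of_int Q * (\<Sum>gh\<in>G \<times> G. if [fst gh ^ p - snd gh ^ p = y ^ p - z ^ p] (mod Q) then 1 else 0)"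
      by (simp add: sum.cartesian_product sum_distrib_left split_def)
    also have "(\<Sum>gh\<in>G \<times> G. if [fst gh ^ p - snd gh ^ p = y ^ p - z ^ p] (mod Q) then 1 else 0 :: complex)
      = (\<Sum>gh\<in>{(g, h). g \<in> G \<and> h \<in> G \<and> [g ^ p - h ^ p = y ^ p - z ^ p] (mod Q)}. 1)"
      by (rule sum.mono_neutral_cong_right) auto
    finally show "(\<Sum>g\<in>G. \<Sum>h\<in>G. of_int Q * (if [g ^ p - h ^ p = y ^ p - z ^ p] (mod Q) then 1 else 0 :: complex))
      = of_int Q * of_nat (MM y z)" unfolding MM_def by simp
  qed
  also have "\<dots> = of_int Q * of_nat (\<Sum>y\<in>G. \<Sum>z\<in>G. MM y z)"
    by (simp add: sum_distrib_left)
  also have "(\<Sum>y\<in>G. \<Sum>z\<in>G. MM y z) = (p - 1) * ((p - 1) + S2)"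
    using sum_MM by (simp add: card_G)
  finally have "complex_of_real (\<Sum>a\<in>{0..<Q}. norm (SS a) ^ 4)
    = complex_of_real (of_int Q * real ((p - 1) * ((p - 1) + S2)))" by simp
  then show ?thesis by (simp only: of_real_eq_iff)
qed

lemma SS_mult_pow:
  assumes t: "t \<in> G"
  shows "SS (d * t ^ p) = SS d"
proof -
  have "SS (d * t ^ p) = (\<Sum>x\<in>G. ee (d * ((t * x) mod P) ^ p))"
    unfolding SS_def
  proof (intro sum.cong refl ee_cong)
    fix x
    have "[((t * x) mod P) ^ p = (t * x) ^ p] (mod Q)" by (rule pow_p_cong) (simp add: Cong.cong_def)
    then have "[d * ((t * x) mod P) ^ p = d * (t * x) ^ p] (mod Q)" by (rule cong_scalar_left)
    then show "[d * t ^ p * x ^ p = d * ((t * x) mod P) ^ p] (mod Q)"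
      by (simp add: power_mult_distrib mult.assoc cong_sym)
  qed
  also have "\<dots> = SS d" unfolding SS_def by (rule sum.reindex_bij_betw[OF scale_bij[OF t]])
  finally show ?thesis .
qed

lemma SS_cong: "[a = b] (mod Q) \<Longrightarrow> SS a = SS b"
  unfolding SS_def by (intro sum.cong refl ee_cong cong_scalar_right)

lemma fq_class:
  assumes "\<not> P dvd d" "\<not> P dvd e" "fq d = fq e"
  obtains t where "t \<in> G" "[e = d * t ^ p] (mod Q)"
proof -
  have d: "d mod P \<in> G" "e mod P \<in> G" using assms mod_in_G by auto
  have "e mod P \<in> (\<lambda>x. (d mod P * x) mod P) ` G"
    using bij_betw_imp_surj_on[OF scale_bij[OF d(1)]] d by simp
  then obtain t where t: "t \<in> G" "(d mod P * t) mod P = e mod P" by auto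
  have "[d * t ^ p = d * t] (mod P)" by (rule cong_scalar_left[OF pow_p_mod_P])
  moreover have "[d * t = e] (mod P)" using t(2) by (simp add: Cong.cong_def mod_mult_left_eq)
  ultimately have "[e = d * t ^ p] (mod P)" by (meson cong_sym cong_trans)
  moreover have "fq (d * t ^ p) = fq d"
    using fq_mult_pow[OF G_not_dvd[OF t(1)] assms(1)] by (simp add: mult.commute)
  ultimately have "[e = d * t ^ p] (mod Q)" using assms by (intro unit_eqI) auto
  with t show ?thesis using that by blast
qed

lemma SS_fq_eq:
  assumes "\<not> P dvd d" "\<not> P dvd e" "fq d = fq e"
  shows "SS d = SS e"
  using fq_class[OF assms] SS_cong SS_mult_pow by metis

definition R2 :: "int set \<Rightarrow> nat" where
  "R2 D = card {(d, e). d \<in> D \<and> e \<in> D \<and> fq d = fq e}"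

text \<open>Since \<open>SS\<close> depends on \<open>fq d\<close> only, Cauchy-Schwarz applied
  twice separates the squared multiplicities, with sum \<open>R2 D\<close>, from the fourth powers
  of one value for each coset. Each such value occurs \<open>p - 1\<close> times in the complete
  fourth moment, which saves this factor.\<close>

lemma sum_SS_fourth_le:
  assumes D: "finite D" "\<And>d. d \<in> D \<Longrightarrow> \<not> P dvd d"
  shows "(\<Sum>d\<in>D. norm (SS d)) ^ 4 \<le> (real (card D))\<^sup>2 * real (R2 D) * (of_int Q * real (p + S2))"
proof -
  define r where "r = (\<lambda>u. SOME d. d \<in> D \<and> fq d = u)"
  have r: "r u \<in> D" "fq (r u) = u" if "u \<in> fq ` D" for u
    using that someI_ex[of "\<lambda>d. d \<in> D \<and> fq d = u"] unfolding r_def by auto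
  define m where "m = (\<lambda>u. card {d \<in> D. fq d = u})"
  define s where "s = (\<lambda>u. norm (SS (r u)))"
  have "(\<Sum>d\<in>D. (norm (SS d))\<^sup>2) = (\<Sum>u\<in>fq ` D. \<Sum>d\<in>{d \<in> D. fq d = u}. (norm (SS d))\<^sup>2)"
    by (rule sum.image_gen[OF D(1)])
  also have "\<dots> = (\<Sum>u\<in>fq ` D. real (m u) * (s u)\<^sup>2)"
  proof (intro sum.cong refl)
    fix u assume u: "u \<in> fq ` D"
    have "(\<Sum>d\<in>{d \<in> D. fq d = u}. (norm (SS d))\<^sup>2) = (\<Sum>d\<in>{d \<in> D. fq d = u}. (s u)\<^sup>2)"
    proof (intro sum.cong refl)
      fix d assume "d \<in> {d \<in> D. fq d = u}"
      then have "SS d = SS (r u)" using r[OF u] D(2) by (intro SS_fq_eq) auto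
      then show "(norm (SS d))\<^sup>2 = (s u)\<^sup>2" by (simp add: s_def)
    qed
    then show "(\<Sum>d\<in>{d \<in> D. fq d = u}. (norm (SS d))\<^sup>2) = real (m u) * (s u)\<^sup>2" by (simp add: m_def)
  qed
  finally have 1: "(\<Sum>d\<in>D. (norm (SS d))\<^sup>2) = (\<Sum>u\<in>fq ` D. real (m u) * (s u)\<^sup>2)" .
  have 2: "(\<Sum>u\<in>fq ` D. (m u)\<^sup>2) = R2 D"
    unfolding R2_def m_def power2_eq_square
    by (rule sum_card_fibres_mult) (use D in auto)
  have 3: "real (p - 1) * (\<Sum>u\<in>fq ` D. s u ^ 4) \<le> of_int Q * real ((p - 1) * ((p - 1) + S2))"
  proof -
    let ?f = "\<lambda>(u, t). (r u * t ^ p) mod Q"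
    have "real (p - 1) * (\<Sum>u\<in>fq ` D. s u ^ 4) = (\<Sum>u\<in>fq ` D. \<Sum>t\<in>G. norm (SS ((r u * t ^ p) mod Q)) ^ 4)"
    proof -
      have "norm (SS ((r u * t ^ p) mod Q)) = s u" if "t \<in> G" for u t
      proof -
        have "SS ((r u * t ^ p) mod Q) = SS (r u * t ^ p)" by (rule SS_cong) (simp add: Cong.cong_def)
        then show ?thesis unfolding s_def using SS_mult_pow[OF that] by simp
      qed
      then show ?thesis by (simp add: card_G sum_distrib_left)
    qed
    also have "\<dots> = (\<Sum>ut\<in>fq ` D \<times> G. norm (SS (?f ut)) ^ 4)"
      by (simp add: sum.cartesian_product split_def)
    also have "\<dots> = (\<Sum>a\<in>?f ` (fq ` D \<times> G). norm (SS a) ^ 4)"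
    proof (subst sum.reindex)
      show "inj_on ?f (fq ` D \<times> G)"
      proof (rule inj_onI)
        fix ut ut' assume a: "ut \<in> fq ` D \<times> G" "ut' \<in> fq ` D \<times> G" "?f ut = ?f ut'"
        obtain u t u' t' where e: "ut = (u, t)" "ut' = (u', t')" by (metis prod.exhaust)
        have u: "u \<in> fq ` D" "u' \<in> fq ` D" "t \<in> G" "t' \<in> G" using a e by auto
        have c: "[r u * t ^ p = r u' * t' ^ p] (mod Q)" using a e by (simp add: Cong.cong_def)
        have n: "\<not> P dvd r u" "\<not> P dvd r u'" using r u D by auto
        have "fq (r u * t ^ p) = fq (r u' * t' ^ p)"
          using n u by (intro fq_cong c not_dvd_mult not_dvd_pow) (auto dest: G_not_dvd)
        then have uu: "u = u'"
          using fq_mult_pow[OF G_not_dvd n(1)] fq_mult_pow[OF G_not_dvd n(2)] u r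
          by (simp add: mult.commute)
        have "[r u * t ^ p = r u * t' ^ p] (mod P)" using cong_Q_P[OF c] uu by simp
        then have "P dvd r u * (t ^ p - t' ^ p)" by (simp add: cong_iff_dvd_diff right_diff_distrib)
        then have "P dvd t ^ p - t' ^ p" using n prime_P prime_dvd_mult_iff by blast
        then have "t = t'" using diff_pow_not_dvd u by blast
        then show "ut = ut'" using e uu by simp
      qed
    qed simp
    also have "\<dots> \<le> (\<Sum>a\<in>{0..<Q}. norm (SS a) ^ 4)"
      using Q_pos by (intro sum_mono2) auto
    finally show ?thesis unfolding sum_norm_SS_fourth .
  qed
  then have "real (p - 1) * (\<Sum>u\<in>fq ` D. s u ^ 4) \<le> real (p - 1) * (of_int Q * real ((p - 1) + S2))"
    by (simp only: of_nat_mult mult_ac)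
  then have 4: "(\<Sum>u\<in>fq ` D. s u ^ 4) \<le> of_int Q * real ((p - 1) + S2)"
    using p_ge_3 by (subst (asm) mult_le_cancel_left_pos) auto
  also have "\<dots> \<le> of_int Q * real (p + S2)" using Q_pos by (intro mult_left_mono) auto
  finally have 4: "(\<Sum>u\<in>fq ` D. s u ^ 4) \<le> of_int Q * real (p + S2)" .
  have "(\<Sum>d\<in>D. norm (SS d))\<^sup>2 \<le> real (card D) * (\<Sum>d\<in>D. (norm (SS d))\<^sup>2)"
    using Cauchy_Schwarz_ineq_sum[of "\<lambda>_. 1" "\<lambda>d. norm (SS d)" D] by simp
  then have "((\<Sum>d\<in>D. norm (SS d))\<^sup>2)\<^sup>2 \<le> (real (card D) * (\<Sum>u\<in>fq ` D. real (m u) * (s u)\<^sup>2))\<^sup>2"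
    unfolding 1 by (intro power_mono) auto
  also have "\<dots> = (real (card D))\<^sup>2 * (\<Sum>u\<in>fq ` D. real (m u) * (s u)\<^sup>2)\<^sup>2"
    by (simp add: power_mult_distrib)
  also have "\<dots> \<le> (real (card D))\<^sup>2 * ((\<Sum>u\<in>fq ` D. (real (m u))\<^sup>2) * (\<Sum>u\<in>fq ` D. ((s u)\<^sup>2)\<^sup>2))"
    by (intro mult_left_mono Cauchy_Schwarz_ineq_sum) auto
  also have "(\<Sum>u\<in>fq ` D. (real (m u))\<^sup>2) = real (R2 D)" unfolding 2[symmetric] by simp
  also have "(real (card D))\<^sup>2 * (real (R2 D) * (\<Sum>u\<in>fq ` D. ((s u)\<^sup>2)\<^sup>2))
     \<le> (real (card D))\<^sup>2 * (real (R2 D) * (of_int Q * real (p + S2)))"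
    using 4 by (intro mult_left_mono) (auto simp: power_mult[symmetric])
  finally show ?thesis by (simp add: power_mult[symmetric] mult.assoc)
qed

text \<open>For a \<open>p\<close>-th power \<open>n\<close> up to \<open>X\<close> and
  \<open>a < H\<close> the phase \<open>a n / Q\<close> is at most 1/6, so every term of the sum
  \<open>K\<close> has real part at least 1/2 and \<open>K\<close> is at least \<open>H/2\<close> in
  norm. Its mean square over all \<open>p\<close>-th powers is a sum of \<open>SS (a - b)\<close>,
  with at most \<open>p\<close> from \<open>a = b\<close> for each \<open>a\<close>.\<close>

lemma card_small_elements_le:
  fixes X H :: int and A :: "int set"
  assumes A: "A \<subseteq> {1..X}" "\<And>n. n \<in> A \<Longrightarrow> \<not> P dvd n \<and> fq n = 0"
    and H: "H \<ge> 1" and X: "X \<ge> 0" and XH: "6 * H * X \<le> Q"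
  shows "real (card A) * of_int H \<le> 4 * (real p + 2 * (\<Sum>d\<in>{1..<H}. norm (SS d)))"
proof -
  define K where "K = (\<lambda>x. \<Sum>a\<in>{0..<H}. ee (a * x ^ p))"
  have XQ: "X < Q"
  proof (cases "X = 0")
    case False
    then have "6 * X \<le> 6 * H * X" using H X by (simp add: mult_le_cancel_right)
    then show ?thesis using XH False X by linarith
  qed (use Q_pos in simp)
  have finA: "finite A" using A finite_subset by auto
  \<comment> \<open>From \<open>fq n = 0\<close> it follows that \<open>n\<close> is congruent to
    \<open>n^p\<close>, hence to the \<open>p\<close>-th power of its residue modulo
    \<open>p\<close>.\<close>
  have np: "[(n mod P) ^ p = n] (mod Q)" if "n \<in> A" for n
  proof -
    have "[(n mod P) ^ p = n ^ p] (mod Q)" by (rule pow_p_cong) (simp add: Cong.cong_def)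
    moreover have "[n ^ p = n] (mod Q)" using unit_rep[of n] A(2)[OF that] by simp
    ultimately show ?thesis by (rule cong_trans)
  qed
  have inj: "inj_on (\<lambda>n. n mod P) A"
  proof (rule inj_onI)
    fix m n assume mn: "m \<in> A" "n \<in> A" "m mod P = n mod P"
    then have "[m = n] (mod Q)" using np by (metis cong_sym cong_trans)
    moreover have "m \<in> {1..X}" "n \<in> {1..X}" using mn A by auto
    ultimately show "m = n" using XQ by (simp add: Cong.cong_def)
  qed
  have sub: "(\<lambda>n. n mod P) ` A \<subseteq> G" using A mod_in_G by auto
  have big: "of_int H / 2 \<le> norm (K (n mod P))" if n: "n \<in> A" for n
  proof -
    have "1 / 2 \<le> Re (ee (a * (n mod P) ^ p))" if a: "a \<in> {0..<H}" for a
    proof -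
      have "[a * (n mod P) ^ p = a * n] (mod Q)" by (rule cong_scalar_left[OF np[OF n]])
      then have "ee (a * (n mod P) ^ p) = ee (a * n)" by (rule ee_cong)
      moreover have "6 * (a * n) \<le> Q"
      proof -
        have "a * n \<le> H * X" using a n A X by (intro mult_mono) auto
        then show ?thesis using XH by simp
      qed
      then have "6 * real_of_int (a * n) \<le> of_int Q" by (metis of_int_le_iff of_int_mult of_int_numeral)
      then have "of_int (a * n) / of_int Q \<le> (1 / 6 :: real)"
        using p_ge_3 by (simp add: field_simps)
      then have "2 * pi * (of_int (a * n) / of_int Q) \<le> 2 * pi * (1 / 6)"
        by (rule mult_left_mono) simp
      then have "2 * pi * of_int (a * n) / of_int Q \<le> pi / 3" by simp
      moreover have "0 \<le> 2 * pi * real_of_int (a * n) / of_int Q"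
        using a n A Q_pos by (intro divide_nonneg_nonneg mult_nonneg_nonneg) auto
      ultimately have "cos (pi / 3) \<le> cos (2 * pi * of_int (a * n) / of_int Q)"
        by (intro cos_monotone_0_pi_le) auto
      then show ?thesis using \<open>ee (a * (n mod P) ^ p) = ee (a * n)\<close> by (simp add: ee_def cos_60)
    qed
    then have "(\<Sum>a\<in>{0..<H}. 1 / 2) \<le> (\<Sum>a\<in>{0..<H}. Re (ee (a * (n mod P) ^ p)))" by (rule sum_mono)
    then have "of_int H / 2 \<le> Re (K (n mod P))" using H by (simp add: K_def)
    also have "\<dots> \<le> norm (K (n mod P))" by (rule complex_Re_le_cmod)
    finally show ?thesis .
  qed
  have "real (card A) * (of_int H / 2)\<^sup>2 = (\<Sum>n\<in>A. (of_int H / 2)\<^sup>2)" by simp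
  also have "\<dots> \<le> (\<Sum>n\<in>A. (norm (K (n mod P)))\<^sup>2)"
    using big H by (intro sum_mono power_mono) auto
  also have "\<dots> = (\<Sum>x\<in>(\<lambda>n. n mod P) ` A. (norm (K x))\<^sup>2)"
    by (simp add: sum.reindex[OF inj])
  also have "\<dots> \<le> (\<Sum>x\<in>G. (norm (K x))\<^sup>2)"
    using sub by (intro sum_mono2) auto
  finally have low: "real (card A) * (of_int H / 2)\<^sup>2 \<le> (\<Sum>x\<in>G. (norm (K x))\<^sup>2)" .
  have "complex_of_real (\<Sum>x\<in>G. (norm (K x))\<^sup>2) = (\<Sum>x\<in>G. K x * cnj (K x))"
    by (simp add: complex_norm_square[symmetric])
  also have "\<dots> = (\<Sum>x\<in>G. \<Sum>a\<in>{0..<H}. \<Sum>b\<in>{0..<H}. ee ((a - b) * x ^ p))"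
    unfolding K_def by (simp add: sum_product cnj_ee ee_add[symmetric] algebra_simps)
  also have "\<dots> = (\<Sum>a\<in>{0..<H}. \<Sum>b\<in>{0..<H}. SS (a - b))"
    unfolding SS_def by (rule trans[OF sum.swap], rule sum.cong[OF refl], rule sum.swap)
  finally have eq: "complex_of_real (\<Sum>x\<in>G. (norm (K x))\<^sup>2) = (\<Sum>a\<in>{0..<H}. \<Sum>b\<in>{0..<H}. SS (a - b))" .
  have "(\<Sum>x\<in>G. (norm (K x))\<^sup>2) = norm (complex_of_real (\<Sum>x\<in>G. (norm (K x))\<^sup>2))"
    unfolding norm_of_real by (rule abs_of_nonneg[symmetric], rule sum_nonneg, simp)
  also have "\<dots> = norm (\<Sum>a\<in>{0..<H}. \<Sum>b\<in>{0..<H}. SS (a - b))" unfolding eq ..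
  also have "\<dots> \<le> (\<Sum>a\<in>{0..<H}. \<Sum>b\<in>{0..<H}. norm (SS (a - b)))"
    by (intro order_trans[OF norm_sum] sum_mono norm_sum)
  also have "\<dots> \<le> (\<Sum>a\<in>{0..<H}. real p + 2 * (\<Sum>d\<in>{1..<H}. norm (SS d)))"
  proof (rule sum_mono)
    fix a assume a: "a \<in> {0..<H}"
    have "{0..<H} = insert a ({0..<a} \<union> {a<..<H})" using a by auto
    then have "(\<Sum>b\<in>{0..<H}. norm (SS (a - b))) = norm (SS (a - a)) + ((\<Sum>b\<in>{0..<a}. norm (SS (a - b)))
        + (\<Sum>b\<in>{a<..<H}. norm (SS (a - b))))"
      by (simp only:) (subst sum.insert, simp, simp, subst sum.union_disjoint, auto)
    also have "(\<Sum>b\<in>{0..<a}. norm (SS (a - b))) = (\<Sum>d\<in>(\<lambda>b. a - b) ` {0..<a}. norm (SS d))"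
      by (subst sum.reindex) (auto simp: inj_on_def)
    also have "\<dots> \<le> (\<Sum>d\<in>{1..<H}. norm (SS d))"
      using a by (intro sum_mono2) auto
    also have "(\<Sum>b\<in>{a<..<H}. norm (SS (a - b))) = (\<Sum>d\<in>(\<lambda>b. b - a) ` {a<..<H}. norm (SS d))"
    proof (subst sum.reindex)
      show "(\<Sum>b\<in>{a<..<H}. norm (SS (a - b))) = sum ((\<lambda>d. norm (SS d)) \<circ> (\<lambda>b. b - a)) {a<..<H}"
        using SS_uminus[of "_ - a"] by (intro sum.cong refl) (metis minus_diff_eq o_apply)
    qed (auto simp: inj_on_def)
    also have "\<dots> \<le> (\<Sum>d\<in>{1..<H}. norm (SS d))"
      using a by (intro sum_mono2) auto
    finally show "(\<Sum>b\<in>{0..<H}. norm (SS (a - b))) \<le> real p + 2 * (\<Sum>d\<in>{1..<H}. norm (SS d))"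
      using norm_SS_le[of "a - a"] by linarith
  qed
  also have "\<dots> = of_int H * (real p + 2 * (\<Sum>d\<in>{1..<H}. norm (SS d)))" using H by simp
  finally have "of_int H * (real (card A) * of_int H) \<le> of_int H * (4 * (real p + 2 * (\<Sum>d\<in>{1..<H}. norm (SS d))))"
    using low by (simp add: power2_eq_square field_simps)
  then show ?thesis using H by (subst (asm) mult_le_cancel_left_pos) auto
qed

end

section \<open>Primes and smooth numbers\<close>

lemma multiplicity_eq_card:
  fixes q n :: nat
  assumes q: "prime q" and n: "0 < n" and N: "n < q ^ Suc N"
  shows "multiplicity q n = card {i \<in> {1..N}. q ^ i dvd n}"
proof -
  have q2: "q \<ge> 2" using q prime_ge_2_nat by blast
  have fm: "q ^ i dvd n \<longleftrightarrow> i \<le> multiplicity q n" for i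
    using n q2 by (intro power_dvd_iff_le_multiplicity) auto
  have "q ^ multiplicity q n \<le> n" using multiplicity_dvd n by (intro dvd_imp_le) auto
  then have "q ^ multiplicity q n < q ^ Suc N" using N by linarith
  then have "multiplicity q n < Suc N" by (rule power_less_imp_less_exp[rotated]) (use q2 in simp)
  then have "multiplicity q n \<le> N" by simp
  then have "{i \<in> {1..N}. q ^ i dvd n} = {1..multiplicity q n}" by (auto simp: fm)
  then show ?thesis by simp
qed

lemma multiplicity_fact_nat:
  fixes q :: nat
  assumes q: "prime q"
  shows "n < q ^ Suc N \<Longrightarrow> multiplicity q (fact n :: nat) = (\<Sum>i\<in>{1..N}. n div q ^ i)"
proof (induction n)
  case (Suc n)
  have q0: "q > 0" using q prime_gt_0_nat by blast
  have "multiplicity q (fact (Suc n) :: nat) = multiplicity q (Suc n) + multiplicity q (fact n)"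
    unfolding fact_Suc using q by (subst prime_elem_multiplicity_mult_distrib) auto
  also have "\<dots> = (\<Sum>i\<in>{1..N}. if q ^ i dvd Suc n then 1 else 0) + (\<Sum>i\<in>{1..N}. n div q ^ i)"
    using Suc by (simp add: multiplicity_eq_card[OF q, of "Suc n" N] sum.If_cases Int_def)
  also have "\<dots> = (\<Sum>i\<in>{1..N}. Suc n div q ^ i)"
    unfolding sum.distrib[symmetric] using q0
    by (intro sum.cong refl) (auto simp: div_Suc dvd_eq_mod_eq_0)
  finally show ?case .
qed simp

text \<open>In Legendre's formula each \<open>q^i\<close> contributes
  \<open>(2 n) div q^i - 2 (n div q^i)\<close>, at most 1, and only powers up to \<open>2 n\<close>
  contribute.\<close>

lemma prime_power_central_binomial_le:
  fixes q :: nat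
  assumes q: "prime q" and n: "n > 0"
  shows "q ^ multiplicity q ((2 * n) choose n) \<le> 2 * n"
proof -
  have q2: "q \<ge> 2" using q prime_ge_2_nat by blast
  obtain N where N: "q ^ N \<le> 2 * n" "2 * n < q ^ Suc N"
    using ex_power_ivl1[of q "2 * n"] q2 n by auto
  have nN: "n < q ^ Suc N" using N by linarith
  have "((2 * n) choose n) * (fact n * fact n) = (fact (2 * n) :: nat)"
    using binomial_fact_lemma[of n "2 * n"] by (simp add: mult_2 mult_ac)
  moreover have "multiplicity q (((2 * n) choose n) * (fact n * fact n))
      = multiplicity q ((2 * n) choose n) + (multiplicity q (fact n :: nat) + multiplicity q (fact n :: nat))"
    using q by (simp add: prime_elem_multiplicity_mult_distrib binomial_eq_0_iff)
  ultimately have "multiplicity q ((2 * n) choose n) + 2 * (\<Sum>i\<in>{1..N}. n div q ^ i)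
      = (\<Sum>i\<in>{1..N}. (2 * n) div q ^ i)"
    using multiplicity_fact_nat[OF q N(2)] multiplicity_fact_nat[OF q nN] by simp
  also have "\<dots> \<le> (\<Sum>i\<in>{1..N}. 2 * (n div q ^ i) + 1)"
  proof (rule sum_mono)
    fix i
    have m: "q ^ i > 0" using q2 by simp
    have "2 * n = 2 * (q ^ i * (n div q ^ i)) + 2 * (n mod q ^ i)" by (metis distrib_left mult_div_mod_eq)
    moreover have "n mod q ^ i < q ^ i" using m by simp
    ultimately have "2 * n < q ^ i * (2 * (n div q ^ i) + 2)" by (simp add: algebra_simps)
    then have "(2 * n) div q ^ i < 2 * (n div q ^ i) + 2" using m by (simp add: div_less_iff_less_mult mult.commute)
    then show "(2 * n) div q ^ i \<le> 2 * (n div q ^ i) + 1" by linarith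
  qed
  also have "\<dots> = 2 * (\<Sum>i\<in>{1..N}. n div q ^ i) + N"
    unfolding sum.distrib sum_distrib_left[symmetric] by simp
  finally have "multiplicity q ((2 * n) choose n) \<le> N" by simp
  then have "q ^ multiplicity q ((2 * n) choose n) \<le> q ^ N" using q2 by (intro power_increasing) auto
  with N show ?thesis by linarith
qed

text \<open>The central binomial coefficient is at least \<open>2^n\<close> and has at most one
  prime power factor, not exceeding \<open>2 n\<close>, for each prime up to
  \<open>2 n\<close>.\<close>

lemma two_power_le_prime_count:
  assumes n: "n > 0"
  shows "2 ^ n \<le> (2 * n) ^ card {q. prime q \<and> q \<le> 2 * n}"
proof -
  let ?B = "(2 * n) choose n"
  have B: "?B > 0" by (simp add: zero_less_binomial_iff)
  have "?B = (\<Prod>q\<in>prime_factors ?B. q ^ multiplicity q ?B)"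
    using B by (simp add: prod_prime_factors)
  also have "\<dots> \<le> (\<Prod>q\<in>prime_factors ?B. 2 * n)"
    using n by (intro prod_mono) (auto intro!: prime_power_central_binomial_le)
  also have "\<dots> = (2 * n) ^ card (prime_factors ?B)" by simp
  also have "\<dots> \<le> (2 * n) ^ card {q. prime q \<and> q \<le> 2 * n}"
  proof (rule power_increasing)
    have "prime_factors ?B \<subseteq> {q. prime q \<and> q \<le> 2 * n}"
    proof
      fix q assume q: "q \<in> prime_factors ?B"
      then have pq: "prime q" "q dvd ?B" by auto
      then have "multiplicity q ?B \<ge> 1" using B by (simp add: prime_multiplicity_gt_zero_iff Suc_le_eq)
      then have "q ^ 1 \<le> q ^ multiplicity q ?B"
        using pq prime_gt_0_nat by (intro power_increasing) (auto simp: Suc_le_eq)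
      also have "\<dots> \<le> 2 * n" using prime_power_central_binomial_le[OF pq(1) n] .
      finally show "q \<in> {q. prime q \<and> q \<le> 2 * n}" using pq by simp
    qed
    then show "card (prime_factors ?B) \<le> card {q. prime q \<and> q \<le> 2 * n}"
      by (intro card_mono) auto
  qed (use n in auto)
  finally have 1: "?B \<le> (2 * n) ^ card {q. prime q \<and> q \<le> 2 * n}" .
  have "2 ^ n \<le> (2 * n) choose n"
  proof -
    have "(2 * n div n) ^ n \<le> (2 * n) choose n"
      using binomial_ge_n_over_k_pow_k[of n "2 * n", where 'a = real] n
      by simp
    then show ?thesis using n by simp
  qed
  with 1 show ?thesis by linarith
qed

section \<open>Lower and upper bounds for numbers of smooth integers\<close>

lemma card_products_ge:
  fixes A :: "nat set"
  assumes A: "finite A" "\<And>q. q \<in> A \<Longrightarrow> prime q \<and> q \<le> y" and j: "y ^ j \<le> Z"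
  shows "card A choose j \<le> card {n \<in> {1..Z}. prime_factors n \<subseteq> A}"
proof -
  let ?S = "{B. B \<subseteq> A \<and> card B = j}"
  have pf: "prime_factors (\<Prod>B) = B" if "B \<subseteq> A" for B
  proof -
    have fin: "finite B" using A that finite_subset by auto
    have pr: "prime q" if "q \<in> B" for q using that \<open>B \<subseteq> A\<close> A by auto
    have "0 \<notin> B" using pr not_prime_0 by blast
    then have "(\<Prod>B) \<noteq> 0" using fin by simp
    then have h1: "q \<in> prime_factors (\<Prod>B) \<longleftrightarrow> prime q \<and> (\<exists>r\<in>B. q dvd r)" for q
    proof (cases "prime q")
      case True
      then show ?thesis using fin \<open>\<Prod>B \<noteq> 0\<close> prime_dvd_prod_iff[OF fin, of q "\<lambda>x. x"]
        by (simp add: in_prime_factors_iff)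
    qed (simp add: in_prime_factors_iff)
    have h2: "prime q \<and> (\<exists>r\<in>B. q dvd r) \<longleftrightarrow> q \<in> B" for q
    proof
      assume "prime q \<and> (\<exists>r\<in>B. q dvd r)"
      then obtain r where r: "prime q" "r \<in> B" "q dvd r" by blast
      then have "q = r" using pr[of r] by (intro primes_dvd_imp_eq)
      then show "q \<in> B" using r by simp
    next
      assume q: "q \<in> B"
      show "prime q \<and> (\<exists>r\<in>B. q dvd r)" by (intro conjI pr[OF q] bexI[OF dvd_refl q])
    qed
    show ?thesis
    proof (rule Set.set_eqI)
      fix q show "q \<in> prime_factors (\<Prod>B) \<longleftrightarrow> q \<in> B" using h1[of q] h2[of q] by (rule trans)
    qed
  qed
  have "inj_on (\<lambda>B. \<Prod>B) ?S"
  proof (rule inj_onI)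
    fix B C assume B: "B \<in> ?S" and C: "C \<in> ?S" and eq: "\<Prod>B = \<Prod>C"
    have "B = prime_factors (\<Prod>B)" using pf[of B] B by simp
    also have "\<dots> = C" unfolding eq using pf[of C] C by simp
    finally show "B = C" .
  qed
  moreover have "(\<lambda>B. \<Prod>B) ` ?S \<subseteq> {n \<in> {1..Z}. prime_factors n \<subseteq> A}"
  proof clarify
    fix B assume B: "B \<subseteq> A" "j = card B"
    have fin: "finite B" using A B finite_subset by auto
    have "(\<Prod>B) \<le> (\<Prod>q\<in>B. y)" using A B by (intro prod_mono) auto
    then have "(\<Prod>B) \<le> Z" using j B by simp
    moreover have "(\<Prod>B) > 0" using A B fin by (auto simp: prime_gt_0_nat intro!: prod_pos)
    ultimately show "(\<Prod>B) \<in> {1..Z} \<and> prime_factors (\<Prod>B) \<subseteq> A" using pf[OF B(1)] B by auto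
  qed
  ultimately have "card ?S \<le> card {n \<in> {1..Z}. prime_factors n \<subseteq> A}"
    by (rule card_inj_on_le) simp
  then show ?thesis using A by (simp add: n_subsets)
qed

text \<open>Rankin's trick with exponent \<open>1/2\<close>.\<close>

lemma card_smooth_le:
  fixes A :: "nat set"
  assumes "finite A" "\<And>q. q \<in> A \<Longrightarrow> prime q"
  shows "real (card {n \<in> {1..x}. prime_factors n \<subseteq> A}) \<le> sqrt (real x) * (\<Prod>q\<in>A. 1 / (1 - 1 / sqrt (real q)))"
  using assms
proof (induction A arbitrary: x rule: finite_induct)
  case empty
  have "{n \<in> {1..x}. prime_factors n \<subseteq> {}} \<subseteq> (if x = 0 then {} else {1})"
    by (auto simp: prime_factorization_empty_iff)
  then have "card {n \<in> {1..x}. prime_factors n \<subseteq> {}} \<le> card (if x = 0 then {} else {1 :: nat})"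
    by (intro card_mono) auto
  also have "real \<dots> \<le> sqrt (real x)" by auto
  finally show ?case by simp
next
  case (insert q A)
  have q: "prime q" using insert by simp
  have q2: "q \<ge> 2" using q prime_ge_2_nat by blast
  define c where "c = 1 - 1 / sqrt (real q)"
  have "1 / sqrt (real q) < 1" using q2 by (simp add: real_sqrt_gt_1_iff)
  then have c: "c > 0" by (simp add: c_def)
  define R where "R = (\<Prod>q\<in>A. 1 / (1 - 1 / sqrt (real q)))"
  have "R \<ge> 0"
    unfolding R_def using insert.prems
  proof (intro prod_nonneg)
    fix q assume "q \<in> A"
    then have "1 \<le> sqrt (real q)" using insert.prems prime_ge_1_nat[of q] by simp
    then show "0 \<le> 1 / (1 - 1 / sqrt (real q))" by (simp add: divide_le_eq)
  qed
  let ?f = "\<lambda>A x. card {n \<in> {1..x}. prime_factors n \<subseteq> A}"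
  show ?case
  proof (induction x rule: less_induct)
    case (less x)
    show ?case
    proof (cases "x = 0")
      case False
      have "{n \<in> {1..x}. prime_factors n \<subseteq> insert q A}
         \<subseteq> {n \<in> {1..x}. prime_factors n \<subseteq> A} \<union> (\<lambda>n. q * n) ` {n \<in> {1..x div q}. prime_factors n \<subseteq> insert q A}"
      proof
        fix n assume n: "n \<in> {n \<in> {1..x}. prime_factors n \<subseteq> insert q A}"
        show "n \<in> {n \<in> {1..x}. prime_factors n \<subseteq> A} \<union> (\<lambda>n. q * n) ` {n \<in> {1..x div q}. prime_factors n \<subseteq> insert q A}"
        proof (cases "q dvd n")
          case True
          then obtain m where m: "n = q * m" by blast
          then have "m > 0" using n by (cases m) auto
          then have "prime_factors m \<subseteq> prime_factors n" using n m by (intro dvd_prime_factors) auto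
          moreover have "m \<le> x div q" using n m q2 by (simp add: less_eq_div_iff_mult_less_eq mult.commute)
          ultimately show ?thesis using n m \<open>m > 0\<close> by auto
        next
          case False
          then have "q \<notin> prime_factors n" by auto
          then show ?thesis using n by auto
        qed
      qed
      then have "?f (insert q A) x \<le> card ({n \<in> {1..x}. prime_factors n \<subseteq> A} \<union> (\<lambda>n. q * n) ` {n \<in> {1..x div q}. prime_factors n \<subseteq> insert q A})"
        by (intro card_mono) auto
      also have "\<dots> \<le> ?f A x + card ((\<lambda>n. q * n) ` {n \<in> {1..x div q}. prime_factors n \<subseteq> insert q A})"
        by (rule card_Un_le)
      also have "\<dots> \<le> ?f A x + ?f (insert q A) (x div q)"
        by (intro add_left_mono card_image_le) auto
      finally have "real (?f (insert q A) x) \<le> real (?f A x) + real (?f (insert q A) (x div q))"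
        by (simp only: of_nat_add[symmetric] of_nat_le_iff)
      also have "real (?f A x) \<le> sqrt (real x) * R"
        unfolding R_def using insert by simp
      also have "real (?f (insert q A) (x div q)) \<le> sqrt (real (x div q)) * (1 / c * R)"
        using less.IH[of "x div q"] False q2 insert.hyps unfolding c_def R_def by simp
      also have "\<dots> \<le> (sqrt (real x) / sqrt (real q)) * (1 / c * R)"
      proof (rule mult_right_mono)
        have "real (x div q) \<le> real x / real q" by (rule of_nat_div_le_of_nat)
        then show "sqrt (real (x div q)) \<le> sqrt (real x) / sqrt (real q)"
          by (metis real_sqrt_divide real_sqrt_le_mono)
      qed (use c \<open>R \<ge> 0\<close> in simp)
      also have "sqrt (real x) * R + (sqrt (real x) / sqrt (real q)) * (1 / c * R)
         = sqrt (real x) * (1 / c * R) * (c + 1 / sqrt (real q))"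
        using c by (simp add: field_simps)
      \<comment> \<open>This identity closes the recursion \<open>x \<mapsto> x div q\<close> and
        explains the Euler factor.\<close>
      also have "c + 1 / sqrt (real q) = 1" by (simp add: c_def)
      finally show ?thesis using insert.hyps unfolding c_def R_def by simp
    qed simp
  qed
qed

text \<open>The primes are replaced by all integers up to \<open>y\<close>. This is affordable: for
  \<open>y\<close> a power of \<open>log p\<close> with exponent below 2 the bound is still
  \<open>p^o(1)\<close>.\<close>

lemma prod_rankin_le:
  fixes A :: "nat set"
  assumes A: "A \<subseteq> {q. prime q \<and> q \<le> y}"
  shows "(\<Prod>q\<in>A. 1 / (1 - 1 / sqrt (real q))) \<le> exp (8 * sqrt (real y))"
proof -
  have finA: "finite A" using A by (rule finite_subset) (auto intro: finite_subset[of _ "{..y}"])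
  have one: "1 / (1 - 1 / sqrt (real q)) \<le> exp (4 / sqrt (real q))" if "prime q" for q
  proof -
    define t where "t = 1 / sqrt (real q)"
    have q2: "q \<ge> 2" using that prime_ge_2_nat by blast
    \<comment> \<open>The inequality \<open>1 / (1 - t) \<le> 1 + 4 t\<close> holds precisely up to
      \<open>t = 3/4\<close>, and \<open>q = 2\<close> is the worst case.\<close>
    have t: "t > 0" "t \<le> 3 / 4"
    proof -
      show "t > 0" using q2 by (simp add: t_def)
      have "4 / 3 \<le> sqrt (2 :: real)" by (rule real_le_rsqrt) (simp add: power2_eq_square)
      also have "\<dots> \<le> sqrt (real q)" using q2 by simp
      finally show "t \<le> 3 / 4" using q2 unfolding t_def by (simp add: field_simps)
    qed
    have "1 / (1 - t) \<le> 1 + 4 * t"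
    proof -
      have "1 \<le> (1 + 4 * t) * (1 - t)" using t mult_left_mono[of t "3/4" t] by (simp add: algebra_simps)
      then show ?thesis using t by (simp add: field_simps)
    qed
    also have "\<dots> \<le> exp (4 * t)" by (rule exp_ge_add_one_self)
    finally show ?thesis by (simp add: t_def)
  qed
  have "(\<Prod>q\<in>A. 1 / (1 - 1 / sqrt (real q))) \<le> (\<Prod>q\<in>A. exp (4 / sqrt (real q)))"
  proof (rule prod_mono)
    fix q assume "q \<in> A"
    then have q: "prime q" using A by blast
    then have "1 \<le> sqrt (real q)" using prime_ge_1_nat[of q] by simp
    then have "0 \<le> 1 / (1 - 1 / sqrt (real q))" by (simp add: divide_le_eq)
    with one[OF q] show "0 \<le> 1 / (1 - 1 / sqrt (real q)) \<and> 1 / (1 - 1 / sqrt (real q)) \<le> exp (4 / sqrt (real q))"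
      by simp
  qed
  also have "\<dots> = exp (\<Sum>q\<in>A. 4 / sqrt (real q))" using finA by (simp add: exp_sum)
  also have "(\<Sum>q\<in>A. 4 / sqrt (real q)) \<le> (\<Sum>n\<in>{1..y}. 4 / sqrt (real n))"
  proof (rule sum_mono2)
    show "A \<subseteq> {1..y}"
    proof
      fix q assume "q \<in> A"
      then have "prime q" "q \<le> y" using A by auto
      then show "q \<in> {1..y}" using prime_ge_1_nat[of q] by simp
    qed
  qed auto
  also have "(\<Sum>n\<in>{1..y}. 4 / sqrt (real n)) \<le> 8 * sqrt (real y)"
  proof (induction y)
    case (Suc y)
    have step: "8 * r + 4 / s \<le> 8 * s" if "s > 0" "s\<^sup>2 = r\<^sup>2 + 1" for r s :: real
    proof -
      have "0 \<le> (s - r)\<^sup>2" by simp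
      then have "2 * (r * s) + 1 \<le> 2 * s\<^sup>2" using that by (simp add: power2_diff mult_ac)
      moreover have "(8 * r + 4 / s) * s = 4 * (2 * (r * s) + 1)" using that by (simp add: field_simps)
      ultimately have "(8 * r + 4 / s) * s \<le> (8 * s) * s" by (simp add: power2_eq_square)
      then show ?thesis using that by simp
    qed
    have "8 * sqrt (real y) + 4 / sqrt (real (Suc y)) \<le> 8 * sqrt (real (Suc y))"
      by (rule step) (auto simp: add.commute)
    with Suc show ?case by simp
  qed simp
  finally show ?thesis by simp
qed

section \<open>Coinciding Fermat quotients\<close>

text \<open>The divisor function by its product formula, a form that also bounds
  \<open>2 ^ card (prime_factors n)\<close>.\<close>

definition tau :: "nat \<Rightarrow> nat" where
  "tau n = (\<Prod>q\<in>prime_factors n. Suc (multiplicity q n))"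

lemma card_divisors_le_tau:
  assumes n: "n > 0"
  shows "card {d. d dvd n} \<le> tau n"
proof -
  let ?f = "\<lambda>d. \<lambda>q\<in>prime_factors n. multiplicity q d"
  have "inj_on ?f {d. d dvd n}"
  proof (rule inj_onI)
    fix d e assume d: "d \<in> {d. d dvd n}" and e: "e \<in> {d. d dvd n}" and eq: "?f d = ?f e"
    have 0: "d > 0" "e > 0" using d e n by (auto intro: Nat.gr0I)
    show "d = e"
    proof (rule multiplicity_eq_nat[OF 0])
      fix q :: nat assume q: "prime q"
      show "multiplicity q d = multiplicity q e"
      proof (cases "q dvd n")
        case True
        then have "q \<in> prime_factors n" using q n by (simp add: in_prime_factors_iff)
        then show ?thesis using fun_cong[OF eq, of q] by simp
      next
        case False
        then have "\<not> q dvd d" "\<not> q dvd e" using d e by (auto dest: dvd_trans)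
        then show ?thesis by (simp add: not_dvd_imp_multiplicity_0)
      qed
    qed
  qed
  moreover have "?f ` {d. d dvd n} \<subseteq> (\<Pi>\<^sub>E q\<in>prime_factors n. {..multiplicity q n})"
    using n by (auto intro!: dvd_imp_multiplicity_le)
  ultimately have "card {d. d dvd n} \<le> card (\<Pi>\<^sub>E q\<in>prime_factors n. {..multiplicity q n})"
    by (rule card_inj_on_le) (simp add: finite_PiE)
  also have "\<dots> = tau n" unfolding tau_def by (simp add: card_PiE)
  finally show ?thesis .
qed

lemma two_power_le_tau: "n > 0 \<Longrightarrow> 2 ^ card (prime_factors n) \<le> tau n"
proof -
  assume n: "n > 0"
  have "(\<Prod>q\<in>prime_factors n. 2) \<le> (\<Prod>q\<in>prime_factors n. Suc (multiplicity q n))"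
  proof (rule prod_mono)
    fix q assume "q \<in> prime_factors n"
    then have "multiplicity q n > 0" using n by (simp add: prime_factors_multiplicity)
    then show "0 \<le> (2 :: nat) \<and> 2 \<le> Suc (multiplicity q n)" by simp
  qed
  then show ?thesis by (simp add: tau_def)
qed

text \<open>Comparison with \<open>n^e\<close> prime by prime: a prime with
  \<open>q^e \<ge> 2\<close> satisfies \<open>a + 1 \<le> 2^a \<le> q^(a e)\<close>, and each of the
  finitely many smaller ones costs at most the factor \<open>K\<close>.\<close>

lemma tau_le_powr:
  fixes e :: real
  assumes e: "e > 0"
  shows "\<exists>C\<ge>1. \<forall>n>0. real (tau n) \<le> C * real n powr e"
proof -
  define K where "K = 1 + 1 / (e * ln 2)"
  define N where "N = nat \<lceil>2 powr (1 / e)\<rceil>"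
  have K: "K \<ge> 1" using e by (simp add: K_def)
  have step: "real (Suc a) \<le> (if q \<le> N then K else 1) * (real q powr e) ^ a" if q: "q \<ge> 2" for q a :: nat
  proof (cases "q \<le> N")
    case True
    have "real (Suc a) \<le> K * (1 + real a * (e * ln 2))"
      unfolding K_def using e by (simp add: field_simps)
    also have "\<dots> \<le> K * exp (real a * (e * ln 2))"
      using K by (intro mult_left_mono exp_ge_add_one_self) auto
    also have "exp (real a * (e * ln 2)) = (2 powr e) ^ a" by (simp add: powr_def exp_of_nat_mult)
    also have "(2 powr e) ^ a \<le> (real q powr e) ^ a" using q e by (intro power_mono powr_mono2) auto
    finally show ?thesis using True K by simp
  next
    case False
    then have "2 powr (1 / e) \<le> real q" unfolding N_def by linarith
    then have "(2 powr (1 / e)) powr e \<le> real q powr e" using e by (intro powr_mono2) auto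
    then have "2 \<le> real q powr e" using e by (simp add: powr_powr)
    then have "2 ^ a \<le> (real q powr e) ^ a" by (intro power_mono) auto
    moreover have "real (Suc a) \<le> 2 ^ a"
    proof -
      have "Suc a \<le> 2 ^ a" by (induction a) auto
      then have "real (Suc a) \<le> real (2 ^ a)" by (simp only: of_nat_le_iff)
      then show ?thesis by simp
    qed
    ultimately show ?thesis using False by simp
  qed
  have "real (tau n) \<le> K ^ Suc N * real n powr e" if n: "n > 0" for n
  proof -
    let ?A = "prime_factors n"
    have "real (tau n) = (\<Prod>q\<in>?A. real (Suc (multiplicity q n)))" unfolding tau_def by (rule of_nat_prod)
    also have "\<dots> \<le> (\<Prod>q\<in>?A. (if q \<le> N then K else 1) * (real q powr e) ^ multiplicity q n)"
      using prime_ge_2_nat by (intro prod_mono conjI step) (auto simp: in_prime_factors_iff)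
    also have "\<dots> = (\<Prod>q\<in>?A. (if q \<le> N then K else 1)) * (\<Prod>q\<in>?A. (real q powr e) ^ multiplicity q n)"
      by (rule prod.distrib)
    also have "(\<Prod>q\<in>?A. (if q \<le> N then K else 1)) = K ^ card (?A \<inter> {q. q \<le> N})"
      by (simp add: prod.If_cases)
    also have "K ^ card (?A \<inter> {q. q \<le> N}) \<le> K ^ Suc N"
    proof (rule power_increasing[OF _ K])
      have "card (?A \<inter> {q. q \<le> N}) \<le> card {..N}" by (intro card_mono) auto
      then show "card (?A \<inter> {q. q \<le> N}) \<le> Suc N" by simp
    qed
    also have "(\<Prod>q\<in>?A. (real q powr e) ^ multiplicity q n) = (\<Prod>q\<in>?A. real q ^ multiplicity q n) powr e"
      unfolding prod_powr_distrib
    proof (rule prod.cong[OF refl])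
      fix q assume "q \<in> ?A"
      then have "q > 0" by (auto simp: in_prime_factors_iff prime_gt_0_nat)
      then show "(real q powr e) ^ multiplicity q n = (real q ^ multiplicity q n) powr e"
        by (simp add: powr_powr powr_realpow[symmetric] mult.commute)
    qed
    also have "(\<Prod>q\<in>?A. real q ^ multiplicity q n) = real (\<Prod>q\<in>?A. q ^ multiplicity q n)" by simp
    also have "(\<Prod>q\<in>?A. q ^ multiplicity q n) = n" using n by (simp add: prod_prime_factors)
    finally show ?thesis by (simp add: mult_right_mono prod_nonneg)
  qed
  then show ?thesis using K by (intro exI[of _ "K ^ Suc N"]) (auto simp del: power_Suc)
qed

lemma card_mult_pairs_le:
  fixes A B E :: "(nat \<times> nat) set"
  assumes fin: "finite A" "finite B" "finite E"
    and AB: "\<And>a b c d. (a, b) \<in> A \<Longrightarrow> (c, d) \<in> B \<Longrightarrow> (a * c, b * d) \<in> E"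
    and E: "\<And>X Y. (X, Y) \<in> E \<Longrightarrow> X > 0 \<and> Y > 0 \<and> card {d. d dvd X} \<le> D \<and> card {d. d dvd Y} \<le> D"
  shows "card A * card B \<le> D\<^sup>2 * card E"
proof -
  let ?f = "\<lambda>((a, b), (c, d)). (a * c, b * d :: nat)"
  have "card A * card B = card (A \<times> B)" by (simp add: card_cartesian_product)
  also have "A \<times> B = (\<Union>z\<in>E. {w \<in> A \<times> B. ?f w = z})" using AB by auto
  also have "card \<dots> \<le> (\<Sum>z\<in>E. card {w \<in> A \<times> B. ?f w = z})" by (rule card_UN_le[OF fin(3)])
  also have "\<dots> \<le> (\<Sum>z\<in>E. D\<^sup>2)"
  proof (rule sum_mono)
    fix z assume z: "z \<in> E"
    obtain X Y where XY: "z = (X, Y)" by (cases z)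
    have pos: "X > 0" "Y > 0" and d: "card {d. d dvd X} \<le> D" "card {d. d dvd Y} \<le> D" using E z XY by auto
    have "inj_on fst {w \<in> A \<times> B. ?f w = z}"
      using pos XY by (auto intro!: inj_onI)
    moreover have "fst ` {w \<in> A \<times> B. ?f w = z} \<subseteq> {d. d dvd X} \<times> {d. d dvd Y}"
      using XY by auto
    ultimately have "card {w \<in> A \<times> B. ?f w = z} \<le> card ({d. d dvd X} \<times> {d. d dvd Y})"
      by (rule card_inj_on_le) (use pos in auto)
    also have "\<dots> \<le> D * D" unfolding card_cartesian_product using d by (rule mult_le_mono)
    finally show "card {w \<in> A \<times> B. ?f w = z} \<le> D\<^sup>2" by (simp add: power2_eq_square)
  qed
  also have "\<dots> = D\<^sup>2 * card E" by simp
  finally show ?thesis .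
qed

text \<open>Averaging over all sets of primes: a random set contains all prime factors of \<open>u\<close> and none
  of \<open>v\<close> with probability \<open>2 powr - (\<omega> u + \<omega> v)\<close>.\<close>

lemma ex_prime_split:
  fixes F :: "(nat \<times> nat) set"
  assumes fin: "finite F"
    and F: "\<And>u v. (u, v) \<in> F \<Longrightarrow> prime_factors u \<inter> prime_factors v = {} \<and>
       2 ^ (card (prime_factors u) + card (prime_factors v)) \<le> D"
  shows "\<exists>Q \<subseteq> (\<Union>(u, v)\<in>F. prime_factors u \<union> prime_factors v).
    card F \<le> D * card {(u, v) \<in> F. prime_factors u \<subseteq> Q \<and> prime_factors v \<inter> Q = {}}"
proof (rule ccontr)
  define W where "W = (\<Union>(u, v)\<in>F. prime_factors u \<union> prime_factors v)"
  define R where "R = (\<lambda>z Q. prime_factors (fst z) \<subseteq> Q \<and> prime_factors (snd z) \<inter> Q = ({} :: nat set))"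
  assume "\<not> ?thesis"
  then have neg: "D * card {z \<in> F. R z Q} < card F" if "Q \<subseteq> W" for Q
    using that unfolding W_def[symmetric] R_def by (auto simp: case_prod_beta' not_le)
  have finW: "finite W" unfolding W_def using fin by auto
  have low: "2 ^ card W \<le> D * card {Q \<in> Pow W. R z Q}" if z: "z \<in> F" for z
  proof -
    define a b where "a = prime_factors (fst z)" and "b = prime_factors (snd z)"
    have ab: "a \<inter> b = {}" "2 ^ (card a + card b) \<le> D" using F[of "fst z" "snd z"] z by (auto simp: a_def b_def)
    have sub: "a \<union> b \<subseteq> W" unfolding W_def a_def b_def using z by (cases z) auto
    have finab: "finite a" "finite b" by (simp_all add: a_def b_def)
    have "card W = card (W - (a \<union> b)) + card (a \<union> b)"
      using finW sub by (metis card_mono card_Diff_subset finite_subset le_add_diff_inverse2)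
    also have "card (a \<union> b) = card a + card b" using ab finab by (simp add: card_Un_disjoint)
    finally have cW: "card W = (card a + card b) + card (W - (a \<union> b))" by simp
    have inj: "inj_on (\<lambda>Q. Q \<union> a) (Pow (W - (a \<union> b)))" by (rule inj_onI) blast
    have "(\<lambda>Q. Q \<union> a) ` Pow (W - (a \<union> b)) \<subseteq> {Q \<in> Pow W. R z Q}"
      unfolding R_def a_def[symmetric] b_def[symmetric] using sub ab by blast
    then have "card (Pow (W - (a \<union> b))) \<le> card {Q \<in> Pow W. R z Q}"
      using inj finW by (intro card_inj_on_le) auto
    then have "2 ^ card (W - (a \<union> b)) \<le> card {Q \<in> Pow W. R z Q}" using finW by (simp add: card_Pow)
    then have "2 ^ (card a + card b) * 2 ^ card (W - (a \<union> b)) \<le> D * card {Q \<in> Pow W. R z Q}"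
      using ab by (intro mult_le_mono)
    then show ?thesis by (simp add: cW power_add)
  qed
  have "card F * 2 ^ card W \<le> (\<Sum>z\<in>F. D * card {Q \<in> Pow W. R z Q})"
    using sum_mono[OF low, of F] by simp
  also have "\<dots> = D * (\<Sum>z\<in>F. \<Sum>Q\<in>Pow W. if R z Q then 1 else 0)"
    unfolding sum_distrib_left[symmetric] using finW by (simp add: sum.If_cases Int_def)
  also have "\<dots> = D * (\<Sum>Q\<in>Pow W. \<Sum>z\<in>F. if R z Q then 1 else 0)" by (subst sum.swap) simp
  also have "\<dots> = (\<Sum>Q\<in>Pow W. D * card {z \<in> F. R z Q})"
    unfolding sum_distrib_left[symmetric] using fin by (simp add: sum.If_cases Int_def)
  also have "\<dots> < (\<Sum>Q\<in>Pow W. card F)"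
    using finW neg by (intro sum_strict_mono) auto
  also have "\<dots> = card F * 2 ^ card W" using finW by (simp add: card_Pow)
  finally show False by simp
qed

lemma smooth_rough_decomp:
  fixes n y :: nat
  assumes "n > 0"
  shows "\<exists>s r. n = s * r \<and> s > 0 \<and> r > 0 \<and> (\<forall>q\<in>prime_factors s. q \<le> y) \<and> (\<forall>q\<in>prime_factors r. y < q)"
  using assms
proof (induction n rule: prime_divisors_induct)
  case (unit n)
  then show ?case by (intro exI[of _ 1]) auto
next
  case (factor q n)
  then obtain s r where sr: "n = s * r" "s > 0" "r > 0" "\<forall>q\<in>prime_factors s. q \<le> y" "\<forall>q\<in>prime_factors r. y < q"
    by auto
  have q: "q > 0" "prime_factors q = {q}" using factor.hyps by (auto simp: prime_gt_0_nat prime_factorization_prime)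
  have pf: "prime_factors (q * m) = insert q (prime_factors m)" if "m > 0" for m
    using q that by (simp add: prime_factors_product)
  show ?case
  proof (cases "q \<le> y")
    case True
    then show ?thesis using sr q pf by (intro exI[of _ "q * s"] exI[of _ r]) auto
  next
    case False
    then show ?thesis using sr q pf by (intro exI[of _ s] exI[of _ "q * r"]) auto
  qed
qed simp

lemma sum_inverse_le_ln:
  assumes "H > 0"
  shows "(\<Sum>g\<in>{1..H}. 1 / real g) \<le> 1 + ln (real H)"
  using assms
proof (induction H rule: nat_induct_non_zero)
  case (Suc n)
  have "ln (real n / real (Suc n)) \<le> real n / real (Suc n) - 1" using Suc.hyps by (intro ln_le_minus_one) auto
  then have "1 / real (Suc n) \<le> ln (real (Suc n)) - ln (real n)"
    using Suc.hyps by (simp add: ln_div field_simps)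
  with Suc.IH show ?case by simp
qed simp

section \<open>Products of pairs with equal Fermat quotients\<close>

context odd_prime begin

text \<open>Assigning each prime to one coordinate by means of \<open>W\<close> forces coprimality
  and, unlike coprimality itself, is inherited by products of pairs.\<close>

definition split_pairs :: "nat set \<Rightarrow> nat \<Rightarrow> nat \<Rightarrow> (nat \<times> nat) set" where
  "split_pairs W N M = {(X, Y). X \<in> {1..N} \<and> Y \<in> {1..M} \<and> \<not> p dvd X \<and> \<not> p dvd Y \<and>
     fq (int X) = fq (int Y) \<and> prime_factors X \<subseteq> W \<and> prime_factors Y \<inter> W = {}}"

lemma finite_split_pairs: "finite (split_pairs W N M)"
  by (rule finite_subset[of _ "{1..N} \<times> {1..M}"]) (auto simp: split_pairs_def)

lemma fq_mult_eq:
  assumes "\<not> P dvd a" "\<not> P dvd b" "\<not> P dvd c" "\<not> P dvd d" "fq a = fq b" "fq c = fq d"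
  shows "fq (a * c) = fq (b * d)"
proof -
  have "[a ^ (p - 1) = b ^ (p - 1)] (mod Q)" using assms fq_eq_iff by blast
  moreover have "[c ^ (p - 1) = d ^ (p - 1)] (mod Q)" using assms fq_eq_iff by blast
  ultimately have "[a ^ (p - 1) * c ^ (p - 1) = b ^ (p - 1) * d ^ (p - 1)] (mod Q)" by (rule cong_mult)
  then show ?thesis using assms by (subst fq_eq_iff) (auto simp: power_mult_distrib not_dvd_mult)
qed

lemma fq_mult_cancel:
  assumes "\<not> P dvd g" "\<not> P dvd a" "\<not> P dvd b" "fq (g * a) = fq (g * b)"
  shows "fq a = fq b"
proof -
  have "[(g * a) ^ (p - 1) = (g * b) ^ (p - 1)] (mod Q)"
    using assms not_dvd_mult[of g] by (subst fq_eq_iff[symmetric]) auto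
  then have "[g ^ (p - 1) * a ^ (p - 1) = g ^ (p - 1) * b ^ (p - 1)] (mod Q)"
    by (simp only: power_mult_distrib)
  moreover have "coprime (g ^ (p - 1)) Q"
    using assms(1) prime_P by (simp add: prime_imp_coprime coprime_commute[of _ P])
  ultimately have "[a ^ (p - 1) = b ^ (p - 1)] (mod Q)" by (simp only: cong_mult_lcancel)
  then show ?thesis using assms by (subst fq_eq_iff)
qed

lemma split_pairs_mult:
  assumes "(a, b) \<in> split_pairs W N M" "(c, d) \<in> split_pairs W N' M'"
  shows "(a * c, b * d) \<in> split_pairs W (N * N') (M * M')"
proof -
  have pos: "a > 0" "b > 0" "c > 0" "d > 0" using assms by (auto simp: split_pairs_def)
  have "prime_factors (a * c) = prime_factors a \<union> prime_factors c"
    "prime_factors (b * d) = prime_factors b \<union> prime_factors d"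
    using pos by (auto simp: prime_factors_product)
  moreover have "fq (int a * int c) = fq (int b * int d)"
    using assms by (intro fq_mult_eq) (auto simp: split_pairs_def)
  moreover have "\<not> p dvd a * c" "\<not> p dvd b * d"
    using assms prime_p by (auto simp: split_pairs_def prime_dvd_mult_iff)
  ultimately show ?thesis using assms pos by (auto simp: split_pairs_def Suc_le_eq intro: mult_le_mono)
qed

lemma card_split_pairs_mult_le:
  assumes D: "\<And>n. n \<in> {1..p\<^sup>2} \<Longrightarrow> tau n \<le> D"
    and "N * N' \<le> p\<^sup>2" "M * M' \<le> p\<^sup>2"
  shows "card (split_pairs W N M) * card (split_pairs W N' M') \<le> D\<^sup>2 * card (split_pairs W (N * N') (M * M'))"
proof (rule card_mult_pairs_le[OF finite_split_pairs finite_split_pairs finite_split_pairs split_pairs_mult])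
  fix X Y assume "(X, Y) \<in> split_pairs W (N * N') (M * M')"
  then have XY: "X \<in> {1..p\<^sup>2}" "Y \<in> {1..p\<^sup>2}" using assms by (auto simp: split_pairs_def)
  have "card {d. d dvd n} \<le> D" if "n \<in> {1..p\<^sup>2}" for n
    using card_divisors_le_tau[of n] D[OF that] that by simp
  with XY show "X > 0 \<and> Y > 0 \<and> card {d. d dvd X} \<le> D \<and> card {d. d dvd Y} \<le> D" by simp
qed

lemma card_split_pairs_power_le:
  assumes D: "\<And>n. n \<in> {1..p\<^sup>2} \<Longrightarrow> tau n \<le> D" and pos: "N > 0" "M > 0"
  shows "N ^ k * Z \<le> p\<^sup>2 \<Longrightarrow> M ^ k * Z \<le> p\<^sup>2 \<Longrightarrow>
    card (split_pairs W N M) ^ k * card (split_pairs W Z Z) \<le> (D\<^sup>2) ^ k * card (split_pairs W (N ^ k * Z) (M ^ k * Z))"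
proof (induction k)
  case (Suc k)
  have "N ^ k * Z \<le> N * (N ^ k * Z)" "M ^ k * Z \<le> M * (M ^ k * Z)" using pos by auto
  then have le: "N ^ k * Z \<le> p\<^sup>2" "M ^ k * Z \<le> p\<^sup>2" using Suc.prems unfolding power_Suc mult.assoc by linarith+
  have "card (split_pairs W N M) ^ Suc k * card (split_pairs W Z Z)
      = card (split_pairs W N M) * (card (split_pairs W N M) ^ k * card (split_pairs W Z Z))"
    by simp
  also have "\<dots> \<le> card (split_pairs W N M) * ((D\<^sup>2) ^ k * card (split_pairs W (N ^ k * Z) (M ^ k * Z)))"
    by (rule mult_le_mono2[OF Suc.IH[OF le]])
  also have "\<dots> = (D\<^sup>2) ^ k * (card (split_pairs W N M) * card (split_pairs W (N ^ k * Z) (M ^ k * Z)))"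
    by (simp only: mult_ac)
  also have "\<dots> \<le> (D\<^sup>2) ^ k * (D\<^sup>2 * card (split_pairs W (N * (N ^ k * Z)) (M * (M ^ k * Z))))"
    using Suc.prems by (intro mult_le_mono2 card_split_pairs_mult_le[OF D]) (simp_all add: mult_ac)
  finally show ?case by (simp only: power_Suc mult_ac)
qed simp

text \<open>Coprime pairs \<open>(X, Y)\<close> with \<open>X Y' \<le> p\<^sup>2\<close> are determined by the quotient \<open>Y / X\<close> modulo \<open>p\<^sup>2\<close>,
  which is a \<open>p\<close>-th power.\<close>

lemma card_split_pairs_le:
  assumes NM: "N * M \<le> p\<^sup>2"
  shows "card (split_pairs W N M) \<le> p"
proof -
  have ex: "\<exists>t. t \<in> G \<and> [int (snd z) = int (fst z) * t ^ p] (mod Q)" if z: "z \<in> split_pairs W N M" for z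
  proof -
    have "\<not> P dvd int (fst z)" "\<not> P dvd int (snd z)" "fq (int (fst z)) = fq (int (snd z))"
      using z by (auto simp: split_pairs_def)
    from fq_class[OF this] show ?thesis by blast
  qed
  then obtain t where t: "\<And>z. z \<in> split_pairs W N M \<Longrightarrow> t z \<in> G \<and> [int (snd z) = int (fst z) * t z ^ p] (mod Q)"
    by metis
  have "inj_on t (split_pairs W N M)"
  proof (rule inj_onI)
    fix z z' assume z: "z \<in> split_pairs W N M" and z': "z' \<in> split_pairs W N M" and eq: "t z = t z'"
    obtain X Y where XY: "z = (X, Y)" by (cases z)
    obtain X' Y' where XY': "z' = (X', Y')" by (cases z')
    have a: "[int Y * int X' = (int X * t z ^ p) * int X'] (mod Q)"
      using t[OF z] XY by (intro cong_scalar_right) simp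
    have "[int Y' * int X = (int X' * t z ^ p) * int X] (mod Q)"
      using t[OF z'] XY' eq by (intro cong_scalar_right) simp
    then have b: "[int Y' * int X = (int X * t z ^ p) * int X'] (mod Q)" by (simp only: mult_ac)
    have c: "[int Y * int X' = int Y' * int X] (mod Q)" by (rule cong_trans[OF a cong_sym[OF b]])
    have r: "X \<in> {1..N}" "X' \<in> {1..N}" "Y \<in> {1..M}" "Y' \<in> {1..M}" using z z' XY XY' by (auto simp: split_pairs_def)
    have lt: "1 \<le> a * b \<and> a * b \<le> p\<^sup>2" if "a \<in> {1..M}" "b \<in> {1..N}" for a b
    proof -
      have "a * b \<le> M * N" using that by (intro mult_le_mono) auto
      then show ?thesis using that NM by (simp add: mult.commute[of M] Suc_le_eq)
    qed
    have c': "[int (Y * X') = int (Y' * X)] (mod int (p\<^sup>2))"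
      using c by (simp add: power2_eq_square)
    \<comment> \<open>Both products lie in \<open>{1..p^2}\<close>, where congruence modulo
      \<open>p^2\<close> means equality.\<close>
    have "Y * X' = Y' * X"
    proof (rule ccontr)
      assume ne: "Y * X' \<noteq> Y' * X"
      have d: "int (p\<^sup>2) dvd int (Y * X') - int (Y' * X)" using c' by (simp only: cong_iff_dvd_diff)
      have "int (Y * X') - int (Y' * X) \<noteq> 0" using ne by (simp only: right_minus_eq of_nat_eq_iff not_False_eq_True)
      then have "\<bar>int (p\<^sup>2)\<bar> \<le> \<bar>int (Y * X') - int (Y' * X)\<bar>" using d by (rule dvd_imp_le_int)
      then show False using lt[of Y X'] lt[of Y' X] r by linarith
    qed
    have cop: "coprime a b" if "(a, b) \<in> split_pairs W N M" for a b
    proof (rule ccontr)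
      assume "\<not> coprime a b"
      then have "gcd a b \<noteq> 1" unfolding coprime_iff_gcd_eq_1 .
      from prime_factor_nat[OF this] obtain q where q: "prime q \<and> q dvd gcd a b" by (elim exE)
      have ab: "prime_factors b \<inter> W = {}" "prime_factors a \<subseteq> W" "a > 0" "b > 0"
        using that unfolding split_pairs_def by simp_all
      have "q \<in> prime_factors a" "q \<in> prime_factors b" using q ab(3,4) by (simp_all add: in_prime_factors_iff)
      then show False using ab(1,2) by blast
    qed
    have cop: "coprime X Y" "coprime X' Y'"
      using z z' unfolding XY XY' by (auto intro: cop)
    have "X dvd Y * X'" unfolding \<open>Y * X' = Y' * X\<close> by simp
    then have "X dvd X'" using cop by (simp only: coprime_dvd_mult_right_iff)
    have "X' dvd Y' * X" unfolding \<open>Y * X' = Y' * X\<close>[symmetric] by simp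
    then have "X' dvd X" using cop by (simp only: coprime_dvd_mult_right_iff)
    have "X = X'" using \<open>X dvd X'\<close> \<open>X' dvd X\<close> by (rule dvd_antisym)
    then have "Y = Y'" using \<open>Y * X' = Y' * X\<close> r by simp
    with \<open>X = X'\<close> show "z = z'" by (simp add: XY XY')
  qed
  then have "card (split_pairs W N M) \<le> card G"
    using t by (intro card_inj_on_le) (auto simp: G_def)
  then show ?thesis by (simp add: card_G)
qed

end

section \<open>Pairs of rough numbers when all small Fermat quotients vanish\<close>

locale small_vanishing = odd_prime +
  fixes y :: nat
  assumes y_less: "y < p" and small_fq: "\<And>n. n \<in> {1..y} \<Longrightarrow> fq (int n) = 0"
begin

lemma fq_1: "fq 1 = 0"
  by (simp add: fq_def fermat_quotient_def)

lemma fq_smooth: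
  "n > 0 \<Longrightarrow> (\<And>q. q \<in> prime_factors n \<Longrightarrow> q \<le> y) \<Longrightarrow> \<not> p dvd n \<and> fq (int n) = 0"
proof (induction n rule: prime_divisors_induct)
  case (unit n)
  then show ?case using fq_1 prime_p prime_gt_1_nat by auto
next
  case (factor q n)
  have n: "n > 0" using factor by simp
  have "q > 0" "prime_factors q = {q}" using factor.hyps by (auto simp: prime_gt_0_nat prime_factorization_prime)
  then have pf: "prime_factors (q * n) = insert q (prime_factors n)"
    using n by (simp add: prime_factors_product)
  have q: "q \<in> {1..y}" using factor.prems pf \<open>q > 0\<close> by auto
  have IH: "\<not> p dvd n" "fq (int n) = 0" using factor n pf by auto
  have qp: "\<not> p dvd q" using q y_less by (auto dest: dvd_imp_le)
  have "fq (int q * int n) = fq (1 * 1)"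
    using IH qp small_fq[OF q] fq_1 p_ge_3 by (intro fq_mult_eq) auto
  then show ?case using IH qp fq_1 prime_p by (simp add: prime_dvd_mult_iff)
qed simp

definition rough_pairs :: "(nat \<times> nat) set" where
  "rough_pairs = {(u, v). u > 0 \<and> v > 0 \<and> coprime u v \<and> \<not> p dvd u \<and> \<not> p dvd v \<and> fq (int u) = fq (int v) \<and>
     (\<forall>q\<in>prime_factors u. y < q) \<and> (\<forall>q\<in>prime_factors v. y < q)}"

text \<open>The product of \<open>k\<close> rough pairs and one pair of smooth numbers is a coprime
  pair in a box of area at most \<open>p^2\<close>. \<open>W\<close> splits the primes above
  \<open>y\<close>, and the disjoint sets \<open>A\<close> and \<open>B\<close> split those used
  below it, so \<open>V = W \<union> A\<close> serves for all factors. Of the exponent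
  \<open>4 k\<close>, half pays for the choice of \<open>W\<close> and half for the multiplicity of
  products.\<close>

lemma card_rough_box_le:
  assumes D: "\<And>n. n \<in> {1..p\<^sup>2} \<Longrightarrow> tau n \<le> D"
    and A: "A \<subseteq> {q. q \<le> y}" "B \<subseteq> {q. q \<le> y}" "A \<inter> B = {}"
    and k: "k > 0" and Z: "Z > 0" and NM: "N > 0" "M > 0" "(N * M) ^ k * Z\<^sup>2 \<le> p\<^sup>2"
  shows "card (rough_pairs \<inter> {1..N} \<times> {1..M}) ^ k *
      (card {n \<in> {1..Z}. prime_factors n \<subseteq> A} * card {n \<in> {1..Z}. prime_factors n \<subseteq> B})
    \<le> D ^ (4 * k) * p"
proof -
  define F where "F = rough_pairs \<inter> {1..N} \<times> {1..M}"
  have finF: "finite F" unfolding F_def by (rule finite_subset[of _ "{1..N} \<times> {1..M}"]) auto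
  have NZ: "N ^ k * Z \<le> p\<^sup>2" "M ^ k * Z \<le> p\<^sup>2" and "N \<le> p\<^sup>2" "M \<le> p\<^sup>2"
  proof -
    have e: "(N * M) ^ k * Z\<^sup>2 = (N ^ k * Z) * (M ^ k * Z)" by (simp add: power_mult_distrib power2_eq_square mult_ac)
    have "N ^ k * Z \<le> (N ^ k * Z) * (M ^ k * Z)" "M ^ k * Z \<le> (N ^ k * Z) * (M ^ k * Z)" using NM Z by auto
    then show *: "N ^ k * Z \<le> p\<^sup>2" "M ^ k * Z \<le> p\<^sup>2" using NM(3) unfolding e by linarith+
    have "N \<le> N ^ k" "M \<le> M ^ k" using NM k by (simp_all add: self_le_power)
    moreover have "N ^ k \<le> N ^ k * Z" "M ^ k \<le> M ^ k * Z" using Z by auto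
    ultimately show "N \<le> p\<^sup>2" "M \<le> p\<^sup>2" using * by linarith+
  qed
  have "\<exists>W\<subseteq>(\<Union>(u, v)\<in>F. prime_factors u \<union> prime_factors v).
     card F \<le> D\<^sup>2 * card {(u, v) \<in> F. prime_factors u \<subseteq> W \<and> prime_factors v \<inter> W = {}}"
  proof (rule ex_prime_split[OF finF])
    fix u v assume "(u, v) \<in> F"
    then have uv: "coprime u v" "u \<in> {1..p\<^sup>2}" "v \<in> {1..p\<^sup>2}" using \<open>N \<le> p\<^sup>2\<close> \<open>M \<le> p\<^sup>2\<close>
      by (auto simp: F_def rough_pairs_def)
    have "prime_factors u \<inter> prime_factors v = {}"
      using uv by (auto simp: in_prime_factors_iff dest: coprime_common_divisor)
    moreover have "2 ^ card (prime_factors u) * 2 ^ card (prime_factors v) \<le> D * D"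
    proof (rule mult_le_mono)
      show "2 ^ card (prime_factors u) \<le> D"
        using uv(2) by (intro le_trans[OF two_power_le_tau D]) simp_all
      show "2 ^ card (prime_factors v) \<le> D"
        using uv(3) by (intro le_trans[OF two_power_le_tau D]) simp_all
    qed
    ultimately show "prime_factors u \<inter> prime_factors v = {} \<and>
       2 ^ (card (prime_factors u) + card (prime_factors v)) \<le> D\<^sup>2"
      by (simp add: power_add power2_eq_square)
  qed
  then obtain W where W: "W \<subseteq> (\<Union>(u, v)\<in>F. prime_factors u \<union> prime_factors v)"
    "card F \<le> D\<^sup>2 * card {(u, v) \<in> F. prime_factors u \<subseteq> W \<and> prime_factors v \<inter> W = {}}" by blast
  have Wy: "y < q" if "q \<in> W" for q using that W(1) by (auto simp: F_def rough_pairs_def)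
  define V where "V = W \<union> A"
  have disj: "X \<inter> A = {}" if X: "\<forall>q\<in>X. y < q" for X
  proof -
    have "q \<notin> A" if "q \<in> X" for q
    proof
      assume "q \<in> A"
      then have "q \<le> y" using A(1) by blast
      with X that show False by (simp add: linorder_not_less[symmetric])
    qed
    then show ?thesis by blast
  qed
  have "{(u, v) \<in> F. prime_factors u \<subseteq> W \<and> prime_factors v \<inter> W = {}} \<subseteq> split_pairs V N M"
  proof clarify
    fix u v assume F: "(u, v) \<in> F" and uv: "prime_factors u \<subseteq> W" "prime_factors v \<inter> W = {}"
    have "prime_factors v \<inter> A = {}" using F by (intro disj) (simp add: F_def rough_pairs_def)
    with uv have "prime_factors v \<inter> V = {}" unfolding V_def by blast
    moreover have "prime_factors u \<subseteq> V" using uv unfolding V_def by blast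
    ultimately show "(u, v) \<in> split_pairs V N M"
      using F unfolding split_pairs_def F_def rough_pairs_def by simp
  qed
  then have "card {(u, v) \<in> F. prime_factors u \<subseteq> W \<and> prime_factors v \<inter> W = {}} \<le> card (split_pairs V N M)"
    by (intro card_mono finite_split_pairs)
  with W(2) have cF: "card F \<le> D\<^sup>2 * card (split_pairs V N M)" by (meson le_trans mult_le_mono2)
  have "{n \<in> {1..Z}. prime_factors n \<subseteq> A} \<times> {n \<in> {1..Z}. prime_factors n \<subseteq> B} \<subseteq> split_pairs V Z Z"
  proof clarify
    fix s t assume s: "s \<in> {1..Z}" "prime_factors s \<subseteq> A" and t: "t \<in> {1..Z}" "prime_factors t \<subseteq> B"
    have "\<not> p dvd s \<and> fq (int s) = 0" using s A by (intro fq_smooth) auto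
    moreover have "\<not> p dvd t \<and> fq (int t) = 0" using t A by (intro fq_smooth) auto
    moreover have "prime_factors t \<inter> V = {}"
    proof -
      have "q \<notin> W" if "q \<in> prime_factors t" for q
      proof
        assume "q \<in> W"
        then have "y < q" by (rule Wy)
        moreover have "q \<le> y" using that t A(2) by blast
        ultimately show False by simp
      qed
      then show ?thesis using t A(3) unfolding V_def by blast
    qed
    ultimately show "(s, t) \<in> split_pairs V Z Z" using s t by (auto simp: split_pairs_def V_def)
  qed
  then have "card ({n \<in> {1..Z}. prime_factors n \<subseteq> A} \<times> {n \<in> {1..Z}. prime_factors n \<subseteq> B}) \<le> card (split_pairs V Z Z)"
    by (intro card_mono finite_split_pairs)
  then have cS: "card {n \<in> {1..Z}. prime_factors n \<subseteq> A} * card {n \<in> {1..Z}. prime_factors n \<subseteq> B} \<le> card (split_pairs V Z Z)"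
    by (simp only: card_cartesian_product)
  have "card F ^ k * (card {n \<in> {1..Z}. prime_factors n \<subseteq> A} * card {n \<in> {1..Z}. prime_factors n \<subseteq> B})
     \<le> (D\<^sup>2 * card (split_pairs V N M)) ^ k * card (split_pairs V Z Z)"
    using cF cS by (intro mult_le_mono power_mono) auto
  also have "\<dots> = (D\<^sup>2) ^ k * (card (split_pairs V N M) ^ k * card (split_pairs V Z Z))"
    by (simp only: power_mult_distrib mult_ac)
  also have "\<dots> \<le> (D\<^sup>2) ^ k * ((D\<^sup>2) ^ k * card (split_pairs V (N ^ k * Z) (M ^ k * Z)))"
    by (intro mult_le_mono2 card_split_pairs_power_le[OF D NM(1,2) NZ])
  also have "\<dots> \<le> (D\<^sup>2) ^ k * ((D\<^sup>2) ^ k * p)"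
  proof (intro mult_le_mono2 card_split_pairs_le)
    show "(N ^ k * Z) * (M ^ k * Z) \<le> p\<^sup>2" using NM(3) by (simp add: power_mult_distrib power2_eq_square mult_ac)
  qed
  also have "\<dots> = D ^ (4 * k) * p"
  proof -
    have "(D\<^sup>2) ^ k * (D\<^sup>2) ^ k = D ^ (4 * k)" by (simp add: power_mult[symmetric] power_add[symmetric])
    then show ?thesis by (simp only: mult.assoc[symmetric])
  qed
  finally show ?thesis unfolding F_def .
qed

text \<open>Write \<open>d = g s u\<close> and \<open>e = g t v\<close> with \<open>g\<close> the
  gcd, \<open>s\<close> and \<open>t\<close> smooth, \<open>u\<close> and \<open>v\<close> rough.
  Cancelling \<open>g\<close> and the smooth parts leaves a rough pair. For given \<open>g\<close>,
  \<open>u\<close>, \<open>v\<close>, Rankin's bound allows at most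
  \<open>H R^2 / (g sqrt (u v))\<close> pairs \<open>(s, t)\<close>, where
  \<open>R = exp (8 * sqrt y)\<close>.\<close>

lemma R2_le:
  assumes H: "H > 0" "H \<le> p"
  shows "real (R2 {1..<int H}) \<le> real H * (1 + ln (real H)) * exp (16 * sqrt (real y)) *
    (\<Sum>(u, v)\<in>rough_pairs \<inter> {1..H} \<times> {1..H}. 1 / sqrt (real u * real v))"
proof -
  define B where "B = {q. prime q \<and> q \<le> y}"
  have finB: "finite B" unfolding B_def by (rule finite_subset[of _ "{..y}"]) auto
  define Sm where "Sm = (\<lambda>x. {n \<in> {1..x}. prime_factors n \<subseteq> B})"
  have finSm: "finite (Sm x)" for x by (simp add: Sm_def)
  define R where "R = exp (8 * sqrt (real y))"
  have Sm_le: "real (card (Sm x)) \<le> sqrt (real x) * R" for x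
  proof -
    have "real (card (Sm x)) \<le> sqrt (real x) * (\<Prod>q\<in>B. 1 / (1 - 1 / sqrt (real q)))"
      unfolding Sm_def using finB by (intro card_smooth_le) (auto simp: B_def)
    also have "\<dots> \<le> sqrt (real x) * R"
      unfolding R_def using prod_rankin_le[of B y] by (intro mult_left_mono) (auto simp: B_def)
    finally show ?thesis .
  qed
  define F where "F = rough_pairs \<inter> {1..H} \<times> {1..H}"
  have finF: "finite F" unfolding F_def by (rule finite_subset[of _ "{1..H} \<times> {1..H}"]) auto
  define f where "f = (\<lambda>((u, v), g, s, t). (int (g * (s * u)), int (g * (t * v))))"
  define I where "I = (SIGMA (u, v):F. SIGMA g:{1..H}. Sm (H div (g * u)) \<times> Sm (H div (g * v)))"
  have finI: "finite I" unfolding I_def using finF finSm by (auto intro!: finite_SigmaI)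
  have "{(d, e). d \<in> {1..<int H} \<and> e \<in> {1..<int H} \<and> fq d = fq e} \<subseteq> f ` I"
  proof clarify
    fix d' e' assume de': "d' \<in> {1..<int H}" "e' \<in> {1..<int H}" "fq d' = fq e'"
    define d e where "d = nat d'" and "e = nat e'"
    have de: "d' = int d" "e' = int e" "d > 0" "e > 0" "d < H" "e < H" using de' by (auto simp: d_def e_def)
    define g where "g = gcd d e"
    have g: "g > 0" using de by (simp add: g_def)
    obtain a b where ab: "d = g * a" "e = g * b" "coprime a b"
      using gcd_coprime_exists[of d e] g unfolding g_def by (auto simp: mult.commute)
    have "a > 0" "b > 0" using de ab by (auto intro: Nat.gr0I)
    obtain s u where su: "a = s * u" "s > 0" "u > 0" "\<forall>q\<in>prime_factors s. q \<le> y" "\<forall>q\<in>prime_factors u. y < q"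
      using smooth_rough_decomp[OF \<open>a > 0\<close>] by blast
    obtain t v where tv: "b = t * v" "t > 0" "v > 0" "\<forall>q\<in>prime_factors t. q \<le> y" "\<forall>q\<in>prime_factors v. y < q"
      using smooth_rough_decomp[OF \<open>b > 0\<close>] by blast
    have nd: "\<not> p dvd d" "\<not> p dvd e" using de H by (auto dest: dvd_imp_le)
    then have nd': "\<not> p dvd g" "\<not> p dvd s" "\<not> p dvd u" "\<not> p dvd t" "\<not> p dvd v" "\<not> p dvd a" "\<not> p dvd b"
      unfolding ab su tv prime_dvd_mult_iff[OF prime_p] by simp_all
    have "fq (int g * int a) = fq (int g * int b)"
      using de'(3) unfolding de(1,2) ab(1,2) of_nat_mult .
    then have "fq (int a) = fq (int b)" by (rule fq_mult_cancel[rotated 3]) (simp_all add: nd')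
    have s0: "fq (int s) = fq 1" "fq (int t) = fq 1"
      unfolding fq_1 using fq_smooth[OF su(2)] fq_smooth[OF tv(2)] su(4) tv(4) by blast+
    have "\<not> P dvd 1" using p_ge_3 by simp
    have su': "fq (int s * int u) = fq (1 * int u)"
      by (rule fq_mult_eq[OF _ \<open>\<not> P dvd 1\<close> _ _ s0(1) refl]) (simp_all add: nd')
    have tv': "fq (int t * int v) = fq (1 * int v)"
      by (rule fq_mult_eq[OF _ \<open>\<not> P dvd 1\<close> _ _ s0(2) refl]) (simp_all add: nd')
    have "fq (int u) = fq (int v)" using \<open>fq (int a) = fq (int b)\<close> su' tv' su(1) tv(1) by simp
    moreover have "coprime u v" using ab(3) unfolding su tv by simp
    ultimately have rp: "(u, v) \<in> rough_pairs"
      unfolding rough_pairs_def using su(3,5) tv(3,5) nd' by simp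
    have le: "g * (s * u) \<le> H" "g * (t * v) \<le> H"
      using de(5,6) unfolding ab(1,2) su(1) tv(1) by simp_all
    have "g * 1 \<le> g * (s * u)" "1 * u \<le> (g * s) * u" "1 * v \<le> (g * t) * v"
      using g su(2,3) tv(2,3) by (intro mult_le_mono, simp_all)+
    then have "g \<le> H" "u \<le> H" "v \<le> H" using le unfolding mult.assoc mult_1 mult_1_right by linarith+
    then have uv: "(u, v) \<in> F" and gH: "g \<in> {1..H}"
      using g su(3) tv(3) rp unfolding F_def by simp_all
    have "s \<le> H div (g * u)" "t \<le> H div (g * v)"
      using le g su(3) tv(3) by (simp_all add: less_eq_div_iff_mult_less_eq mult_ac)
    then have "s \<in> Sm (H div (g * u))" "t \<in> Sm (H div (g * v))"
      using su(2,4) tv(2,4) unfolding Sm_def B_def by (auto simp: in_prime_factors_iff)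
    then have "((u, v), g, s, t) \<in> I" using uv gH by (simp add: I_def)
    moreover have "(d', e') = f ((u, v), g, s, t)" unfolding f_def de ab su tv by simp
    ultimately show "(d', e') \<in> f ` I" by (rule rev_image_eqI)
  qed
  then have "R2 {1..<int H} \<le> card I"
    unfolding R2_def using finI by (meson card_image_le card_mono finite_imageI le_trans)
  also have "card I = (\<Sum>(u, v)\<in>F. \<Sum>g\<in>{1..H}. card (Sm (H div (g * u))) * card (Sm (H div (g * v))))"
    unfolding I_def using finF finSm by (subst card_SigmaI) (auto intro!: sum.cong simp: card_cartesian_product)
  finally have "real (R2 {1..<int H}) \<le> real (\<Sum>(u, v)\<in>F. \<Sum>g\<in>{1..H}. card (Sm (H div (g * u))) * card (Sm (H div (g * v))))"
    by (simp only: of_nat_le_iff)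
  also have "\<dots> = (\<Sum>(u, v)\<in>F. \<Sum>g\<in>{1..H}. real (card (Sm (H div (g * u)))) * real (card (Sm (H div (g * v)))))"
    by (simp add: case_prod_beta')
  also have "\<dots> \<le> (\<Sum>(u, v)\<in>F. \<Sum>g\<in>{1..H}. (real H * R\<^sup>2 / sqrt (real u * real v)) * (1 / real g))"
  proof (intro sum_mono, clarify, intro sum_mono)
    fix u v g assume uv: "(u, v) \<in> F" and g: "g \<in> {1..H}"
    have pos: "real u > 0" "real v > 0" "real g > 0" using uv g by (auto simp: F_def)
    have *: "real (card (Sm (H div (g * u)))) \<le> sqrt (real H / (real g * real u)) * R" for u
    proof -
      have "real (H div (g * u)) \<le> real H / real (g * u)" by (rule of_nat_div_le_of_nat)
      then have "sqrt (real (H div (g * u))) * R \<le> sqrt (real H / (real g * real u)) * R"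
        by (intro mult_right_mono) (auto simp: R_def)
      with Sm_le[of "H div (g * u)"] show ?thesis by linarith
    qed
    have "real (card (Sm (H div (g * u)))) * real (card (Sm (H div (g * v))))
       \<le> (sqrt (real H / (real g * real u)) * R) * (sqrt (real H / (real g * real v)) * R)"
      by (intro mult_mono *) (auto simp: R_def)
    also have "\<dots> = (sqrt (real H) * sqrt (real H)) * R\<^sup>2 / (sqrt (real u) * sqrt (real v)) / (sqrt (real g) * sqrt (real g))"
      unfolding real_sqrt_divide real_sqrt_mult power2_eq_square by (simp add: mult_ac)
    also have "\<dots> = (real H * R\<^sup>2 / sqrt (real u * real v)) * (1 / real g)"
      by (simp add: real_sqrt_mult)
    finally show "real (card (Sm (H div (g * u)))) * real (card (Sm (H div (g * v))))
       \<le> (real H * R\<^sup>2 / sqrt (real u * real v)) * (1 / real g)" .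
  qed
  also have "\<dots> = (\<Sum>(u, v)\<in>F. (real H * R\<^sup>2 / sqrt (real u * real v)) * (\<Sum>g\<in>{1..H}. 1 / real g))"
    by (simp only: sum_distrib_left)
  also have "\<dots> = (real H * R\<^sup>2 * (\<Sum>g\<in>{1..H}. 1 / real g)) * (\<Sum>(u, v)\<in>F. 1 / sqrt (real u * real v))"
    unfolding sum_distrib_left[of "real H * R\<^sup>2 * (\<Sum>g\<in>{1..H}. 1 / real g)"] by (intro sum.cong) auto
  also have "\<dots> \<le> (real H * R\<^sup>2 * (1 + ln (real H))) * (\<Sum>(u, v)\<in>F. 1 / sqrt (real u * real v))"
    using sum_inverse_le_ln[OF H(1)] by (intro mult_right_mono mult_left_mono sum_nonneg) auto
  also have "R\<^sup>2 = exp (16 * sqrt (real y))" by (simp add: R_def power2_eq_square exp_add[symmetric])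
  finally show ?thesis unfolding F_def by (simp only: mult_ac)
qed

end

section \<open>Asymptotics\<close>

lemma eventually_lnreal:
  fixes P :: "real \<Rightarrow> bool"
  assumes "eventually P at_top"
  shows "eventually (\<lambda>p :: nat. P (ln (real p))) sequentially"
proof -
  have "filterlim (\<lambda>p :: nat. ln (real p)) at_top sequentially" by real_asymp
  then show ?thesis using assms by (rule filterlim_iff[THEN iffD1, rule_format])
qed

text \<open>For \<open>L = ln p\<close> and \<open>y\<close> the integer part of
  \<open>L powr k\<close>. The third inequality guarantees enough primes, by Chebyshev's bound, even
  after they are divided into two halves; the last absorbs the rounding of an exponent in
  \<open>card_smooth_ge\<close>.\<close>

lemma log_power_asymp:
  fixes k e :: real
  assumes k: "1 < k" and e: "e > 0" "e < k - 1"
  shows "\<forall>\<^sub>F L :: real in at_top. L > 1 \<and> L \<le> L powr k - 1 \<and>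
     (L powr (k - 1 - e)) * (4 * L) \<le> (L powr k - 3) / 2 * ln 2 - 2 * (k * ln L) \<and>
     (k - 1) * ln L \<le> e * L"
proof (intro eventually_conj)
  show "\<forall>\<^sub>F L :: real in at_top. L > 1" by real_asymp
  show "\<forall>\<^sub>F L :: real in at_top. L \<le> L powr k - 1" using k by real_asymp
  show "\<forall>\<^sub>F L :: real in at_top. (k - 1) * ln L \<le> e * L" using e k by real_asymp
  have 1: "\<forall>\<^sub>F L :: real in at_top. (k * ln L) * 1000 \<le> L powr k" using k by real_asymp
  have 2: "\<forall>\<^sub>F L :: real in at_top. 1000 \<le> L powr k" using k by real_asymp
  have 3: "\<forall>\<^sub>F L :: real in at_top. 1000 \<le> L powr e" using e by real_asymp
  have 4: "\<forall>\<^sub>F L :: real in at_top. L > 0" by real_asymp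
  show "\<forall>\<^sub>F L :: real in at_top. (L powr (k - 1 - e)) * (4 * L) \<le> (L powr k - 3) / 2 * ln 2 - 2 * (k * ln L)"
    using 1 2 3 4
  proof eventually_elim
    case (elim L)
    have "L powr (k - 1 - e) * L = L powr (k - e)" using elim powr_mult_base[of L "k - 1 - e"] by (simp add: mult.commute)
    moreover have "L powr (k - e) * L powr e = L powr k" by (simp add: powr_add[symmetric])
    moreover have "L powr (k - e) * 1000 \<le> L powr (k - e) * L powr e" using elim by (intro mult_left_mono) auto
    ultimately have a: "L powr (k - 1 - e) * L * 1000 \<le> L powr k" by simp
    have "ln (2 :: real) \<ge> 1 / 2" using ln_add_one_self_le_self2[of "-(1/2)"] by (simp add: ln_div)
    then have "(L powr k - 3) / 2 * (1 / 2) \<le> (L powr k - 3) / 2 * ln 2" using elim by (intro mult_left_mono) auto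
    then have "(L powr k - 3) / 4 \<le> (L powr k - 3) / 2 * ln 2" by simp
    moreover have "4 * t \<le> w - 2 * q" if "t * 1000 \<le> x" "q * 1000 \<le> x" "1000 \<le> x" "(x - 3) / 4 \<le> w" for t q w x :: real
      using that by argo
    ultimately have "4 * (L powr (k - 1 - e) * L) \<le> (L powr k - 3) / 2 * ln 2 - 2 * (k * ln L)"
      using a elim by blast
    then show ?case by (simp only: mult_ac)
  qed
qed

lemma prime_count_ge:
  assumes y: "y \<ge> 2"
  shows "((real y - 1) / 2) * ln 2 \<le> real (card {q. prime q \<and> q \<le> y}) * ln (real y)"
proof -
  define n where "n = y div 2"
  have "n > 0" "2 * n \<le> y" "y \<le> 2 * n + 1" using y unfolding n_def by linarith+
  moreover from this have "real y \<le> real (2 * n + 1)" by (simp only: of_nat_le_iff)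
  ultimately have n: "n > 0" "2 * n \<le> y" "real n \<ge> (real y - 1) / 2" by simp_all
  define c where "c = card {q. prime q \<and> q \<le> 2 * n}"
  have "2 ^ n \<le> (2 * n) ^ c" unfolding c_def by (rule two_power_le_prime_count[OF n(1)])
  then have "real (2 ^ n) \<le> real ((2 * n) ^ c)" by (simp only: of_nat_le_iff)
  then have "ln (2 ^ n) \<le> ln (real (2 * n) ^ c)" using n by (subst ln_le_cancel_iff) auto
  moreover have "ln (real (2 * n) ^ c) = real c * ln (real (2 * n))" by (rule ln_realpow)
  moreover have "ln (2 ^ n) = real n * ln 2" by (simp add: ln_realpow)
  ultimately have "real n * ln 2 \<le> real c * ln (real (2 * n))" by (simp only:)
  also have "\<dots> \<le> real (card {q. prime q \<and> q \<le> y}) * ln (real y)"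
  proof (rule mult_mono)
    have "c \<le> card {q. prime q \<and> q \<le> y}"
      unfolding c_def using n by (intro card_mono) (auto intro: finite_subset[of _ "{..y}"])
    then show "real c \<le> real (card {q. prime q \<and> q \<le> y})" by simp
    show "ln (real (2 * n)) \<le> ln (real y)" using n by (subst ln_le_cancel_iff) auto
  qed (use n in auto)
  finally have "real n * ln 2 \<le> real (card {q. prime q \<and> q \<le> y}) * ln (real y)" .
  moreover have "((real y - 1) / 2) * ln 2 \<le> real n * ln 2" using n by (intro mult_right_mono) auto
  ultimately show ?thesis by linarith
qed

text \<open>Let \<open>j\<close> be maximal with \<open>y^j \<le> Z\<close>. Products of
  \<open>j\<close> of the \<open>m\<close> primes number at least \<open>(m/j)^j \<ge> b^j\<close>
  with \<open>b = L powr (k - 1 - e)\<close>, whereas \<open>Z\<close> is less than the power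
  \<open>k (j + 1)\<close> of \<open>L\<close>; the quotient of the exponents is near
  \<open>(k - 1)/k\<close>. Of the loss \<open>3 e\<close>, one part covers \<open>j + 1\<close> in
  place of \<open>j\<close>, two parts the \<open>e\<close> in \<open>b\<close>.\<close>

lemma card_smooth_ge:
  fixes L k e :: real and y m :: nat
  assumes L: "L > 1" "real p = exp L" and k: "1 < k" and e: "e > 0" "e < k - 1"
    and y: "real y \<le> L powr k" "L \<le> real y"
    and m: "L powr (k - 1 - e) * (2 * L) \<le> real m * ln (real y)"
    and small: "(k - 1) * ln L \<le> e * L"
    and A: "finite A" "card A = m" "\<And>q. q \<in> A \<Longrightarrow> prime q \<and> q \<le> y"
    and Z: "Z \<ge> 1" "Z \<le> p\<^sup>2"
  shows "real Z powr (1 - 1 / k) * real p powr (- (3 * e)) \<le> real (card {n \<in> {1..Z}. prime_factors n \<subseteq> A})"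
proof -
  have y2: "y \<ge> 2" using L y by linarith
  obtain j where j: "y ^ j \<le> Z" "Z < y ^ Suc j" using ex_power_ivl1[of y Z] y2 Z by auto
  have lny: "ln L \<le> ln (real y)" "ln L > 0" "ln (real y) > 0" using L y by (simp_all add: ln_le_cancel_iff)
  have jL: "real j * ln (real y) \<le> 2 * L"
  proof -
    have "y ^ j \<le> p ^ 2" using j Z by linarith
    then have "real (y ^ j) \<le> real (p ^ 2)" by (simp only: of_nat_le_iff)
    then have "ln (real y ^ j) \<le> ln (real p ^ 2)" using y2 L by (subst ln_le_cancel_iff) auto
    then show ?thesis using y2 L by (simp add: ln_realpow)
  qed
  define b where "b = L powr (k - 1 - e)"
  have b: "b \<ge> 1" unfolding b_def using L e by (intro ge_one_powr_ge_zero) auto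
  have jm: "b * real j \<le> real m"
  proof -
    have "b * (real j * ln (real y)) \<le> b * (2 * L)" using jL b by (intro mult_left_mono) auto
    also have "\<dots> \<le> real m * ln (real y)" using m by (simp add: b_def)
    finally have "(b * real j) * ln (real y) \<le> real m * ln (real y)" by (simp only: mult.assoc)
    then show ?thesis using lny by (simp only: mult_le_cancel_right_pos)
  qed
  have "1 * real j \<le> b * real j" using b by (intro mult_right_mono) auto
  then have "j \<le> m" using jm by linarith
  have "b ^ j \<le> real (m choose j)"
  proof (cases "j = 0")
    case False
    have "b \<le> real m / real j" using jm False by (simp add: field_simps)
    then have "b ^ j \<le> (real m / real j) ^ j" using b by (intro power_mono) auto
    also have "\<dots> \<le> real (m choose j)" using binomial_ge_n_over_k_pow_k[OF \<open>j \<le> m\<close>, where 'a = real] by simp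
    finally show ?thesis .
  qed simp
  also have "m choose j \<le> card {n \<in> {1..Z}. prime_factors n \<subseteq> A}"
    using card_products_ge[OF A(1) A(3) j(1)] A(2) by simp
  finally have low: "b ^ j \<le> real (card {n \<in> {1..Z}. prime_factors n \<subseteq> A})" by simp
  have "real Z powr (1 - 1 / k) * real p powr (- (3 * e)) \<le> b ^ j"
  proof -
    have "real Z < real (y ^ Suc j)" using j(2) by (simp only: of_nat_less_iff)
    then have "ln (real Z) \<le> ln (real y ^ Suc j)" using Z y2 by (subst ln_le_cancel_iff) auto
    also have "\<dots> = real (Suc j) * ln (real y)" using y2 by (subst ln_realpow) auto
    also have "ln (real y) \<le> k * ln L" using y(1) y2 L by (metis ln_powr ln_mono of_nat_0_less_iff pos2 order_less_le_trans powr_gt_zero less_trans zero_less_one less_imp_neq)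
    finally have lnZ: "ln (real Z) \<le> real (Suc j) * (k * ln L)" by (simp add: mult_left_mono)
    have "(1 - 1 / k) * ln (real Z) \<le> (1 - 1 / k) * (real (Suc j) * (k * ln L))"
      using lnZ k by (intro mult_left_mono) auto
    also have "\<dots> = (k - 1) * (real j * ln L) + (k - 1) * ln L" using k by (simp add: field_simps)
    finally have 1: "(1 - 1 / k) * ln (real Z) \<le> (k - 1) * (real j * ln L) + e * L" using small by linarith
    have "real j * ln L \<le> real j * ln (real y)" using lny by (intro mult_left_mono) auto
    then have "real j * ln L \<le> 2 * L" using jL by linarith
    then have 2: "e * (real j * ln L) \<le> e * (2 * L)" using e by (intro mult_left_mono) auto
    have "real Z powr (1 - 1 / k) * real p powr (- (3 * e)) = exp ((1 - 1 / k) * ln (real Z) - 3 * e * L)"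
      using Z L by (simp add: powr_def exp_diff exp_minus divide_inverse)
    also have "\<dots> \<le> exp (real j * ((k - 1 - e) * ln L))"
      using 1 2 by (simp add: algebra_simps)
    also have "\<dots> = b ^ j" unfolding b_def using L by (simp add: powr_def exp_of_nat_mult)
    finally show ?thesis .
  qed
  with low show ?thesis by linarith
qed

text \<open>Disjoint sets of primes keep the smooth factors of the two coordinates coprime. Halving
  the supply of primes does not affect the exponent.\<close>

lemma eventually_smooth_ge:
  fixes k e :: real
  assumes k: "1 < k" and e: "e > 0" "e < k - 1"
  shows "\<forall>\<^sub>F p :: nat in sequentially. \<exists>A B.
    A \<subseteq> {q. prime q \<and> q \<le> nat \<lfloor>ln (real p) powr k\<rfloor>} \<and> B \<subseteq> {q. prime q \<and> q \<le> nat \<lfloor>ln (real p) powr k\<rfloor>} \<and> A \<inter> B = {} \<and>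
    (\<forall>Z\<in>{1..p\<^sup>2}. real Z powr (1 - 1 / k) * real p powr (- (3 * e)) \<le> real (card {n \<in> {1..Z}. prime_factors n \<subseteq> A}) \<and>
       real Z powr (1 - 1 / k) * real p powr (- (3 * e)) \<le> real (card {n \<in> {1..Z}. prime_factors n \<subseteq> B}))"
  using eventually_lnreal[OF log_power_asymp[OF k e]] eventually_gt_at_top[of 0]
proof eventually_elim
  case (elim p)
  define L where "L = ln (real p)"
  define y where "y = nat \<lfloor>L powr k\<rfloor>"
  have L: "L > 1" "real p = exp L" using elim by (auto simp: L_def)
  have y: "real y \<le> L powr k" "L powr k - 1 \<le> real y" "L \<le> real y"
    using elim unfolding y_def L_def[symmetric] by linarith+
  have y2: "y \<ge> 2" using L y by linarith
  define Pr where "Pr = {q. prime q \<and> q \<le> y}"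
  have finPr: "finite Pr" unfolding Pr_def by (rule finite_subset[of _ "{..y}"]) auto
  define m where "m = card Pr div 2"
  obtain A where A: "A \<subseteq> Pr" "card A = m" "finite A"
    using obtain_subset_with_card_n[of m Pr] by (auto simp: m_def)
  have "card (Pr - A) = card Pr - m" using A by (simp add: card_Diff_subset)
  then have "m \<le> card (Pr - A)" by (simp add: m_def)
  then obtain B where B: "B \<subseteq> Pr - A" "card B = m" "finite B"
    using obtain_subset_with_card_n by metis
  have lny: "ln (real y) \<le> k * ln L"
  proof -
    have "ln (real y) \<le> ln (L powr k)" using y(1) y2 L by (subst ln_le_cancel_iff) auto
    then show ?thesis using L by (simp add: ln_powr)
  qed
  have "(L powr (k - 1 - e)) * (4 * L) \<le> (L powr k - 3) / 2 * ln 2 - 2 * (k * ln L)"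
    using elim by (simp add: L_def)
  also have "(L powr k - 3) / 2 * ln 2 \<le> ((real y - 1) / 2) * ln 2"
    using y by (intro mult_right_mono) auto
  also have "\<dots> \<le> real (card Pr) * ln (real y)" unfolding Pr_def by (rule prime_count_ge[OF y2])
  also have "\<dots> \<le> (2 * real m + 1) * ln (real y)"
  proof (rule mult_right_mono)
    have "card Pr \<le> 2 * m + 1" unfolding m_def by linarith
    then show "real (card Pr) \<le> 2 * real m + 1" by linarith
  qed (use y2 in simp)
  finally have "(L powr (k - 1 - e)) * (4 * L) \<le> 2 * (real m * ln (real y)) + ln (real y) - 2 * (k * ln L)"
    by (simp add: algebra_simps)
  moreover have "k * ln L > 0" using k L by simp
  ultimately have m: "L powr (k - 1 - e) * (2 * L) \<le> real m * ln (real y)" using lny by linarith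
  have small: "(k - 1) * ln L \<le> e * L" using elim by (simp add: L_def)
  note ge = card_smooth_ge[OF L k e y(1,3) m small]
  show ?case
    unfolding L_def[symmetric] y_def[symmetric] Pr_def[symmetric]
  proof (rule exI[of _ A], rule exI[of _ B], intro conjI ballI)
    fix Z assume Z: "Z \<in> {1..p\<^sup>2}"
    show "real Z powr (1 - 1 / k) * real p powr (- (3 * e)) \<le> real (card {n \<in> {1..Z}. prime_factors n \<subseteq> A})"
      using Z A by (intro ge) (auto simp: Pr_def)
    show "real Z powr (1 - 1 / k) * real p powr (- (3 * e)) \<le> real (card {n \<in> {1..Z}. prime_factors n \<subseteq> B})"
      using Z B by (intro ge) (auto simp: Pr_def)
  qed (use A B in auto)
qed

text \<open>As \<open>Z\<close> is about \<open>p / V^(k/2)\<close>, up to powers \<open>p^e\<close>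
  one gets \<open>c^k \<le> p^(1 - 2 \<alpha>) V^(\<alpha> k)\<close>, that is
  \<open>c \<le> sqrt V * (p^(1/k) / sqrt V)^(1 - 2 \<alpha>)\<close>. The base of the last power is
  at most \<open>p^(1/30)\<close>.\<close>

lemma box_count_powr_le:
  fixes p :: nat and e \<alpha> V S T D c Z :: real
  assumes p: "p > 1" and \<alpha>: "0 \<le> \<alpha>" "\<alpha> \<le> 1 / 2" and k: "5 \<le> k" "k \<le> 30"
    and V: "V \<ge> 1" "V ^ k \<le> (real p)\<^sup>2" "k = 30 \<or> (real p)\<^sup>2 < V ^ Suc k"
    and Z: "Z > 0" "real p \<le> 2 * Z * sqrt (V ^ k)"
    and ST: "Z powr \<alpha> * real p powr (- e) \<le> S" "Z powr \<alpha> * real p powr (- e) \<le> T"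
    and D: "D \<ge> 0" "D \<le> real p powr e" and e: "2 \<le> real p powr e"
    and c: "c \<ge> 0" "c ^ k * (S * T) \<le> D ^ (4 * k) * real p"
  shows "c \<le> real p powr ((1 - 2 * \<alpha>) / 30 + 7 * e) * sqrt V"
proof (cases "c = 0")
  case False
  then have c0: "c > 0" using c by simp
  define l where "l = ln (real p)"
  define v where "v = ln V"
  define z where "z = ln Z"
  have l: "l > 0" using p by (simp add: l_def)
  have v: "v \<ge> 0" using V by (simp add: v_def)
  have pe: "real p powr x = exp (x * l)" for x using p by (simp add: powr_def l_def)
  have Zp: "Z powr \<alpha> * real p powr (- e) = exp (\<alpha> * z - e * l)"
    unfolding pe using Z by (simp add: powr_def z_def exp_diff exp_minus divide_inverse)
  have "ln 2 \<le> ln (exp (e * l))" using e unfolding pe by (subst ln_le_cancel_iff) auto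
  then have e2: "ln 2 \<le> e * l" by (simp only: ln_exp)
  have z: "l \<le> ln 2 + z + real k * v / 2"
  proof -
    have "ln (real p) \<le> ln (2 * Z * sqrt (V ^ k))" using Z p by (subst ln_le_cancel_iff) auto
    also have "\<dots> = ln 2 + z + real k * v / 2"
      using Z V by (simp add: ln_mult ln_sqrt ln_realpow z_def v_def)
    finally show ?thesis by (simp add: l_def)
  qed
  have main: "real k * ln c + 2 * (\<alpha> * z - e * l) \<le> 4 * real k * (e * l) + l"
  proof -
    have "exp (\<alpha> * z - e * l) * exp (\<alpha> * z - e * l) \<le> S * T"
      using ST unfolding Zp by (intro mult_mono) (auto intro: order_trans[OF exp_ge_zero])
    then have "c ^ k * (exp (\<alpha> * z - e * l) * exp (\<alpha> * z - e * l)) \<le> c ^ k * (S * T)"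
      using c by (intro mult_left_mono) auto
    also have "\<dots> \<le> D ^ (4 * k) * real p" by (rule c(2))
    also have "\<dots> \<le> exp (e * l) ^ (4 * k) * real p"
      using D unfolding pe by (intro mult_right_mono power_mono) auto
    finally have le: "c ^ k * (exp (\<alpha> * z - e * l) * exp (\<alpha> * z - e * l)) \<le> exp (e * l) ^ (4 * k) * real p" .
    have "c ^ k = exp (real k * ln c)" using c0 by (simp add: exp_of_nat_mult)
    moreover have "exp (e * l) ^ (4 * k) = exp (real (4 * k) * (e * l))" by (rule exp_of_nat_mult[symmetric])
    moreover have "real p = exp l" using p by (simp add: l_def)
    ultimately have "exp (real k * ln c + ((\<alpha> * z - e * l) + (\<alpha> * z - e * l))) \<le> exp (real (4 * k) * (e * l) + l)"
      using le by (simp only: exp_add)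
    then show ?thesis by simp
  qed
  have k0: "real k > 0" using k by simp
  have "\<alpha> * (l - ln 2 - real k * v / 2) \<le> \<alpha> * z" using z \<alpha> by (intro mult_left_mono) auto
  moreover have "\<alpha> * ln 2 \<le> 1 / 2 * ln 2" using \<alpha> by (intro mult_right_mono) auto
  moreover have expand: "\<alpha> * (l - ln 2 - real k * v / 2) = \<alpha> * l - \<alpha> * ln 2 - \<alpha> * (real k * v) / 2"
    "(1 - 2 * \<alpha>) * l = l - 2 * (\<alpha> * l)"
    by (simp_all add: algebra_simps)
  ultimately have "real k * ln c \<le> 4 * real k * (e * l) + 2 * (e * l) + ln 2 + (1 - 2 * \<alpha>) * l + \<alpha> * (real k * v)"
    using main expand
    by argo
  also have "\<dots> \<le> 4 * real k * (e * l) + 3 * (e * l) + (1 - 2 * \<alpha>) * l + \<alpha> * (real k * v)"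
    using e2 by simp
  also have "3 * (e * l) \<le> 3 * real k * (e * l)"
  proof -
    have "0 \<le> e * l" using e2 ln_ge_zero[of "2 :: real"] by linarith
    then show ?thesis using k by (intro mult_right_mono) auto
  qed
  finally have "real k * ln c \<le> 7 * real k * (e * l) + (1 - 2 * \<alpha>) * l + \<alpha> * (real k * v)" by linarith
  also have "\<dots> = real k * (7 * (e * l) + (1 - 2 * \<alpha>) * (l / real k) + \<alpha> * v)"
    using k0 by (simp add: field_simps)
  finally have "ln c \<le> 7 * (e * l) + (1 - 2 * \<alpha>) * (l / real k) + \<alpha> * v"
    using k0 by (simp only: mult_le_cancel_left_pos)
  also have "\<dots> = 7 * (e * l) + (1 - 2 * \<alpha>) * (l / real k - v / 2) + v / 2" by (simp add: algebra_simps)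
  also have "(1 - 2 * \<alpha>) * (l / real k - v / 2) \<le> (1 - 2 * \<alpha>) * (l / 30)"
  proof (rule mult_left_mono)
    show "l / real k - v / 2 \<le> l / 30"
    \<comment> \<open>For \<open>k = 30\<close> the term \<open>v / 2\<close> is dropped; otherwise
      it is at least \<open>l / (k + 1)\<close> because one more copy would exceed
      \<open>p^2\<close>.\<close>
    proof (cases "k = 30")
      case False
      then have "ln ((real p)\<^sup>2) \<le> ln (V ^ Suc k)" using V p by (subst ln_le_cancel_iff) auto
      then have "2 * l \<le> real (Suc k) * v" using p V by (simp only: ln_realpow l_def v_def of_nat_numeral)
      then have "l / real (Suc k) \<le> v / 2" by (simp add: field_simps)
      moreover have "l / real k - l / real (Suc k) = l / (real k * real (Suc k))"
        using k0 by (simp add: field_simps)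
      moreover have "l / (real k * real (Suc k)) \<le> l / 30"
      proof (rule divide_left_mono)
        have "5 * 6 \<le> real k * real (Suc k)" using k by (intro mult_mono) auto
        then show "30 \<le> real k * real (Suc k)" by simp
      qed (use l k0 in auto)
      ultimately show ?thesis by linarith
    qed (use v in simp)
  qed (use \<alpha> in simp)
  finally have "ln c \<le> ((1 - 2 * \<alpha>) / 30 + 7 * e) * l + v / 2" by (simp add: algebra_simps)
  then have "exp (ln c) \<le> exp (((1 - 2 * \<alpha>) / 30 + 7 * e) * l + v / 2)" by (simp only: exp_le_cancel_iff)
  moreover have "exp (v / 2) = sqrt V" using V by (simp add: v_def ln_sqrt[symmetric])
  ultimately show ?thesis using c0 by (simp add: pe exp_add)
qed (use V in simp)

text \<open>On a dyadic cell inside a box of area \<open>V\<close> the weight is at most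
  \<open>2 / sqrt V\<close>, which cancels the \<open>sqrt V\<close> in the count. Each of the
  \<open>(l + 1)^2\<close> cells contributes at most \<open>2 K\<close>.\<close>

lemma sum_inverse_sqrt_dyadic_le:
  fixes F :: "(nat \<times> nat) set"
  assumes F: "F \<subseteq> {1..H} \<times> {1..H}" and H: "H < 2 ^ Suc l" and K: "K \<ge> 0"
    and box: "\<And>i j. i \<le> l \<Longrightarrow> j \<le> l \<Longrightarrow>
      real (card (F \<inter> {1..2 ^ Suc i} \<times> {1..2 ^ Suc j})) \<le> K * sqrt (real (2 ^ Suc i * 2 ^ Suc j))"
  shows "(\<Sum>(u, v)\<in>F. 1 / sqrt (real u * real v)) \<le> real ((l + 1)\<^sup>2) * (2 * K)"
proof -
  have finF: "finite F" using F by (rule finite_subset) simp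
  have "\<exists>i. u \<ge> 1 \<longrightarrow> 2 ^ i \<le> u \<and> u < 2 ^ Suc i" for u :: nat
    using ex_power_ivl1[of 2 u] by auto
  then obtain f where f: "\<And>u :: nat. u \<ge> 1 \<Longrightarrow> 2 ^ f u \<le> u \<and> u < 2 ^ Suc (f u)" by metis
  have fl: "f u \<le> l" if "u \<in> {1..H}" for u
  proof -
    have "2 ^ f u < (2 :: nat) ^ Suc l" using f[of u] that H by (auto intro: le_less_trans)
    then have "f u < Suc l" by (rule power_less_imp_less_exp[rotated]) simp
    then show ?thesis by simp
  qed
  let ?g = "\<lambda>z. (f (fst z), f (snd z))"
  have "(\<Sum>(u, v)\<in>F. 1 / sqrt (real u * real v))
      = (\<Sum>w\<in>{..l} \<times> {..l}. \<Sum>(u, v)\<in>{z \<in> F. ?g z = w}. 1 / sqrt (real u * real v))"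
    using F fl by (intro sum.group[symmetric] finF) auto
  also have "\<dots> \<le> (\<Sum>w\<in>{..l} \<times> {..l}. 2 * K)"
  proof (rule sum_mono)
    fix w assume w: "w \<in> {..l} \<times> {..l}"
    obtain i j where ij: "w = (i, j)" by (cases w)
    define V where "V = real (2 ^ Suc i * 2 ^ Suc j)"
    have V: "V > 0" by (simp add: V_def)
    have sub: "{z \<in> F. ?g z = w} \<subseteq> F \<inter> {1..2 ^ Suc i} \<times> {1..2 ^ Suc j}"
    proof
      fix z assume z: "z \<in> {z \<in> F. ?g z = w}"
      then have "fst z \<ge> 1" "snd z \<ge> 1" using F by auto
      then show "z \<in> F \<inter> {1..2 ^ Suc i} \<times> {1..2 ^ Suc j}"
        using z f[of "fst z"] f[of "snd z"] ij by (cases z) auto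
    qed
    have "(\<Sum>(u, v)\<in>{z \<in> F. ?g z = w}. 1 / sqrt (real u * real v)) \<le> (\<Sum>z\<in>{z \<in> F. ?g z = w}. 2 / sqrt V)"
    proof (rule sum_mono)
      fix z assume z: "z \<in> {z \<in> F. ?g z = w}"
      obtain u v where uv: "z = (u, v)" by (cases z)
      have "u \<ge> 1" "v \<ge> 1" "f u = i" "f v = j" using z F uv ij by auto
      then have "2 ^ i \<le> u" "2 ^ j \<le> v" using f by blast+
      then have "2 ^ i * 2 ^ j \<le> u * v" by (rule mult_le_mono)
      then have "real (2 ^ i * 2 ^ j) \<le> real (u * v)" by (simp only: of_nat_le_iff)
      then have "V \<le> 4 * (real u * real v)" by (simp add: V_def)
      then have "sqrt V \<le> sqrt (4 * (real u * real v))" by simp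
      then have "sqrt V \<le> 2 * sqrt (real u * real v)" by (simp add: real_sqrt_mult)
      then have "1 / sqrt (real u * real v) \<le> 2 / sqrt V"
        using V \<open>u \<ge> 1\<close> \<open>v \<ge> 1\<close> by (simp add: field_simps)
      then show "(case z of (u, v) \<Rightarrow> 1 / sqrt (real u * real v)) \<le> 2 / sqrt V" by (simp add: uv)
    qed
    also have "\<dots> = real (card {z \<in> F. ?g z = w}) * (2 / sqrt V)" by simp
    also have "\<dots> \<le> (K * sqrt V) * (2 / sqrt V)"
    proof (rule mult_right_mono)
      have "card {z \<in> F. ?g z = w} \<le> card (F \<inter> {1..2 ^ Suc i} \<times> {1..2 ^ Suc j})"
        using sub finF by (intro card_mono) auto
      then have "real (card {z \<in> F. ?g z = w}) \<le> real (card (F \<inter> {1..2 ^ Suc i} \<times> {1..2 ^ Suc j}))"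
        by (simp only: of_nat_le_iff)
      also have "\<dots> \<le> K * sqrt V" unfolding V_def using w ij by (intro box) auto
      finally show "real (card {z \<in> F. ?g z = w}) \<le> K * sqrt V" .
    qed (use V in simp)
    also have "\<dots> = 2 * K" using V by simp
    finally show "(\<Sum>(u, v)\<in>{z \<in> F. ?g z = w}. 1 / sqrt (real u * real v)) \<le> 2 * K" .
  qed
  also have "\<dots> = real ((l + 1)\<^sup>2) * (2 * K)" by (simp add: power2_eq_square)
  finally show ?thesis .
qed

context small_vanishing begin

text \<open>The number \<open>k\<close> of copies of a box that are multiplied together is the largest admissible one,
  capped at 30; the loss is governed by \<open>1 / k - 1 / (k + 1) \<le> 1 / 30\<close>.\<close>

lemma card_rough_box_powr_le:
  fixes e \<alpha> :: real
  assumes D: "\<And>n. n \<in> {1..p\<^sup>2} \<Longrightarrow> tau n \<le> D" "real D \<le> real p powr e"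
    and A: "A \<subseteq> {q. q \<le> y}" "B \<subseteq> {q. q \<le> y}" "A \<inter> B = {}"
    and AB: "\<And>Z. Z \<in> {1..p\<^sup>2} \<Longrightarrow> real Z powr \<alpha> * real p powr (- e) \<le> real (card {n \<in> {1..Z}. prime_factors n \<subseteq> A})"
      "\<And>Z. Z \<in> {1..p\<^sup>2} \<Longrightarrow> real Z powr \<alpha> * real p powr (- e) \<le> real (card {n \<in> {1..Z}. prime_factors n \<subseteq> B})"
    and \<alpha>: "0 \<le> \<alpha>" "\<alpha> \<le> 1 / 2" and e: "2 \<le> real p powr e"
    and NM: "N > 0" "M > 0" "(N * M) ^ 5 \<le> p\<^sup>2"
  shows "real (card (rough_pairs \<inter> {1..N} \<times> {1..M})) \<le> real p powr ((1 - 2 * \<alpha>) / 30 + 7 * e) * sqrt (real (N * M))"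
proof -
  define V where "V = N * M"
  have V: "V \<ge> 1" using NM by (simp add: V_def Suc_le_eq)
  define Ks where "Ks = {k \<in> {5..30}. V ^ k \<le> p\<^sup>2}"
  define k where "k = Max Ks"
  have fin: "finite Ks" and ne: "5 \<in> Ks" using NM by (auto simp: Ks_def V_def)
  have "k \<in> Ks" unfolding k_def using fin ne by (intro Max_in) auto
  then have k: "5 \<le> k" "k \<le> 30" "V ^ k \<le> p\<^sup>2" by (auto simp: Ks_def)
  have kmax: "k = 30 \<or> p\<^sup>2 < V ^ Suc k"
  proof (rule ccontr)
    assume "\<not> ?thesis"
    then have "Suc k \<in> Ks" using k by (simp add: Ks_def del: power_Suc)
    then have "Suc k \<le> k" using fin unfolding k_def by (intro Max_ge)
    then show False by simp
  qed
  define r where "r = real p / sqrt (real (V ^ k))"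
  define Z where "Z = nat \<lfloor>r\<rfloor>"
  have sV: "sqrt (real (V ^ k)) > 0" using V by simp
  have "real (V ^ k) \<le> real (p\<^sup>2)" using k(3) by (simp only: of_nat_le_iff)
  then have "sqrt (real (V ^ k)) \<le> sqrt (real (p\<^sup>2))" by (simp only: real_sqrt_le_iff)
  then have "sqrt (real (V ^ k)) \<le> real p" by simp
  then have r1: "r \<ge> 1" unfolding r_def using sV by (simp add: field_simps)
  then have Z: "Z \<ge> 1" "real Z \<le> r" "r < real Z + 1" unfolding Z_def by linarith+
  then have "r \<le> 2 * real Z" by linarith
  note Z = Z(1,2) this
  have pZ: "real p \<le> 2 * real Z * sqrt (real (V ^ k))"
    using Z(3) sV unfolding r_def by (simp add: field_simps)
  have VZ: "V ^ k * Z\<^sup>2 \<le> p\<^sup>2"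
  proof -
    have "real Z * sqrt (real (V ^ k)) \<le> real p" using Z(2) sV unfolding r_def by (simp add: field_simps)
    then have "(real Z * sqrt (real (V ^ k)))\<^sup>2 \<le> (real p)\<^sup>2" by (intro power_mono) auto
    then have "real (V ^ k * Z\<^sup>2) \<le> real (p\<^sup>2)" by (simp add: power_mult_distrib mult.commute)
    then show ?thesis by (simp only: of_nat_le_iff)
  qed
  have "1 * Z \<le> Z * Z" using Z by (intro mult_le_mono) auto
  then have "Z \<le> Z\<^sup>2" by (simp only: power2_eq_square mult_1)
  moreover have "1 * Z\<^sup>2 \<le> V ^ k * Z\<^sup>2" using V by (intro mult_le_mono) auto
  then have "Z\<^sup>2 \<le> V ^ k * Z\<^sup>2" by (simp only: mult_1)
  ultimately have "Z \<le> p\<^sup>2" using VZ by linarith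
  then have Zin: "Z \<in> {1..p\<^sup>2}" using Z(1) by simp
  let ?c = "card (rough_pairs \<inter> {1..N} \<times> {1..M})"
  let ?S = "\<lambda>A. card {n \<in> {1..Z}. prime_factors n \<subseteq> A}"
  have "?c ^ k * (?S A * ?S B) \<le> D ^ (4 * k) * p"
    using NM k VZ Z unfolding V_def by (intro card_rough_box_le[OF D(1) A]) auto
  then have "real (?c ^ k * (?S A * ?S B)) \<le> real (D ^ (4 * k) * p)" by (simp only: of_nat_le_iff)
  then have bd: "real ?c ^ k * (real (?S A) * real (?S B)) \<le> real D ^ (4 * k) * real p"
    by (simp only: of_nat_mult of_nat_power)
  have "real ?c \<le> real p powr ((1 - 2 * \<alpha>) / 30 + 7 * e) * sqrt (real V)"
  proof (rule box_count_powr_le[OF _ \<alpha> k(1,2) _ _ _ _ _ AB(1)[OF Zin] AB(2)[OF Zin] _ D(2) e _ bd])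
    show "real V ^ k \<le> (real p)\<^sup>2" using \<open>real (V ^ k) \<le> real (p\<^sup>2)\<close> by simp
    have "real (p\<^sup>2) < real (V ^ Suc k)" if "p\<^sup>2 < V ^ Suc k" using that by (simp only: of_nat_less_iff)
    then show "k = 30 \<or> (real p)\<^sup>2 < real V ^ Suc k" using kmax by auto
    show "real p \<le> 2 * real Z * sqrt (real V ^ k)" using pZ by simp
  qed (use V Z p_ge_3 in auto)
  then show ?thesis by (simp only: V_def)
qed

text \<open>Dyadic boxes have sides at most \<open>2 H\<close>, hence the condition on
  \<open>4 H^2\<close>. The \<open>10 e\<close> consists of \<open>7 e\<close> from the boxes and
  one \<open>e\<close> each for the logarithm, Rankin's factor and the number of boxes.\<close>

lemma R2_powr_le:
  fixes e \<alpha> :: real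
  assumes D: "\<And>n. n \<in> {1..p\<^sup>2} \<Longrightarrow> tau n \<le> D" "real D \<le> real p powr e"
    and A: "A \<subseteq> {q. q \<le> y}" "B \<subseteq> {q. q \<le> y}" "A \<inter> B = {}"
    and AB: "\<And>Z. Z \<in> {1..p\<^sup>2} \<Longrightarrow> real Z powr \<alpha> * real p powr (- e) \<le> real (card {n \<in> {1..Z}. prime_factors n \<subseteq> A})"
      "\<And>Z. Z \<in> {1..p\<^sup>2} \<Longrightarrow> real Z powr \<alpha> * real p powr (- e) \<le> real (card {n \<in> {1..Z}. prime_factors n \<subseteq> B})"
    and \<alpha>: "0 \<le> \<alpha>" "\<alpha> \<le> 1 / 2" and e: "2 \<le> real p powr e"
    and H: "H > 0" "H \<le> p" "(4 * H\<^sup>2) ^ 5 \<le> p\<^sup>2"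
    and asy: "1 + ln (real p) \<le> real p powr e" "exp (16 * sqrt (real y)) \<le> real p powr e"
      "2 * (1 + ln (real p) / ln 2)\<^sup>2 \<le> real p powr e"
  shows "real (R2 {1..<int H}) \<le> real H * real p powr ((1 - 2 * \<alpha>) / 30 + 10 * e)"
proof -
  obtain l where l: "2 ^ l \<le> H" "H < 2 ^ Suc l" using ex_power_ivl1[of 2 H] H by auto
  define K where "K = real p powr ((1 - 2 * \<alpha>) / 30 + 7 * e)"
  have p1: "real p > 1" using p_ge_3 by simp
  have "(\<Sum>(u, v)\<in>rough_pairs \<inter> {1..H} \<times> {1..H}. 1 / sqrt (real u * real v)) \<le> real ((l + 1)\<^sup>2) * (2 * K)"
  proof (rule sum_inverse_sqrt_dyadic_le[OF _ l(2)])
    fix i j assume ij: "i \<le> l" "j \<le> l"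
    have "2 ^ Suc i \<le> 2 * H" "2 ^ Suc j \<le> 2 * H"
      using le_trans[OF power_increasing[OF ij(1), of "2 :: nat"] l(1)]
        le_trans[OF power_increasing[OF ij(2), of "2 :: nat"] l(1)] by simp_all
    then have "2 ^ Suc i * 2 ^ Suc j \<le> (2 * H) * (2 * H)" by (rule mult_le_mono)
    then have "2 ^ Suc i * 2 ^ Suc j \<le> 4 * H\<^sup>2" by (simp add: power2_eq_square)
    then have "(2 ^ Suc i * 2 ^ Suc j) ^ 5 \<le> (4 * H\<^sup>2) ^ 5" by (rule power_mono) simp
    then have "(2 ^ Suc i * 2 ^ Suc j) ^ 5 \<le> p\<^sup>2" using H(3) by (rule order_trans)
    then have "real (card (rough_pairs \<inter> {1..2 ^ Suc i} \<times> {1..2 ^ Suc j})) \<le> K * sqrt (real (2 ^ Suc i * 2 ^ Suc j))"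
      unfolding K_def by (intro card_rough_box_powr_le[OF D A AB \<alpha> e]) simp_all
    moreover have "card ((rough_pairs \<inter> {1..H} \<times> {1..H}) \<inter> {1..2 ^ Suc i} \<times> {1..2 ^ Suc j})
       \<le> card (rough_pairs \<inter> {1..2 ^ Suc i} \<times> {1..2 ^ Suc j})"
      by (rule card_mono) (auto intro: finite_subset[of _ "{1..2 ^ Suc i} \<times> {1..2 ^ Suc j}"])
    ultimately show "real (card ((rough_pairs \<inter> {1..H} \<times> {1..H}) \<inter> {1..2 ^ Suc i} \<times> {1..2 ^ Suc j}))
       \<le> K * sqrt (real (2 ^ Suc i * 2 ^ Suc j))"
      by linarith
  qed (auto simp: K_def)
  also have "real ((l + 1)\<^sup>2) * (2 * K) \<le> real p powr e * K"
  proof -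
    have "2 ^ l \<le> p" using l H by linarith
    then have "real (2 ^ l) \<le> real p" by (simp only: of_nat_le_iff)
    then have "ln (2 ^ l) \<le> ln (real p)" using p1 by (subst ln_le_cancel_iff) auto
    then have "real l * ln 2 \<le> ln (real p)" by (simp add: ln_realpow)
    then have "real l + 1 \<le> 1 + ln (real p) / ln 2" by (simp add: field_simps)
    then have "(real l + 1)\<^sup>2 \<le> (1 + ln (real p) / ln 2)\<^sup>2" by (intro power_mono) auto
    then have "2 * (real l + 1)\<^sup>2 \<le> real p powr e" using asy(3) by linarith
    then have "2 * (real l + 1)\<^sup>2 * K \<le> real p powr e * K" by (intro mult_right_mono) (simp_all add: K_def)
    then show ?thesis by (simp add: ac_simps)
  qed
  finally have S: "(\<Sum>(u, v)\<in>rough_pairs \<inter> {1..H} \<times> {1..H}. 1 / sqrt (real u * real v)) \<le> real p powr e * K" .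
  have "1 + ln (real H) \<le> 1 + ln (real p)" using H by simp
  then have lnH: "1 + ln (real H) \<le> real p powr e" using asy(1) by (rule order_trans)
  have lnH0: "0 \<le> 1 + ln (real H)" using H by simp
  have "real (R2 {1..<int H}) \<le> real H * (1 + ln (real H)) * exp (16 * sqrt (real y)) *
    (\<Sum>(u, v)\<in>rough_pairs \<inter> {1..H} \<times> {1..H}. 1 / sqrt (real u * real v))"
    by (rule R2_le[OF H(1,2)])
  also have "\<dots> \<le> real H * real p powr e * real p powr e * (real p powr e * K)"
  proof (intro mult_mono S asy(2) lnH)
    show "0 \<le> (\<Sum>(u, v)\<in>rough_pairs \<inter> {1..H} \<times> {1..H}. 1 / sqrt (real u * real v))"
      by (intro sum_nonneg) auto
  qed (use lnH0 in auto)
  also have "\<dots> = real H * (real p powr e * real p powr e * real p powr e * K)" by (simp only: mult_ac)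
  also have "real p powr e * real p powr e * real p powr e * K = real p powr ((1 - 2 * \<alpha>) / 30 + 10 * e)"
  proof -
    have "(1 - 2 * \<alpha>) / 30 + 10 * e = e + e + e + ((1 - 2 * \<alpha>) / 30 + 7 * e)" by simp
    then show ?thesis unfolding K_def by (simp only: powr_add)
  qed
  finally show ?thesis .
qed

text \<open>The exponential sums give at most \<open>12 p / H\<close> smooth numbers up to
  \<open>X\<close>, which is about \<open>p^(131/72)\<close>, whereas there are about
  \<open>X^\<alpha>\<close>. Comparing exponents, \<open>131/72 \<alpha> + 13/72\<close> would be at
  most 1 up to multiples of \<open>e\<close>.\<close>

lemma small_vanishing_contradiction:
  fixes e \<alpha> :: real
  assumes D: "\<And>n. n \<in> {1..p\<^sup>2} \<Longrightarrow> tau n \<le> D" "real D \<le> real p powr e"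
    and A: "A \<subseteq> {q. q \<le> y}" "B \<subseteq> {q. q \<le> y}" "A \<inter> B = {}"
    and AB: "\<And>Z. Z \<in> {1..p\<^sup>2} \<Longrightarrow> real Z powr \<alpha> * real p powr (- e) \<le> real (card {n \<in> {1..Z}. prime_factors n \<subseteq> A})"
      "\<And>Z. Z \<in> {1..p\<^sup>2} \<Longrightarrow> real Z powr \<alpha> * real p powr (- e) \<le> real (card {n \<in> {1..Z}. prime_factors n \<subseteq> B})"
    and \<alpha>: "0 \<le> \<alpha>" "\<alpha> \<le> 1 / 2" "59 / 72 + 3 * e < 131 / 72 * \<alpha>" and e: "0 < e" "e \<le> 1 / 30000"
    and S2: "real S2 \<le> real p powr (16 / 11 + e)"
    and asy: "1 + ln (real p) \<le> real p powr e" "exp (16 * sqrt (real y)) \<le> real p powr e"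
      "2 * (1 + ln (real p) / ln 2)\<^sup>2 \<le> real p powr e" "24 \<le> real p powr e"
      "1024 * real p powr (130 / 72) \<le> (real p)\<^sup>2" "12 \<le> real p powr (131 / 72)" "2 \<le> real p powr (13 / 72)"
  shows False
proof -
  have p1: "real p > 1" using p_ge_3 by simp
  define H where "H = nat \<lfloor>real p powr (13 / 72)\<rfloor>"
  define X where "X = p\<^sup>2 div (6 * H)"
  have H: "real H \<le> real p powr (13 / 72)" "real p powr (13 / 72) \<le> 2 * real H" "H \<ge> 1"
    using asy(7) unfolding H_def by linarith+
  have "real p powr (13 / 72) \<le> real p powr 1" using p1 by (intro powr_mono) auto
  then have Hp: "H \<le> p" using H(1) by simp
  have H5: "(4 * H\<^sup>2) ^ 5 \<le> p\<^sup>2"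
  proof -
    have "real ((4 * H\<^sup>2) ^ 5) = 1024 * real H ^ 10" by (simp add: power_mult_distrib)
    also have "\<dots> \<le> 1024 * (real p powr (13 / 72)) ^ 10" using H by (intro mult_left_mono power_mono) auto
    also have "(real p powr (13 / 72)) ^ 10 = real p powr (130 / 72)"
      using p1 by (simp add: powr_power)
    also have "1024 * real p powr (130 / 72) \<le> real (p\<^sup>2)" using asy(5) by simp
    finally show ?thesis by (simp only: of_nat_le_iff)
  qed
  have e2: "2 \<le> real p powr e" using asy(4) by simp
  define r where "r = (1 - 2 * \<alpha>) / 30"
  \<comment> \<open>From \<open>\<alpha> > 59/131\<close> follows
    \<open>1 - 2 \<alpha> < 13/131\<close>.\<close>
  have r: "r \<le> 13 / 3930" using \<alpha>(3) e unfolding r_def by simp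
  have R2: "real (R2 {1..<int H}) \<le> real H * real p powr (r + 10 * e)"
    unfolding r_def using H Hp H5 by (intro R2_powr_le[OF D A AB \<alpha>(1,2) e2 _ _ _ asy(1-3)]) auto
  define T where "T = (\<Sum>d\<in>{1..<int H}. norm (SS d))"
  have T0: "T \<ge> 0" unfolding T_def by (intro sum_nonneg) auto
  have "T ^ 4 \<le> (real (card {1..<int H}))\<^sup>2 * real (R2 {1..<int H}) * (of_int Q * real (p + S2))"
    unfolding T_def
  proof (rule sum_SS_fourth_le)
    fix d assume "d \<in> {1..<int H}"
    then show "\<not> P dvd d" using Hp by (auto dest: zdvd_imp_le)
  qed simp
  also have "\<dots> \<le> (real p powr (13 / 72))\<^sup>2 * (real p powr (13 / 72) * real p powr (r + 10 * e)) *
      ((real p)\<^sup>2 * (real p powr e * real p powr (16 / 11 + e)))"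
  proof (intro mult_mono power_mono)
    show "real (card {1..<int H}) \<le> real p powr (13 / 72)" using H by simp
    have "real H * real p powr (r + 10 * e) \<le> real p powr (13 / 72) * real p powr (r + 10 * e)"
      using H by (intro mult_right_mono) auto
    with R2 show "real (R2 {1..<int H}) \<le> real p powr (13 / 72) * real p powr (r + 10 * e)" by linarith
    show "of_int Q \<le> (real p)\<^sup>2" by (simp add: power2_eq_square)
    have "real p powr 1 \<le> real p powr (16 / 11 + e)" using p1 e by (intro powr_mono) auto
    then have "real p + real S2 \<le> 2 * real p powr (16 / 11 + e)" using S2 by simp
    also have "\<dots> \<le> real p powr e * real p powr (16 / 11 + e)" using e2 by (intro mult_right_mono) auto
    finally show "real (p + S2) \<le> real p powr e * real p powr (16 / 11 + e)" by simp
  qed auto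
  also have "\<dots> = real p powr (3 * (13 / 72) + r + 10 * e + 2 + e + (16 / 11 + e))"
  proof -
    have "(real p)\<^sup>2 = real p powr 2" using p1 by simp
    moreover have "(real p powr (13 / 72))\<^sup>2 = real p powr (13 / 72 + 13 / 72)"
      by (simp only: power2_eq_square powr_add)
    ultimately have "(real p powr (13 / 72))\<^sup>2 * (real p powr (13 / 72) * real p powr (r + 10 * e)) *
      ((real p)\<^sup>2 * (real p powr e * real p powr (16 / 11 + e))) = real p powr (13 / 72 + 13 / 72 + (13 / 72 + (r + 10 * e)) + (2 + (e + (16 / 11 + e))))"
      by (simp only: powr_add)
    also have "13 / 72 + 13 / 72 + (13 / 72 + (r + 10 * e)) + (2 + (e + (16 / 11 + e)))
        = 3 * (13 / 72) + r + 10 * e + 2 + e + (16 / 11 + e)" by simp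
    finally show ?thesis .
  qed
  \<comment> \<open>The narrow margin: \<open>39/72 + 13/3930 + 2 + 16/11\<close> is about 3.9995,
    and \<open>12 e \<le> 0.0004\<close> still fits below 4.\<close>
  also have "\<dots> \<le> real p powr 4" using p1 r e by (intro powr_mono) auto
  also have "\<dots> = real p ^ 4" using p1 by simp
  finally have "T \<le> real p" using power_le_imp_le_base[of T 3 "real p"] by simp
  define E where "E = {n \<in> {1..X}. prime_factors n \<subseteq> A}"
  have HX: "6 * H * X \<le> p\<^sup>2" unfolding X_def by (simp add: mult.commute)
  have "real (card (int ` E)) * of_int (int H) \<le> 4 * (real p + 2 * (\<Sum>d\<in>{1..<int H}. norm (SS d)))"
  proof (rule card_small_elements_le)
    show "int ` E \<subseteq> {1..int X}" by (auto simp: E_def)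
    fix n assume "n \<in> int ` E"
    then obtain m where m: "n = int m" "m > 0" "prime_factors m \<subseteq> A" by (auto simp: E_def)
    then have "\<not> p dvd m \<and> fq (int m) = 0" using A(1) by (intro fq_smooth) auto
    then show "\<not> P dvd n \<and> fq n = 0" using m by simp
  next
    have "int (6 * H * X) \<le> int (p\<^sup>2)" using HX by (simp only: of_nat_le_iff)
    then show "6 * int H * int X \<le> Q" by (simp add: power2_eq_square)
  qed (use H in auto)
  also have "card (int ` E) = card E" by (intro card_image) simp
  finally have "real (card E) * real H \<le> 12 * real p"
    using \<open>T \<le> real p\<close> unfolding T_def[symmetric] by simp
  have X1: "real p powr (131 / 72) \<le> 12 * real X"
  proof -
    have H0: "6 * H > 0" using H by simp
    have "p\<^sup>2 < (X + 1) * (6 * H)" unfolding X_def using H0 by (metis Suc_eq_plus1 dividend_less_div_times mult_Suc)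
    then have "real (p\<^sup>2) < real ((X + 1) * (6 * H))" by (simp only: of_nat_less_iff)
    then have "(real p)\<^sup>2 \<le> (real X + 1) * 6 * real H" by (simp add: algebra_simps)
    also have "\<dots> \<le> (real X + 1) * 6 * real p powr (13 / 72)" using H by (intro mult_left_mono) auto
    also have "(real p)\<^sup>2 = real p powr (131 / 72) * real p powr (13 / 72)"
      using p1 by (simp add: powr_add[symmetric])
    finally have "real p powr (131 / 72) \<le> (real X + 1) * 6" using p1 by simp
    moreover have "t \<le> 12 * x" if "t \<le> (x + 1) * 6" "12 \<le> t" for t x :: real using that by argo
    ultimately show ?thesis using asy(6) by blast
  qed
  have X: "X \<in> {1..p\<^sup>2}"
  proof -
    have "real X > 0" using X1 asy(6) by linarith
    moreover have "X \<le> p\<^sup>2" unfolding X_def by simp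
    ultimately show ?thesis by simp
  qed
  have "real p powr (131 / 72 - e) \<le> real X"
  proof -
    have "real p powr (131 / 72) = real p powr (131 / 72 - e) * real p powr e" by (simp add: powr_add[symmetric])
    moreover have "real p powr (131 / 72 - e) * 12 \<le> real p powr (131 / 72 - e) * real p powr e"
      using asy(4) by (intro mult_left_mono) auto
    ultimately show ?thesis using X1 by linarith
  qed
  then have "(real p powr (131 / 72 - e)) powr \<alpha> * real p powr (- e) \<le> real X powr \<alpha> * real p powr (- e)"
    using \<alpha> by (intro mult_right_mono powr_mono2) auto
  also have "\<dots> \<le> real (card E)" unfolding E_def by (rule AB(1)[OF X])
  finally have "real p powr ((131 / 72 - e) * \<alpha> - e) \<le> real (card E)"
    by (simp add: powr_powr powr_add[symmetric])
  then have "real p powr ((131 / 72 - e) * \<alpha> - e) * (real p powr (13 / 72) / 2) \<le> real (card E) * real H"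
    using H by (intro mult_mono) auto
  also have "\<dots> \<le> 12 * real p" by fact
  finally have "real p powr ((131 / 72 - e) * \<alpha> - e) * real p powr (13 / 72) \<le> 24 * real p" by simp
  also have "\<dots> \<le> real p powr e * real p powr 1" using asy(4) p1 by (simp add: mult_right_mono)
  finally have "real p powr ((131 / 72 - e) * \<alpha> - e + 13 / 72) \<le> real p powr (e + 1)"
    by (simp only: powr_add)
  then have "(131 / 72 - e) * \<alpha> - e + 13 / 72 \<le> e + 1" using p1 by (simp only: powr_le_cancel_iff)
  moreover have "(131 / 72 - e) * \<alpha> = 131 / 72 * \<alpha> - e * \<alpha>" by (rule left_diff_distrib)
  moreover have "e * \<alpha> \<le> e * (1 / 2)" using e \<alpha> by (intro mult_left_mono) auto
  ultimately show False using \<alpha>(3) e by argo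
qed

end

lemma eventually_S2_le:
  fixes e :: real
  assumes e: "e > 0"
  shows "\<forall>\<^sub>F p in sequentially. odd_prime p \<longrightarrow> real (odd_prime.S2 p) \<le> real p powr (16 / 11 + e)"
proof -
  have "\<forall>\<^sub>F p :: nat in sequentially. 10 ^ 80 * (2 + ln (real p) / ln 2) ^ 22 \<le> real p powr e"
    using e by real_asymp
  then show ?thesis
  proof eventually_elim
    case (elim p)
    show ?case
    proof
      assume "odd_prime p"
      then interpret odd_prime p .
      have p1: "real p > 1" using p_ge_3 by simp
      define l where "l = nat \<lceil>ln (real p) / ln 2\<rceil>"
      have l: "ln (real p) / ln 2 \<le> real l" "real l \<le> 2 + ln (real p) / ln 2"
      proof -
        have "0 \<le> ln (real p) / ln 2" using p1 by simp
        then show "ln (real p) / ln 2 \<le> real l" "real l \<le> 2 + ln (real p) / ln 2"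
          unfolding l_def by linarith+
      qed
      have "ln (real p) \<le> ln (2 ^ l)" using l(1) by (simp add: ln_realpow field_simps)
      then have "real p \<le> real (2 ^ l)" using p1 by (subst (asm) ln_le_cancel_iff) auto
      then have pl: "p \<le> 2 ^ l" by (simp only: of_nat_le_iff)
      have "real l ^ 22 \<le> (2 + ln (real p) / ln 2) ^ 22" using l by (intro power_mono) auto
      then have "10 ^ 80 * real l ^ 22 \<le> 10 ^ 80 * (2 + ln (real p) / ln 2) ^ 22" by (intro mult_left_mono) auto
      then have lp: "10 ^ 80 * real l ^ 22 \<le> real p powr e" using elim by (rule order_trans)
      have *: "real S2 \<le> real p powr (16 / 11 + e)"
        if h: "real S2 ^ Suc n \<le> 10 ^ 80 * real l ^ 22 * real p ^ m" and mn: "real m \<le> 16 / 11 * real (Suc n)" for n m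
      proof -
        have "10 ^ 80 * real l ^ 22 * real p ^ m \<le> real p powr e * real p powr (real m)"
          using lp p1 by (simp add: powr_realpow mult_right_mono)
        also have "\<dots> = real p powr (e + real m)" by (simp add: powr_add)
        also have "\<dots> \<le> real p powr ((16 / 11 + e) * real (Suc n))"
        proof (rule powr_mono)
          have "e * 1 \<le> e * real (Suc n)" using e by (intro mult_left_mono) auto
          then show "e + real m \<le> (16 / 11 + e) * real (Suc n)" using mn by (simp only: distrib_right)
        qed (use p1 in simp)
        also have "\<dots> = (real p powr (16 / 11 + e)) ^ Suc n"
          using p1 by (simp add: powr_power mult.commute del: power_Suc)
        finally have "real S2 ^ Suc n \<le> (real p powr (16 / 11 + e)) ^ Suc n" using h by linarith
        then show ?thesis by (rule power_le_imp_le_base) simp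
      qed
      show "real S2 \<le> real p powr (16 / 11 + e)"
        using S2_bound[OF pl] *[of 2 4] *[of 19 29] *[of 10 16] by (auto simp: numeral_eq_Suc)
    qed
  qed
qed

text \<open>\<open>k > 131/72\<close> is equivalent to \<open>131/72 \<alpha> > 59/72\<close> for
  \<open>\<alpha> = 1 - 1/k\<close>. The bound \<open>k < 2\<close> gives
  \<open>\<alpha> \<le> 1/2\<close> and makes \<open>sqrt y\<close> of smaller order than
  \<open>ln p\<close>, as Rankin's factor requires.\<close>

lemma eventually_not_small_vanishing:
  fixes k :: real
  assumes k: "131 / 72 < k" "k < 2"
  shows "\<forall>\<^sub>F p :: nat in sequentially. \<not> small_vanishing p (nat \<lfloor>ln (real p) powr k\<rfloor>)"
proof -
  define \<alpha> where "\<alpha> = 1 - 1 / k"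
  have \<alpha>: "0 \<le> \<alpha>" "\<alpha> \<le> 1 / 2" "59 / 72 < 131 / 72 * \<alpha>" unfolding \<alpha>_def using k by (simp_all add: field_simps)
  define e where "e = min (1 / 30000) ((131 / 72 * \<alpha> - 59 / 72) / 4)"
  have e: "0 < e" "e \<le> 1 / 30000" "59 / 72 + 3 * e < 131 / 72 * \<alpha>"
  proof -
    have "e \<le> (131 / 72 * \<alpha> - 59 / 72) / 4" unfolding e_def by (rule min.cobounded2)
    then show "59 / 72 + 3 * e < 131 / 72 * \<alpha>" using \<alpha>(3) by argo
    show "e \<le> 1 / 30000" unfolding e_def by (rule min.cobounded1)
    show "0 < e" using \<alpha>(3) by (simp add: e_def)
  qed
  \<comment> \<open>The exponent \<open>e / 4\<close> suits arguments up to \<open>p^2\<close>: it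
    yields \<open>p^(e/2)\<close>, and another \<open>p^(e/2)\<close> absorbs
    \<open>C\<close>.\<close>
  obtain C where C: "C \<ge> 1" "\<And>n. n > 0 \<Longrightarrow> real (tau n) \<le> C * real n powr (e / 4)"
    using tau_le_powr[of "e / 4"] e by auto
  have 1: "\<forall>\<^sub>F p :: nat in sequentially. 1 + ln (real p) \<le> real p powr e" using e by real_asymp
  have 2: "\<forall>\<^sub>F p :: nat in sequentially. 16 * ln (real p) powr (k / 2) \<le> e * ln (real p)"
  proof -
    have "\<forall>\<^sub>F L :: real in at_top. 16 * L powr (k / 2) \<le> e * L" using e k by real_asymp
    then show ?thesis by (rule eventually_lnreal)
  qed
  have 3: "\<forall>\<^sub>F p :: nat in sequentially. 2 * (1 + ln (real p) / ln 2)\<^sup>2 \<le> real p powr e" using e by real_asymp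
  have 4: "\<forall>\<^sub>F p :: nat in sequentially. 24 \<le> real p powr e" using e by real_asymp
  have 5: "\<forall>\<^sub>F p :: nat in sequentially. 1024 * real p powr (130 / 72) \<le> (real p)\<^sup>2" by real_asymp
  have 6: "\<forall>\<^sub>F p :: nat in sequentially. 12 \<le> real p powr (131 / 72)" by real_asymp
  have 7: "\<forall>\<^sub>F p :: nat in sequentially. 2 \<le> real p powr (13 / 72)" by real_asymp
  have 8: "\<forall>\<^sub>F p :: nat in sequentially. C \<le> real p powr (e / 2)" using e by real_asymp
  have e3: "e / 3 > 0" "e / 3 < k - 1" "1 < k" using e k by auto
  show ?thesis
    using 1 2 3 4 5 6 7 8 eventually_smooth_ge[OF e3(3,1,2)] eventually_S2_le[OF e(1)]
  proof eventually_elim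
    case (elim p)
    show ?case
    proof
      define y where "y = nat \<lfloor>ln (real p) powr k\<rfloor>"
      assume "small_vanishing p (nat \<lfloor>ln (real p) powr k\<rfloor>)"
      then interpret small_vanishing p y unfolding y_def .
      have p1: "real p > 1" using p_ge_3 by simp
      obtain A B where A: "A \<subseteq> {q. prime q \<and> q \<le> y}" "B \<subseteq> {q. prime q \<and> q \<le> y}" "A \<inter> B = {}"
        and AB: "\<forall>Z\<in>{1..p\<^sup>2}. real Z powr \<alpha> * real p powr (- (3 * (e / 3))) \<le> real (card {n \<in> {1..Z}. prime_factors n \<subseteq> A}) \<and>
       real Z powr \<alpha> * real p powr (- (3 * (e / 3))) \<le> real (card {n \<in> {1..Z}. prime_factors n \<subseteq> B})"
        using elim(9) unfolding y_def[symmetric] \<alpha>_def[symmetric] by blast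
      define D where "D = nat \<lfloor>real p powr e\<rfloor>"
      have D: "real D \<le> real p powr e" unfolding D_def by simp
      have tauD: "tau n \<le> D" if n: "n \<in> {1..p\<^sup>2}" for n
      proof -
        have "n \<le> p\<^sup>2" using n by simp
        then have "real n \<le> real (p\<^sup>2)" by (simp only: of_nat_le_iff)
        then have "real n powr (e / 4) \<le> (real p powr 2) powr (e / 4)"
          using e p1 by (intro powr_mono2) auto
        then have n2: "real n powr (e / 4) \<le> real p powr (e / 2)" by (simp only: powr_powr) simp
        have "real (tau n) \<le> C * real n powr (e / 4)" using C(2) n by simp
        also have "\<dots> \<le> real p powr (e / 2) * real p powr (e / 2)"
          using elim(8) n2 C(1) by (intro mult_mono) auto
        also have "\<dots> = real p powr e" by (simp add: powr_add[symmetric])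
        finally show ?thesis unfolding D_def by (simp add: le_nat_floor)
      qed
      have expy: "exp (16 * sqrt (real y)) \<le> real p powr e"
      proof -
        have "real y \<le> ln (real p) powr k" unfolding y_def by simp
        then have "sqrt (real y) \<le> sqrt (ln (real p) powr k)" by (simp only: real_sqrt_le_iff)
        also have "\<dots> = ln (real p) powr (k / 2)" by (simp add: powr_half_sqrt[symmetric] powr_powr)
        finally have "16 * sqrt (real y) \<le> e * ln (real p)" using elim(2) by linarith
        then show ?thesis using p1 by (simp add: powr_def)
      qed
      have S2: "real S2 \<le> real p powr (16 / 11 + e)" using elim(10) odd_prime_axioms by blast
      show False
        by (rule small_vanishing_contradiction[OF tauD D _ _ A(3) _ _ \<alpha>(1,2) e(3,1,2) S2 elim(1) expy elim(3-7)])
          (use A AB in auto)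
    qed
  qed
qed

lemma eventually_least_nonvanishing_le:
  fixes k :: real
  assumes k: "131 / 72 < k" "k < 2"
  shows "\<forall>\<^sub>F p :: nat in sequentially. prime p \<longrightarrow> real (least_nonvanishing p) \<le> ln (real p) powr k"
proof -
  have 1: "\<forall>\<^sub>F p :: nat in sequentially. ln (real p) powr k < real p" using k by real_asymp
  show ?thesis
    using eventually_not_small_vanishing[OF k] 1 eventually_gt_at_top[of 2]
  proof eventually_elim
    case (elim p)
    show ?case
    proof (intro impI)
      assume p: "prime p"
      then interpret odd_prime p by unfold_locales (rule p, rule prime_odd_nat[OF p elim(3)])
      define y where "y = nat \<lfloor>ln (real p) powr k\<rfloor>"
      have yl: "real y \<le> ln (real p) powr k" by (simp add: y_def)
      then have yp: "y < p" using elim(2) by linarith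
      have "\<not> y < least_nonvanishing p"
      proof
        assume l: "y < least_nonvanishing p"
        have "small_vanishing p y"
        proof unfold_locales
          fix n assume n: "n \<in> {1..y}"
          then have "n < least_nonvanishing p" using l by simp
          from not_less_Least[OF this[unfolded least_nonvanishing_def]]
          have "n > 0 \<longrightarrow> \<not> p dvd n \<longrightarrow> [fermat_quotient p (int n) = 0] (mod int p)" by blast
          moreover have "\<not> p dvd n" using n yp by (auto dest: dvd_imp_le)
          ultimately have "[fermat_quotient p (int n) = 0] (mod int p)" using n by simp
          then have "int p dvd fermat_quotient p (int n)" by (simp only: cong_0_iff)
          then show "fq (int n) = 0" unfolding fq_def by (rule dvd_imp_mod_0)
        qed (rule yp)
        then show False using elim(1) by (simp add: y_def)
      qed
      then have "real (least_nonvanishing p) \<le> real y" by simp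
      with yl show "real (least_nonvanishing p) \<le> ln (real p) powr k" by linarith
    qed
  qed
qed

theorem theorem16:
  shows "\<exists>e :: nat \<Rightarrow> real. e \<in> o(\<lambda>_. 1) \<and>
    (\<forall>\<^sub>F p in sequentially. prime p \<longrightarrow>
       real (least_nonvanishing p) \<le> ln (real p) powr (131 / 72 + e p))"
proof -
  \<comment> \<open>\<open>x p\<close> is the exact exponent of the least nonvanishing argument to
    the base \<open>ln p\<close>. Its positive excess over 131/72 is one function that serves for
    all fixed \<open>k > 131/72\<close> at once.\<close>
  define x where "x = (\<lambda>p :: nat. ln (real (least_nonvanishing p)) / ln (ln (real p)))"
  define e where "e = (\<lambda>p :: nat. if prime p then max 0 (x p - 131 / 72) else 0)"
  have L: "\<forall>\<^sub>F p :: nat in sequentially. ln (real p) > 1" by real_asymp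
  have pos: "least_nonvanishing p > 0" if "prime p" for p
    using LeastI_ex[OF least_nonvanishing_witness[OF that]] unfolding least_nonvanishing_def by blast
  have "\<forall>\<^sub>F p in sequentially. norm (e p) \<le> c * norm (1 :: real)" if c: "c > 0" for c
  proof -
    \<comment> \<open>The cap \<open>1/10\<close> keeps \<open>k\<close> below 2.\<close>
    define k where "k = 131 / 72 + min c (1 / 10)"
    have k: "131 / 72 < k" "k < 2" "k \<le> 131 / 72 + c" using c unfolding k_def by auto
    show ?thesis
      using eventually_least_nonvanishing_le[OF k(1,2)] L
    proof eventually_elim
      case (elim p)
      show ?case
      proof (cases "prime p")
        case True
        have "ln (real (least_nonvanishing p)) \<le> ln (ln (real p) powr k)"
          using elim True pos[OF True] by (subst ln_le_cancel_iff) auto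
        also have "\<dots> = k * ln (ln (real p))" using elim by (simp add: ln_powr)
        finally have "x p \<le> k" unfolding x_def using elim by (simp add: field_simps)
        then show ?thesis using True k c by (simp add: e_def)
      qed (use c in \<open>simp add: e_def\<close>)
    qed
  qed
  then have "e \<in> o(\<lambda>_. 1)" by (rule landau_o.smallI)
  moreover have "\<forall>\<^sub>F p in sequentially. prime p \<longrightarrow>
       real (least_nonvanishing p) \<le> ln (real p) powr (131 / 72 + e p)"
    using L
  proof eventually_elim
    case (elim p)
    show ?case
    proof
      assume p: "prime p"
      have "real (least_nonvanishing p) = exp (x p * ln (ln (real p)))"
        using elim pos[OF p] by (simp add: x_def)
      also have "\<dots> \<le> exp ((131 / 72 + e p) * ln (ln (real p)))"
        using elim p by (simp add: e_def)
      also have "\<dots> = ln (real p) powr (131 / 72 + e p)" using elim by (simp add: powr_def)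
      finally show "real (least_nonvanishing p) \<le> ln (real p) powr (131 / 72 + e p)" .
    qed
  qed
  ultimately show ?thesis by blast
qed

end
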